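(* Suppose $G$ is an ordered groupoid and let $\mathcal{A}$ be a $G$-module. Then there are natural isomorphisms $H^n(E(G),\mathcal{A}) \cong \operatorname{Ext}_{\mathfrak{L}(G)}^n(\mathbb{Z} G,\mathcal{A})$ for all $n\geq 0$.
   Context: **Ordered groupoids.** A groupoid $G$ is a small category with all morphisms invertible, composed left to right; identities are identified with objects and form the set $G_0$. For an arrow $g$, $g\mathbf d=gg^{-1}$ is its start and $g\mathbf r=g^{-1}g$ its end. An ordered groupoid is a groupoid with a partial order $\leq$ on arrows such that: (OG1) $x\leq y\Rightarrow x^{-1}\leq y^{-1}$; (OG2) if $x\leq y$, $u\leq v$ and $xu,yv$ exist then $xu\leq yv$; (OG3) if $e\in G_0$, $e\leq x\mathbf d$, there is a unique $(e|x)\leq x$ with $(e|x)\mathbf d=e$ (restriction); (OG4) if $e\in G_0$, $e\leq x\mathbf r$, there is a unique $(x|e)\leq x$ with $(x|e)\mathbf r=e$ (corestriction). **Modules.** $\mathfrak L(G)$ is the category with objects $G_0$ and morphisms $(e,g)$, $e\in G_0$, $g\in G$, $g\mathbf d\leq e$, from $e$ to $g\mathbf r$, with $(e,g)(f,h)=(e,(g|h\mathbf d)h)$ when $g\mathbf r=f$. A $G$-module is a functor $\mathcal A:\mathfrak L(G)\to\mathbf{Ab}$, $e\mapsto A_e$; $\operatorname{Mod}_{\mathfrak L(G)}$ is the category of $G$-modules and natural transformations, and $\operatorname{Ext}_{\mathfrak L(G)}$ is computed there. **Restriction to identities.** $E(G)$ denotes the poset $G_0$ viewed as a category with a unique morphism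 $x\to y$ whenever $x\geq y$; it equals $\mathfrak L(G_0)$ and embeds in $\mathfrak L(G)$, via which $G$-modules restrict to $E(G)$-modules (functors $E(G)\to\mathbf{Ab}$). $H^n(E(G),\mathcal A)=\operatorname{Ext}^n_{E(G)}(\Delta\mathbb Z,\mathcal A|_{E(G)})$, computed in the category of functors $E(G)\to\mathbf{Ab}$, where $\Delta\mathbb Z$ is the constant functor at $\mathbb Z$. **Adjoint module.** $\mathbb ZG$ is the $G$-module with $(\mathbb ZG)_e$ the free abelian group on $\{g\in G:g^{-1}g=e\}$; an arrow $g\in G(e,y)$ induces $(\mathbb ZG)_e\to(\mathbb ZG)_y$, $h\mapsto hg$, and for identities $f\leq e$ the morphism $(e,f)$ induces $(\mathbb ZG)_e\to(\mathbb ZG)_f$, $g\mapsto(g|f)$. *)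

theory Defs
  imports "HOL-Algebra.Free_Abelian_Groups"
begin

section \<open>Small categories\<close>

text \<open>Composition is written in diagrammatic order: \<open>f \<cdot> g\<close> is \<open>f\<close> followed by \<open>g\<close>, and is
  meaningful only if \<open>Cod f = Dom g\<close>.\<close>

record ('o, 'm) cat =
  Ob   :: "'o set"
  Arr  :: "'m set"
  Dom  :: "'m \<Rightarrow> 'o"
  Cod  :: "'m \<Rightarrow> 'o"
  Idn  :: "'o \<Rightarrow> 'm"
  Cmp  :: "'m \<Rightarrow> 'm \<Rightarrow> 'm"  (infixl \<open>\<cdot>\<index>\<close> 70)

locale small_category =
  fixes C :: "('o, 'm, 'z) cat_scheme" (structure)
  assumes Dom_in [simp, intro]: "f \<in> Arr C \<Longrightarrow> Dom C f \<in> Ob C"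
    and Cod_in [simp, intro]: "f \<in> Arr C \<Longrightarrow> Cod C f \<in> Ob C"
    and Idn_in [simp, intro]: "x \<in> Ob C \<Longrightarrow> Idn C x \<in> Arr C"
    and Dom_Idn [simp]: "x \<in> Ob C \<Longrightarrow> Dom C (Idn C x) = x"
    and Cod_Idn [simp]: "x \<in> Ob C \<Longrightarrow> Cod C (Idn C x) = x"
    and Cmp_in [simp, intro]: "\<lbrakk>f \<in> Arr C; g \<in> Arr C; Cod C f = Dom C g\<rbrakk> \<Longrightarrow> f \<cdot> g \<in> Arr C"
    and Dom_Cmp [simp]: "\<lbrakk>f \<in> Arr C; g \<in> Arr C; Cod C f = Dom C g\<rbrakk> \<Longrightarrow> Dom C (f \<cdot> g) = Dom C f"
    and Cod_Cmp [simp]: "\<lbrakk>f \<in> Arr C; g \<in> Arr C; Cod C f = Dom C g\<rbrakk> \<Longrightarrow> Cod C (f \<cdot> g) = Cod C g"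
    and Idn_left [simp]: "f \<in> Arr C \<Longrightarrow> Idn C (Dom C f) \<cdot> f = f"
    and Idn_right [simp]: "f \<in> Arr C \<Longrightarrow> f \<cdot> Idn C (Cod C f) = f"
    and Cmp_assoc: "\<lbrakk>f \<in> Arr C; g \<in> Arr C; h \<in> Arr C; Cod C f = Dom C g; Cod C g = Dom C h\<rbrakk>
          \<Longrightarrow> (f \<cdot> g) \<cdot> h = f \<cdot> (g \<cdot> h)"


section \<open>Ordered groupoids\<close>

text \<open>Objects are identified with identity arrows, so both have the same type and
  \<open>Ob G\<close> is the set \<open>G\<^sub>0\<close> of identities.\<close>

record 'g ogpd = "('g, 'g) cat" +
  Leq :: "'g rel"

abbreviation leq_in :: "('g, 'z) ogpd_scheme \<Rightarrow> 'g \<Rightarrow> 'g \<Rightarrow> bool" (infix \<open>\<preceq>\<index>\<close> 50)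
  where "x \<preceq>\<^bsub>G\<^esub> y \<equiv> (x, y) \<in> Leq G"

definition ginv :: "('g, 'g, 'z) cat_scheme \<Rightarrow> 'g \<Rightarrow> 'g" where
  "ginv G x = (THE y. y \<in> Arr G \<and> Dom G y = Cod G x \<and> Cod G y = Dom G x \<and>
      Cmp G x y = Idn G (Dom G x) \<and> Cmp G y x = Idn G (Cod G x))"

locale groupoid = small_category G for G :: "('g, 'g, 'z) cat_scheme" (structure) +
  assumes Idn_ident [simp]: "e \<in> Ob G \<Longrightarrow> Idn G e = e"
    and invertible: "x \<in> Arr G \<Longrightarrow> \<exists>y \<in> Arr G. Dom G y = Cod G x \<and> Cod G y = Dom G x \<and>
          x \<cdot> y = Idn G (Dom G x) \<and> y \<cdot> x = Idn G (Cod G x)"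

locale ordered_groupoid = groupoid G for G :: "'g ogpd" (structure) +
  assumes order: "partial_order_on (Arr G) (Leq G)"
    and OG1: "x \<preceq> y \<Longrightarrow> ginv G x \<preceq> ginv G y"
    and OG2: "\<lbrakk>x \<preceq> y; u \<preceq> v; Cod G x = Dom G u; Cod G y = Dom G v\<rbrakk> \<Longrightarrow> x \<cdot> u \<preceq> y \<cdot> v"
    and OG3: "\<lbrakk>x \<in> Arr G; e \<in> Ob G; e \<preceq> Dom G x\<rbrakk> \<Longrightarrow> \<exists>!y. y \<preceq> x \<and> Dom G y = e"
    and OG4: "\<lbrakk>x \<in> Arr G; e \<in> Ob G; e \<preceq> Cod G x\<rbrakk> \<Longrightarrow> \<exists>!y. y \<preceq> x \<and> Cod G y = e"

definition corestr :: "'g ogpd \<Rightarrow> 'g \<Rightarrow> 'g \<Rightarrow> 'g" where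
  "corestr G x e = (THE y. y \<preceq>\<^bsub>G\<^esub> x \<and> Cod G y = e)"

definition Lcat :: "'g ogpd \<Rightarrow> ('g, 'g \<times> 'g) cat" where
  "Lcat G = \<lparr>
     Ob = Ob G,
     Arr = {(e, g). e \<in> Ob G \<and> g \<in> Arr G \<and> Dom G g \<preceq>\<^bsub>G\<^esub> e},
     Dom = (\<lambda>(e, g). e),
     Cod = (\<lambda>(e, g). Cod G g),
     Idn = (\<lambda>e. (e, e)),
     Cmp = (\<lambda>(e, g) (f, h). (e, Cmp G (corestr G g (Dom G h)) h))\<rparr>"

text \<open>The arrow \<open>x \<rightarrow> y\<close> of the poset category \<open>E(G)\<close> is the pair \<open>(x, y)\<close>.\<close>

definition Ecat :: "'g ogpd \<Rightarrow> ('g, 'g \<times> 'g) cat" where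
  "Ecat G = \<lparr>
     Ob = Ob G,
     Arr = {(x, y). x \<in> Ob G \<and> y \<in> Ob G \<and> y \<preceq>\<^bsub>G\<^esub> x},
     Dom = (\<lambda>(x, y). x),
     Cod = (\<lambda>(x, y). y),
     Idn = (\<lambda>x. (x, x)),
     Cmp = (\<lambda>(x, y) (y', z). (x, z))\<rparr>"


section \<open>Functors to abelian groups\<close>

text \<open>A functor \<open>C \<rightarrow> Ab\<close>; abelian groups are multiplicatively written commutative groups
  with carriers contained in the type \<open>'a\<close>.\<close>

record ('o, 'm, 'a) cmod =
  obm :: "'o \<Rightarrow> 'a monoid"
  arm :: "'m \<Rightarrow> 'a \<Rightarrow> 'a"

locale cat_module = small_category C for C :: "('o, 'm) cat" (structure) +
  fixes M :: "('o, 'm, 'a) cmod"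
  assumes obm_group: "x \<in> Ob C \<Longrightarrow> comm_group (obm M x)"
    and arm_hom: "f \<in> Arr C \<Longrightarrow> arm M f \<in> hom (obm M (Dom C f)) (obm M (Cod C f))"
    and arm_Idn: "\<lbrakk>x \<in> Ob C; a \<in> carrier (obm M x)\<rbrakk> \<Longrightarrow> arm M (Idn C x) a = a"
    and arm_Cmp: "\<lbrakk>f \<in> Arr C; g \<in> Arr C; Cod C f = Dom C g; a \<in> carrier (obm M (Dom C f))\<rbrakk>
          \<Longrightarrow> arm M (f \<cdot> g) a = arm M g (arm M f a)"

text \<open>Natural transformations, made extensional so that equality of functions is equality
  of natural transformations.\<close>

definition nat_trans ::
  "('o, 'm) cat \<Rightarrow> ('o, 'm, 'a) cmod \<Rightarrow> ('o, 'm, 'b) cmod \<Rightarrow> ('o \<Rightarrow> 'a \<Rightarrow> 'b) set" where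
  "nat_trans C M N = {\<eta> \<in> extensional (Ob C).
     (\<forall>x \<in> Ob C. \<eta> x \<in> extensional (carrier (obm M x)) \<and> \<eta> x \<in> hom (obm M x) (obm N x)) \<and>
     (\<forall>f \<in> Arr C. \<forall>a \<in> carrier (obm M (Dom C f)).
        \<eta> (Cod C f) (arm M f a) = arm N f (\<eta> (Dom C f) a))}"

text \<open>The composite of \<open>\<eta>\<close>, with source \<open>M\<close>, followed by \<open>\<theta>\<close>.\<close>

definition nt_comp ::
  "('o, 'm) cat \<Rightarrow> ('o, 'm, 'a) cmod \<Rightarrow> ('o \<Rightarrow> 'b \<Rightarrow> 'c) \<Rightarrow> ('o \<Rightarrow> 'a \<Rightarrow> 'b) \<Rightarrow> 'o \<Rightarrow> 'a \<Rightarrow> 'c" where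
  "nt_comp C M \<theta> \<eta> = (\<lambda>x \<in> Ob C. compose (carrier (obm M x)) (\<theta> x) (\<eta> x))"

definition Hom_group ::
  "('o, 'm) cat \<Rightarrow> ('o, 'm, 'a) cmod \<Rightarrow> ('o, 'm, 'b) cmod \<Rightarrow> ('o \<Rightarrow> 'a \<Rightarrow> 'b) monoid" where
  "Hom_group C M N = \<lparr>
     carrier = nat_trans C M N,
     monoid.mult = (\<lambda>\<eta> \<theta>. \<lambda>x \<in> Ob C. \<lambda>a \<in> carrier (obm M x). \<eta> x a \<otimes>\<^bsub>obm N x\<^esub> \<theta> x a),
     one = (\<lambda>x \<in> Ob C. \<lambda>a \<in> carrier (obm M x). \<one>\<^bsub>obm N x\<^esub>)\<rparr>"


section \<open>Ext in categories of functors to abelian groups\<close>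

text \<open>Projective objects of the category of functors from \<open>C\<close> to abelian groups with carrier
  in \<open>'u\<close>. If \<open>'u\<close> is infinite and at least as large as the type of arrows, then the free
  \<open>C\<close>-modules on subsets of \<open>'u\<close> have copies with carrier in \<open>'u\<close>; hence projectives in
  this sense are direct summands of free modules, and they have the lifting property for
  modules over arbitrary carrier types.\<close>

definition projective_mod :: "('o, 'm) cat \<Rightarrow> ('o, 'm, 'u) cmod \<Rightarrow> bool" where
  "projective_mod C P \<longleftrightarrow> cat_module C P \<and>
     (\<forall>(N :: ('o, 'm, 'u) cmod) (N' :: ('o, 'm, 'u) cmod) \<pi> \<phi>.
        cat_module C N \<longrightarrow> cat_module C N' \<longrightarrow>
        \<pi> \<in> nat_trans C N N' \<longrightarrow> (\<forall>x \<in> Ob C. \<pi> x ` carrier (obm N x) = carrier (obm N' x)) \<longrightarrow>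
        \<phi> \<in> nat_trans C P N' \<longrightarrow>
        (\<exists>\<psi> \<in> nat_trans C P N. nt_comp C P \<pi> \<psi> = \<phi>))"

text \<open>The sequence \<open>\<dots> \<rightarrow> P 2 \<rightarrow> P 1 \<rightarrow> P 0 \<rightarrow> M \<rightarrow> 0\<close> with differentials \<open>d n : P (n + 1) \<rightarrow> P n\<close>
  and augmentation \<open>\<epsilon>\<close> is exact, and every \<open>P n\<close> is projective.\<close>

definition projective_resolution ::
  "('o, 'm) cat \<Rightarrow> ('o, 'm, 'b) cmod \<Rightarrow> (nat \<Rightarrow> ('o, 'm, 'u) cmod) \<Rightarrow>
   (nat \<Rightarrow> 'o \<Rightarrow> 'u \<Rightarrow> 'u) \<Rightarrow> ('o \<Rightarrow> 'u \<Rightarrow> 'b) \<Rightarrow> bool" where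
  "projective_resolution C M P d \<epsilon> \<longleftrightarrow>
     (\<forall>n. projective_mod C (P n)) \<and>
     (\<forall>n. d n \<in> nat_trans C (P (Suc n)) (P n)) \<and>
     \<epsilon> \<in> nat_trans C (P 0) M \<and>
     (\<forall>x \<in> Ob C.
        \<epsilon> x ` carrier (obm (P 0) x) = carrier (obm M x) \<and>
        d 0 x ` carrier (obm (P 1) x) = kernel (obm (P 0) x) (obm M x) (\<epsilon> x) \<and>
        (\<forall>n. d (Suc n) x ` carrier (obm (P (Suc (Suc n))) x)
               = kernel (obm (P (Suc n)) x) (obm (P n) x) (d n x)))"

text \<open>A carrier type large enough for free resolutions of modules with carrier in \<open>'b\<close>: it is
  infinite and at least as large as \<open>'m\<close> and \<open>'b\<close>.\<close>

type_synonym ('m, 'b) res_carrier = "('m + 'b + nat) list"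

definition chosen_resolution ::
  "('o, 'm) cat \<Rightarrow> ('o, 'm, 'b) cmod \<Rightarrow>
   (nat \<Rightarrow> ('o, 'm, ('m, 'b) res_carrier) cmod) \<times>
   (nat \<Rightarrow> 'o \<Rightarrow> ('m, 'b) res_carrier \<Rightarrow> ('m, 'b) res_carrier)" where
  "chosen_resolution C M = (SOME (P, d). \<exists>\<epsilon>. projective_resolution C M P d \<epsilon>)"

definition res_mod ::
  "('o, 'm) cat \<Rightarrow> ('o, 'm, 'b) cmod \<Rightarrow> nat \<Rightarrow> ('o, 'm, ('m, 'b) res_carrier) cmod" where
  "res_mod C M = fst (chosen_resolution C M)"

definition res_diff ::
  "('o, 'm) cat \<Rightarrow> ('o, 'm, 'b) cmod \<Rightarrow> nat \<Rightarrow>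
   'o \<Rightarrow> ('m, 'b) res_carrier \<Rightarrow> ('m, 'b) res_carrier" where
  "res_diff C M = snd (chosen_resolution C M)"

text \<open>The cochain complex \<open>Hom(P n, A)\<close> with coboundary \<open>f \<mapsto> f \<circ> d n\<close>.\<close>

definition cochains ::
  "('o, 'm) cat \<Rightarrow> ('o, 'm, 'b) cmod \<Rightarrow> ('o, 'm, 'a) cmod \<Rightarrow> nat \<Rightarrow>
   ('o \<Rightarrow> ('m, 'b) res_carrier \<Rightarrow> 'a) monoid" where
  "cochains C M A n = Hom_group C (res_mod C M n) A"

definition coboundary ::
  "('o, 'm) cat \<Rightarrow> ('o, 'm, 'b) cmod \<Rightarrow> nat \<Rightarrow>
   ('o \<Rightarrow> ('m, 'b) res_carrier \<Rightarrow> 'a) \<Rightarrow> 'o \<Rightarrow> ('m, 'b) res_carrier \<Rightarrow> 'a" where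
  "coboundary C M n f = nt_comp C (res_mod C M (Suc n)) f (res_diff C M n)"

definition cocycles ::
  "('o, 'm) cat \<Rightarrow> ('o, 'm, 'b) cmod \<Rightarrow> ('o, 'm, 'a) cmod \<Rightarrow> nat \<Rightarrow>
   ('o \<Rightarrow> ('m, 'b) res_carrier \<Rightarrow> 'a) set" where
  "cocycles C M A n = kernel (cochains C M A n) (cochains C M A (Suc n)) (coboundary C M n)"

fun coboundaries ::
  "('o, 'm) cat \<Rightarrow> ('o, 'm, 'b) cmod \<Rightarrow> ('o, 'm, 'a) cmod \<Rightarrow> nat \<Rightarrow>
   ('o \<Rightarrow> ('m, 'b) res_carrier \<Rightarrow> 'a) set" where
  "coboundaries C M A 0 = {\<one>\<^bsub>cochains C M A 0\<^esub>}"
| "coboundaries C M A (Suc n) = coboundary C M n ` carrier (cochains C M A n)"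

definition Ext ::
  "('o, 'm) cat \<Rightarrow> nat \<Rightarrow> ('o, 'm, 'b) cmod \<Rightarrow> ('o, 'm, 'a) cmod \<Rightarrow>
   ('o \<Rightarrow> ('m, 'b) res_carrier \<Rightarrow> 'a) set monoid" where
  "Ext C n M A = (cochains C M A n)\<lparr>carrier := cocycles C M A n\<rparr> Mod coboundaries C M A n"

text \<open>The map induced by \<open>\<alpha> : A \<rightarrow> A'\<close> sends the class of a cocycle \<open>f\<close> to the class of
  \<open>\<alpha> \<circ> f\<close>; classes are cosets of the coboundaries.\<close>

definition Ext_map ::
  "('o, 'm) cat \<Rightarrow> nat \<Rightarrow> ('o, 'm, 'b) cmod \<Rightarrow> ('o, 'm, 'a) cmod \<Rightarrow> ('o \<Rightarrow> 'a \<Rightarrow> 'a) \<Rightarrow>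
   ('o \<Rightarrow> ('m, 'b) res_carrier \<Rightarrow> 'a) set \<Rightarrow> ('o \<Rightarrow> ('m, 'b) res_carrier \<Rightarrow> 'a) set" where
  "Ext_map C n M A' \<alpha> X =
     coboundaries C M A' n <#>\<^bsub>cochains C M A' n\<^esub> (nt_comp C (res_mod C M n) \<alpha> ` X)"


section \<open>The modules and the cohomology of an ordered groupoid\<close>

definition const_Z :: "('o, 'm, int) cmod" where
  "const_Z = \<lparr>obm = (\<lambda>_. integer_group), arm = (\<lambda>_ a. a)\<rparr>"

text \<open>The embedding of \<open>E(G)\<close> in \<open>L(G)\<close> is the identity on objects.\<close>

definition E_embed :: "'g \<times> 'g \<Rightarrow> 'g \<times> 'g" where
  "E_embed = (\<lambda>(x, y). (x, y))"

definition restrict_E :: "('g, 'g \<times> 'g, 'a) cmod \<Rightarrow> ('g, 'g \<times> 'g, 'a) cmod" where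
  "restrict_E A = \<lparr>obm = obm A, arm = arm A \<circ> E_embed\<rparr>"

definition H_E :: "'g ogpd \<Rightarrow> nat \<Rightarrow> ('g, 'g \<times> 'g, 'a) cmod \<Rightarrow>
    ('g \<Rightarrow> ('g \<times> 'g, int) res_carrier \<Rightarrow> 'a) set monoid" where
  "H_E G n A = Ext (Ecat G) n const_Z (restrict_E A)"

text \<open>Restriction to \<open>E(G)\<close> does not change the components of a natural transformation.\<close>

definition H_E_map :: "'g ogpd \<Rightarrow> nat \<Rightarrow> ('g, 'g \<times> 'g, 'a) cmod \<Rightarrow> ('g \<Rightarrow> 'a \<Rightarrow> 'a) \<Rightarrow>
    ('g \<Rightarrow> ('g \<times> 'g, int) res_carrier \<Rightarrow> 'a) set \<Rightarrow>
    ('g \<Rightarrow> ('g \<times> 'g, int) res_carrier \<Rightarrow> 'a) set" where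
  "H_E_map G n A' \<alpha> = Ext_map (Ecat G) n const_Z (restrict_E A') \<alpha>"

text \<open>The arrow \<open>(e, g)\<close> factors as \<open>(e, Dom g)\<close> followed by \<open>(Dom g, g)\<close>, so it acts on basis
  elements by \<open>h \<mapsto> (h|Dom g) \<mapsto> (h|Dom g) \<cdot> g\<close>.\<close>

definition ZG :: "'g ogpd \<Rightarrow> ('g, 'g \<times> 'g, 'g \<Rightarrow>\<^sub>0 int) cmod" where
  "ZG G = \<lparr>
     obm = (\<lambda>e. free_Abelian_group {g \<in> Arr G. Cmp G (ginv G g) g = e}),
     arm = (\<lambda>(e, g). frag_extend (\<lambda>h. frag_of (Cmp G (corestr G h (Dom G g)) g)))\<rparr>"

end

theory Submission
  imports Defs
begin

text \<open>An arrow of \<open>Lcat G\<close> factors uniquely as a restriction \<open>(e, Dom g)\<close>, which belongs to \<open>Ecat G\<close>,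
  followed by \<open>(Dom g, g)\<close>, an arrow of the groupoid. Therefore restriction of modules from
  \<open>Lcat G\<close> to \<open>Ecat G\<close> has a left adjoint that is given pointwise by direct sums over groupoid
  arrows: it is exact, it preserves projectives because restriction is exact, and it sends
  \<open>const_Z\<close> to \<open>ZG G\<close>. Applied to a projective resolution of \<open>const_Z\<close> it gives one of
  \<open>ZG G\<close>, and the adjunction identifies the two complexes of homomorphisms into \<open>A\<close>.

  The proof carries this out for one explicit resolution, the bar resolution, which is built for
  both categories at once: for a set \<open>H\<close> of arrows of \<open>G\<close>, either all arrows or only the
  identities. The module \<open>bar n\<close> is spanned at \<open>y\<close> by pairs \<open>(\<sigma>, g)\<close> of a chain \<open>\<sigma>\<close> of
  \<open>n\<close> objects and an arrow \<open>g\<close> in \<open>H\<close> that ends at \<open>y\<close> and starts below \<open>\<sigma>\<close>; the boundary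
  acts on \<open>\<sigma>\<close> alone. Prepending \<open>Dom g\<close> to \<open>\<sigma>\<close> contracts this complex at each object
  (\<open>boundary_contraction\<close>, \<open>bar_exact\<close>), so that it resolves \<open>bar 0\<close>, the free abelian group on
  \<open>H\<close>. This is isomorphic to \<open>ZG G\<close> if \<open>H\<close> consists of all arrows and to \<open>const_Z\<close> if it
  consists of the identities. For \<open>n > 0\<close> the module \<open>bar n\<close> is free on the chains: a natural
  transformation out of it is given by arbitrary values at the pairs \<open>(\<sigma>, hd \<sigma>)\<close> (\<open>bar_nat_trans_eqI\<close>,
  \<open>bar_extension\<close>). These pairs involve identities only. Hence restricting a natural transformation
  from the large bar resolution to the small one loses nothing, and since it commutes with the
  boundary it is an isomorphism of cochain complexes (\<open>restrict_bar_bij\<close>,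
  \<open>restrict_bar_cochain_map\<close>).

  It remains to replace the bar resolutions by those that define \<open>Ext\<close>. Comparison maps in both
  directions are homotopy inverse to each other (\<open>resolutions_quasi_isomorphic\<close>). The modules
  involved have carriers in different types, so lifting properties are moved between types along
  injections (\<open>lifts_through_surjection\<close>, \<open>projective_lifts_from\<close>), and the bar resolution is
  moved along such an injection to see that a projective resolution in the required type exists at
  all (\<open>projective_resolution_transport\<close>, \<open>bar_carrier_embeds\<close>). The isomorphism is natural
  in \<open>A\<close> because each step is precomposition with a map that does not depend on \<open>A\<close>, or the inverse of
  such a step, while a module map \<open>\<alpha>\<close> acts by postcomposition.\<close>

section \<open>Cohomology of cochain complexes\<close>

locale cochain_complex =
  fixes K :: "nat \<Rightarrow> 'c monoid" and \<delta> :: "nat \<Rightarrow> 'c \<Rightarrow> 'c"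
  assumes cochain_group: "comm_group (K n)"
    and diff_hom: "\<delta> n \<in> hom (K n) (K (Suc n))"
    and diff_diff: "x \<in> carrier (K n) \<Longrightarrow> \<delta> (Suc n) (\<delta> n x) = \<one>\<^bsub>K (Suc (Suc n))\<^esub>"

definition cocycle_set :: "(nat \<Rightarrow> 'c monoid) \<Rightarrow> (nat \<Rightarrow> 'c \<Rightarrow> 'c) \<Rightarrow> nat \<Rightarrow> 'c set" where
  "cocycle_set K \<delta> n = kernel (K n) (K (Suc n)) (\<delta> n)"

fun coboundary_set :: "(nat \<Rightarrow> 'c monoid) \<Rightarrow> (nat \<Rightarrow> 'c \<Rightarrow> 'c) \<Rightarrow> nat \<Rightarrow> 'c set" where
  "coboundary_set K \<delta> 0 = {\<one>\<^bsub>K 0\<^esub>}"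
| "coboundary_set K \<delta> (Suc n) = \<delta> n ` carrier (K n)"

definition cohomology :: "(nat \<Rightarrow> 'c monoid) \<Rightarrow> (nat \<Rightarrow> 'c \<Rightarrow> 'c) \<Rightarrow> nat \<Rightarrow> 'c set monoid" where
  "cohomology K \<delta> n = (K n)\<lparr>carrier := cocycle_set K \<delta> n\<rparr> Mod coboundary_set K \<delta> n"

text \<open>The product with the coboundaries enlarges the image of a coset to a full coset, also where
  \<open>f n\<close> does not map onto the coboundaries of the target.\<close>

definition cohomology_map ::
  "(nat \<Rightarrow> 'd monoid) \<Rightarrow> (nat \<Rightarrow> 'd \<Rightarrow> 'd) \<Rightarrow> (nat \<Rightarrow> 'c \<Rightarrow> 'd) \<Rightarrow> nat \<Rightarrow> 'c set \<Rightarrow> 'd set" where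
  "cohomology_map K' \<delta>' f n X = coboundary_set K' \<delta>' n <#>\<^bsub>K' n\<^esub> (f n ` X)"

context cochain_complex
begin

lemma cochain_group_is_group: "group (K n)"
  using cochain_group by (simp add: comm_group_def)

lemma diff_group_hom: "group_hom (K n) (K (Suc n)) (\<delta> n)"
  using diff_hom cochain_group_is_group by (simp add: group_hom_def group_hom_axioms_def)

lemma diff_closed: "x \<in> carrier (K n) \<Longrightarrow> \<delta> n x \<in> carrier (K (Suc n))"
  using diff_hom hom_carrier by blast

lemma cocycle_iff:
  "z \<in> cocycle_set K \<delta> n \<longleftrightarrow> z \<in> carrier (K n) \<and> \<delta> n z = \<one>\<^bsub>K (Suc n)\<^esub>"
  by (simp add: cocycle_set_def kernel_def)

lemma subgroup_cocycles: "subgroup (cocycle_set K \<delta> n) (K n)"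
  unfolding cocycle_set_def by (rule group_hom.subgroup_kernel[OF diff_group_hom])

lemma subgroup_coboundaries: "subgroup (coboundary_set K \<delta> n) (K n)"
proof (cases n)
  case 0
  then show ?thesis
    using group.triv_subgroup[OF cochain_group_is_group] by simp
next
  case (Suc m)
  then show ?thesis
    using group_hom.img_is_subgroup[OF diff_group_hom[of m]] by simp
qed

lemma carrier_cohomology:
  "carrier (cohomology K \<delta> n) = (\<lambda>z. coboundary_set K \<delta> n #>\<^bsub>K n\<^esub> z) ` cocycle_set K \<delta> n"
  by (simp add: cohomology_def carrier_FactGroup r_coset_def)

lemma mult_cohomology: "monoid.mult (cohomology K \<delta> n) = set_mult (K n)"
  by (simp add: cohomology_def set_mult_def fun_eq_iff)

lemma coset_mult:
  assumes "z \<in> carrier (K n)" "w \<in> carrier (K n)"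
  shows "(coboundary_set K \<delta> n #>\<^bsub>K n\<^esub> z) <#>\<^bsub>K n\<^esub> (coboundary_set K \<delta> n #>\<^bsub>K n\<^esub> w)
    = coboundary_set K \<delta> n #>\<^bsub>K n\<^esub> (z \<otimes>\<^bsub>K n\<^esub> w)"
proof -
  interpret comm_group "K n" by (rule cochain_group)
  have "coboundary_set K \<delta> n \<lhd> K n"
    using subgroup_coboundaries by (simp add: subgroup_imp_normal)
  then show ?thesis using assms by (rule normal.rcos_sum)
qed

lemma coset_eq_iff:
  assumes "z \<in> carrier (K n)" "w \<in> carrier (K n)"
  shows "coboundary_set K \<delta> n #>\<^bsub>K n\<^esub> z = coboundary_set K \<delta> n #>\<^bsub>K n\<^esub> w
    \<longleftrightarrow> z \<otimes>\<^bsub>K n\<^esub> inv\<^bsub>K n\<^esub> w \<in> coboundary_set K \<delta> n"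
proof -
  interpret comm_group "K n" by (rule cochain_group)
  note sub = subgroup_coboundaries[of n]
  show ?thesis
  proof
    assume "coboundary_set K \<delta> n #>\<^bsub>K n\<^esub> z = coboundary_set K \<delta> n #>\<^bsub>K n\<^esub> w"
    then have "z \<in> coboundary_set K \<delta> n #>\<^bsub>K n\<^esub> w"
      using rcos_self[OF assms(1) sub] by simp
    then obtain b where "b \<in> coboundary_set K \<delta> n" "z = b \<otimes>\<^bsub>K n\<^esub> w"
      by (auto simp: r_coset_def)
    moreover have "b \<in> carrier (K n)" using calculation subgroup.subset[OF sub] by blast
    ultimately show "z \<otimes>\<^bsub>K n\<^esub> inv\<^bsub>K n\<^esub> w \<in> coboundary_set K \<delta> n"
      using assms by (simp add: m_assoc)
  next
    assume b: "z \<otimes>\<^bsub>K n\<^esub> inv\<^bsub>K n\<^esub> w \<in> coboundary_set K \<delta> n"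
    have "z = (z \<otimes>\<^bsub>K n\<^esub> inv\<^bsub>K n\<^esub> w) \<otimes>\<^bsub>K n\<^esub> w" using assms by (simp add: m_assoc)
    then have "z \<in> coboundary_set K \<delta> n #>\<^bsub>K n\<^esub> w"
      using b by (auto simp: r_coset_def)
    then show "coboundary_set K \<delta> n #>\<^bsub>K n\<^esub> z = coboundary_set K \<delta> n #>\<^bsub>K n\<^esub> w"
      using repr_independence[OF _ assms(2) sub, of z] by simp
  qed
qed

end

locale cochain_map = K: cochain_complex K \<delta> + K': cochain_complex K' \<delta>'
  for K :: "nat \<Rightarrow> 'c monoid" and \<delta> and K' :: "nat \<Rightarrow> 'd monoid" and \<delta>' +
  fixes f :: "nat \<Rightarrow> 'c \<Rightarrow> 'd"
  assumes map_hom: "f n \<in> hom (K n) (K' n)"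
    and map_diff: "x \<in> carrier (K n) \<Longrightarrow> f (Suc n) (\<delta> n x) = \<delta>' n (f n x)"
begin

lemma map_group_hom: "group_hom (K n) (K' n) (f n)"
  using map_hom K.cochain_group_is_group K'.cochain_group_is_group
  by (simp add: group_hom_def group_hom_axioms_def)

lemma map_closed: "x \<in> carrier (K n) \<Longrightarrow> f n x \<in> carrier (K' n)"
  using map_hom hom_carrier by blast

lemma map_one: "f n \<one>\<^bsub>K n\<^esub> = \<one>\<^bsub>K' n\<^esub>"
  by (rule group_hom.hom_one[OF map_group_hom])

lemma map_cocycle: "z \<in> cocycle_set K \<delta> n \<Longrightarrow> f n z \<in> cocycle_set K' \<delta>' n"
  using map_diff[of z n] map_one[of "Suc n"] map_closed[of z n]
  unfolding K.cocycle_iff K'.cocycle_iff by simp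

lemma map_coboundary: "b \<in> coboundary_set K \<delta> n \<Longrightarrow> f n b \<in> coboundary_set K' \<delta>' n"
proof (cases n)
  case 0
  assume "b \<in> coboundary_set K \<delta> n"
  with 0 show ?thesis by (simp add: map_one)
next
  case (Suc m)
  assume "b \<in> coboundary_set K \<delta> n"
  with Suc obtain c where "c \<in> carrier (K m)" "b = \<delta> m c" by auto
  with Suc show ?thesis using map_diff[of c m] map_closed[of c m] by simp
qed

lemma cohomology_map_coset:
  assumes z: "z \<in> carrier (K n)"
  shows "cohomology_map K' \<delta>' f n (coboundary_set K \<delta> n #>\<^bsub>K n\<^esub> z)
      = coboundary_set K' \<delta>' n #>\<^bsub>K' n\<^esub> f n z"
    (is "?l = ?r")
proof -
  interpret G: comm_group "K n" by (rule K.cochain_group)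
  interpret G': comm_group "K' n" by (rule K'.cochain_group)
  note B = subgroup.subset[OF K.subgroup_coboundaries] subgroup.subset[OF K'.subgroup_coboundaries]
  show ?thesis
  proof
    show "?l \<subseteq> ?r"
    proof
      fix y assume "y \<in> ?l"
      then obtain b' b where *: "b' \<in> coboundary_set K' \<delta>' n" "b \<in> coboundary_set K \<delta> n"
        "y = b' \<otimes>\<^bsub>K' n\<^esub> f n (b \<otimes>\<^bsub>K n\<^esub> z)"
        by (auto simp: cohomology_map_def set_mult_def r_coset_def)
      have "y = (b' \<otimes>\<^bsub>K' n\<^esub> f n b) \<otimes>\<^bsub>K' n\<^esub> f n z"
        using * B z map_closed hom_mult[OF map_hom] by (auto simp: subset_iff G'.m_assoc)
      then show "y \<in> ?r"
        using subgroup.m_closed[OF K'.subgroup_coboundaries *(1) map_coboundary[OF *(2)]]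
        by (auto simp: r_coset_def)
    qed
    show "?r \<subseteq> ?l"
    proof
      fix y assume "y \<in> ?r"
      then obtain b' where "b' \<in> coboundary_set K' \<delta>' n" "y = b' \<otimes>\<^bsub>K' n\<^esub> f n z"
        by (auto simp: r_coset_def)
      then show "y \<in> ?l"
        using G.rcos_self[OF z K.subgroup_coboundaries]
        by (auto simp: cohomology_map_def set_mult_def)
    qed
  qed
qed

lemma cohomology_map_hom: "cohomology_map K' \<delta>' f n \<in> hom (cohomology K \<delta> n) (cohomology K' \<delta>' n)"
proof (rule homI)
  fix X assume "X \<in> carrier (cohomology K \<delta> n)"
  then obtain z where z: "z \<in> cocycle_set K \<delta> n" and X: "X = coboundary_set K \<delta> n #>\<^bsub>K n\<^esub> z"
    unfolding K.carrier_cohomology by blast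
  then have zc: "z \<in> carrier (K n)" by (simp add: K.cocycle_iff)
  show "cohomology_map K' \<delta>' f n X \<in> carrier (cohomology K' \<delta>' n)"
    unfolding X cohomology_map_coset[OF zc] K'.carrier_cohomology using map_cocycle[OF z] by blast
  fix Y assume "Y \<in> carrier (cohomology K \<delta> n)"
  then obtain w where "w \<in> cocycle_set K \<delta> n" and Y: "Y = coboundary_set K \<delta> n #>\<^bsub>K n\<^esub> w"
    unfolding K.carrier_cohomology by blast
  then have wc: "w \<in> carrier (K n)" by (simp add: K.cocycle_iff)
  have zw: "z \<otimes>\<^bsub>K n\<^esub> w \<in> carrier (K n)"
    using zc wc group_hom.axioms(1)[OF map_group_hom] by (simp add: group.is_monoid monoid.m_closed)
  show "cohomology_map K' \<delta>' f n (X \<otimes>\<^bsub>cohomology K \<delta> n\<^esub> Y)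
      = cohomology_map K' \<delta>' f n X \<otimes>\<^bsub>cohomology K' \<delta>' n\<^esub> cohomology_map K' \<delta>' f n Y"
    unfolding X Y K.mult_cohomology K'.mult_cohomology K.coset_mult[OF zc wc]
      cohomology_map_coset[OF zw] cohomology_map_coset[OF zc] cohomology_map_coset[OF wc]
      K'.coset_mult[OF map_closed[OF zc] map_closed[OF wc]]
    by (simp add: hom_mult[OF map_hom zc wc])
qed

end

text \<open>The two conditions express injectivity and surjectivity on cohomology by cocycles, so that they
  can be verified and composed before passing to cosets.\<close>

locale quasi_isomorphism = cochain_map K \<delta> K' \<delta>' f
  for K :: "nat \<Rightarrow> 'c monoid" and \<delta> and K' :: "nat \<Rightarrow> 'd monoid" and \<delta>' f +
  assumes reflects_coboundaries:
      "z \<in> cocycle_set K \<delta> n \<Longrightarrow> f n z \<in> coboundary_set K' \<delta>' n \<Longrightarrow> z \<in> coboundary_set K \<delta> n"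
    and hits_cocycles:
      "z' \<in> cocycle_set K' \<delta>' n \<Longrightarrow>
        \<exists>z \<in> cocycle_set K \<delta> n. f n z \<otimes>\<^bsub>K' n\<^esub> inv\<^bsub>K' n\<^esub> z' \<in> coboundary_set K' \<delta>' n"
begin

lemma cohomology_map_iso: "cohomology_map K' \<delta>' f n \<in> iso (cohomology K \<delta> n) (cohomology K' \<delta>' n)"
proof -
  interpret G: comm_group "K n" by (rule K.cochain_group)
  interpret G': comm_group "K' n" by (rule K'.cochain_group)
  interpret f: group_hom "K n" "K' n" "f n" by (rule map_group_hom)
  have inj: "inj_on (cohomology_map K' \<delta>' f n) (carrier (cohomology K \<delta> n))"
  proof (rule inj_onI)
    fix X Y assume XY: "X \<in> carrier (cohomology K \<delta> n)" "Y \<in> carrier (cohomology K \<delta> n)"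
      and eq: "cohomology_map K' \<delta>' f n X = cohomology_map K' \<delta>' f n Y"
    from XY obtain z w where zw: "z \<in> cocycle_set K \<delta> n" "w \<in> cocycle_set K \<delta> n"
      "X = coboundary_set K \<delta> n #>\<^bsub>K n\<^esub> z" "Y = coboundary_set K \<delta> n #>\<^bsub>K n\<^esub> w"
      by (auto simp: K.carrier_cohomology)
    have c: "z \<in> carrier (K n)" "w \<in> carrier (K n)" using zw by (auto simp: K.cocycle_iff)
    have "f n z \<otimes>\<^bsub>K' n\<^esub> inv\<^bsub>K' n\<^esub> f n w \<in> coboundary_set K' \<delta>' n"
      using eq c unfolding zw cohomology_map_coset[OF c(1)] cohomology_map_coset[OF c(2)]
      by (subst (asm) K'.coset_eq_iff) (auto intro: map_closed)
    then have "f n (z \<otimes>\<^bsub>K n\<^esub> inv\<^bsub>K n\<^esub> w) \<in> coboundary_set K' \<delta>' n" using c by simp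
    moreover have "z \<otimes>\<^bsub>K n\<^esub> inv\<^bsub>K n\<^esub> w \<in> cocycle_set K \<delta> n"
      using zw K.subgroup_cocycles by (simp add: subgroup.m_closed subgroup.m_inv_closed)
    ultimately show "X = Y"
      using reflects_coboundaries c by (simp add: zw K.coset_eq_iff)
  qed
  have surj: "X' \<in> cohomology_map K' \<delta>' f n ` carrier (cohomology K \<delta> n)"
    if X': "X' \<in> carrier (cohomology K' \<delta>' n)" for X'
  proof -
    obtain z' where z': "z' \<in> cocycle_set K' \<delta>' n" "X' = coboundary_set K' \<delta>' n #>\<^bsub>K' n\<^esub> z'"
      using X' by (auto simp: K'.carrier_cohomology)
    obtain z where z: "z \<in> cocycle_set K \<delta> n"
      "f n z \<otimes>\<^bsub>K' n\<^esub> inv\<^bsub>K' n\<^esub> z' \<in> coboundary_set K' \<delta>' n"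
      using hits_cocycles z' by blast
    have c: "z \<in> carrier (K n)" "z' \<in> carrier (K' n)"
      using z z' by (auto simp: K.cocycle_iff K'.cocycle_iff)
    have "cohomology_map K' \<delta>' f n (coboundary_set K \<delta> n #>\<^bsub>K n\<^esub> z) = X'"
      unfolding z'(2) cohomology_map_coset[OF c(1)]
      using K'.coset_eq_iff[OF map_closed[OF c(1)] c(2)] z(2) by simp
    moreover have "coboundary_set K \<delta> n #>\<^bsub>K n\<^esub> z \<in> carrier (cohomology K \<delta> n)"
      using z(1) by (auto simp: K.carrier_cohomology)
    ultimately show ?thesis by blast
  qed
  have "cohomology_map K' \<delta>' f n ` carrier (cohomology K \<delta> n) = carrier (cohomology K' \<delta>' n)"
    using surj hom_carrier[OF cohomology_map_hom] by blast
  then show ?thesis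
    using inj cohomology_map_hom unfolding iso_def bij_betw_def by blast
qed

end

text \<open>A degreewise bijective cochain map is an isomorphism of complexes. It is the inverse that gets
  used: homomorphisms are extended from the small bar resolution to the large one.\<close>

lemma inverse_quasi_isomorphism:
  assumes "cochain_map K \<delta> K' \<delta>' f" and bij: "\<And>n. bij_betw (f n) (carrier (K n)) (carrier (K' n))"
  shows "quasi_isomorphism K' \<delta>' K \<delta> (\<lambda>n. inv_into (carrier (K n)) (f n))"
proof -
  interpret f: cochain_map K \<delta> K' \<delta>' f by fact
  let ?g = "\<lambda>n. inv_into (carrier (K n)) (f n)"
  have gf: "?g n (f n x) = x" if "x \<in> carrier (K n)" for n x
    using that bij_betw_inv_into_left[OF bij] by simp
  have fg: "f n (?g n y) = y" if "y \<in> carrier (K' n)" for n y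
    using that bij_betw_inv_into_right[OF bij] by simp
  have iso: "f n \<in> iso (K n) (K' n)" for n
    using f.map_hom bij by (simp add: iso_def)
  have g_hom: "?g n \<in> hom (K' n) (K n)" for n
    using group.iso_set_sym[OF f.K.cochain_group_is_group iso] by (simp add: iso_def)
  interpret g: cochain_map K' \<delta>' K \<delta> ?g
  proof (intro cochain_map.intro cochain_map_axioms.intro g_hom f.K.cochain_complex_axioms
      f.K'.cochain_complex_axioms)
    fix n y assume y: "y \<in> carrier (K' n)"
    have gy: "?g n y \<in> carrier (K n)" by (rule hom_in_carrier[OF g_hom y])
    show "?g (Suc n) (\<delta>' n y) = \<delta> n (?g n y)"
      using f.map_diff[OF gy] gf[OF f.K.diff_closed[OF gy]] fg[OF y] by simp
  qed
  show ?thesis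
  proof (intro quasi_isomorphism.intro quasi_isomorphism_axioms.intro g.cochain_map_axioms)
    fix n z assume "z \<in> cocycle_set K' \<delta>' n" "?g n z \<in> coboundary_set K \<delta> n"
    then show "z \<in> coboundary_set K' \<delta>' n"
      using f.map_coboundary[of "?g n z" n] fg[of z n] by (simp add: f.K'.cocycle_iff)
  next
    fix n z assume z: "z \<in> cocycle_set K \<delta> n"
    then have zc: "z \<in> carrier (K n)" by (simp add: f.K.cocycle_iff)
    have "?g n (f n z) \<otimes>\<^bsub>K n\<^esub> inv\<^bsub>K n\<^esub> z \<in> coboundary_set K \<delta> n"
      using gf[OF zc] group.r_inv[OF f.K.cochain_group_is_group zc]
        subgroup.one_closed[OF f.K.subgroup_coboundaries] by simp
    then show "\<exists>y \<in> cocycle_set K' \<delta>' n. ?g n y \<otimes>\<^bsub>K n\<^esub> inv\<^bsub>K n\<^esub> z \<in> coboundary_set K \<delta> n"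
      using f.map_cocycle[OF z] by blast
  qed
qed

lemma quasi_isomorphism_comp:
  assumes "quasi_isomorphism K \<delta> K' \<delta>' f" "quasi_isomorphism K' \<delta>' K'' \<delta>'' g"
  shows "quasi_isomorphism K \<delta> K'' \<delta>'' (\<lambda>n. g n \<circ> f n)"
proof -
  interpret f: quasi_isomorphism K \<delta> K' \<delta>' f by fact
  interpret g: quasi_isomorphism K' \<delta>' K'' \<delta>'' g by fact
  show ?thesis
  proof unfold_locales
    fix n
    show "g n \<circ> f n \<in> hom (K n) (K'' n)"
      using f.map_hom g.map_hom by (rule hom_compose)
    show "(g (Suc n) \<circ> f (Suc n)) (\<delta> n x) = \<delta>'' n ((g n \<circ> f n) x)" if "x \<in> carrier (K n)" for x
      using that by (simp add: f.map_diff g.map_diff f.map_closed)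
    show "z \<in> coboundary_set K \<delta> n"
      if "z \<in> cocycle_set K \<delta> n" "(g n \<circ> f n) z \<in> coboundary_set K'' \<delta>'' n" for z
      using that f.reflects_coboundaries g.reflects_coboundaries f.map_cocycle by simp
    show "\<exists>z \<in> cocycle_set K \<delta> n. (g n \<circ> f n) z \<otimes>\<^bsub>K'' n\<^esub> inv\<^bsub>K'' n\<^esub> z'' \<in> coboundary_set K'' \<delta>'' n"
      if z'': "z'' \<in> cocycle_set K'' \<delta>'' n" for z''
    proof -
      interpret G': comm_group "K' n" by (rule f.K'.cochain_group)
      interpret G'': comm_group "K'' n" by (rule g.K'.cochain_group)
      interpret gh: group_hom "K' n" "K'' n" "g n" by (rule g.map_group_hom)
      obtain z' where z': "z' \<in> cocycle_set K' \<delta>' n"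
        "g n z' \<otimes>\<^bsub>K'' n\<^esub> inv\<^bsub>K'' n\<^esub> z'' \<in> coboundary_set K'' \<delta>'' n"
        using g.hits_cocycles z'' by blast
      obtain z where z: "z \<in> cocycle_set K \<delta> n"
        "f n z \<otimes>\<^bsub>K' n\<^esub> inv\<^bsub>K' n\<^esub> z' \<in> coboundary_set K' \<delta>' n"
        using f.hits_cocycles z' by blast
      have c: "f n z \<in> carrier (K' n)" "z' \<in> carrier (K' n)" "z'' \<in> carrier (K'' n)"
        using z z' z'' f.map_cocycle f.K'.cocycle_iff g.K'.cocycle_iff by blast+
      have "g n (f n z \<otimes>\<^bsub>K' n\<^esub> inv\<^bsub>K' n\<^esub> z') \<otimes>\<^bsub>K'' n\<^esub> (g n z' \<otimes>\<^bsub>K'' n\<^esub> inv\<^bsub>K'' n\<^esub> z'')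
          \<in> coboundary_set K'' \<delta>'' n"
        using g.map_coboundary[OF z(2)] z'(2) g.K'.subgroup_coboundaries
        by (simp add: subgroup.m_closed)
      moreover have "g n (f n z \<otimes>\<^bsub>K' n\<^esub> inv\<^bsub>K' n\<^esub> z') \<otimes>\<^bsub>K'' n\<^esub> (g n z' \<otimes>\<^bsub>K'' n\<^esub> inv\<^bsub>K'' n\<^esub> z'')
          = g n (f n z) \<otimes>\<^bsub>K'' n\<^esub> inv\<^bsub>K'' n\<^esub> z''"
        using c by (simp add: G''.m_assoc) (simp add: G''.m_assoc[symmetric])
      ultimately show ?thesis using z(1) by auto
    qed
  qed
qed


section \<open>Natural transformations and the groups they form\<close>

lemma cat_module_groupD: "cat_module C M \<Longrightarrow> x \<in> Ob C \<Longrightarrow> comm_group (obm M x)"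
  by (simp add: cat_module.obm_group)

lemma cat_module_group: "cat_module C M \<Longrightarrow> x \<in> Ob C \<Longrightarrow> group (obm M x)"
  by (rule comm_group.axioms(2)[OF cat_module_groupD])

lemma cat_module_category: "cat_module C M \<Longrightarrow> small_category C"
  by (simp add: cat_module_def)

lemma Dom_Ob: "cat_module C M \<Longrightarrow> f \<in> Arr C \<Longrightarrow> Dom C f \<in> Ob C"
  and Cod_Ob: "cat_module C M \<Longrightarrow> f \<in> Arr C \<Longrightarrow> Cod C f \<in> Ob C"
  by (simp_all add: cat_module_category small_category.Dom_in small_category.Cod_in)

lemma arm_closed:
  "cat_module C M \<Longrightarrow> f \<in> Arr C \<Longrightarrow> a \<in> carrier (obm M (Dom C f))
    \<Longrightarrow> arm M f a \<in> carrier (obm M (Cod C f))"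
  by (rule hom_in_carrier[OF cat_module.arm_hom])

lemma nat_transI:
  assumes "\<eta> \<in> extensional (Ob C)"
    and "\<And>x. x \<in> Ob C \<Longrightarrow> \<eta> x \<in> extensional (carrier (obm M x))"
    and "\<And>x. x \<in> Ob C \<Longrightarrow> \<eta> x \<in> hom (obm M x) (obm N x)"
    and "\<And>f a. f \<in> Arr C \<Longrightarrow> a \<in> carrier (obm M (Dom C f))
           \<Longrightarrow> \<eta> (Cod C f) (arm M f a) = arm N f (\<eta> (Dom C f) a)"
  shows "\<eta> \<in> nat_trans C M N"
  using assms by (simp add: nat_trans_def)

lemma nat_trans_hom: "\<eta> \<in> nat_trans C M N \<Longrightarrow> x \<in> Ob C \<Longrightarrow> \<eta> x \<in> hom (obm M x) (obm N x)"
  by (simp add: nat_trans_def)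

lemma nat_trans_closed:
  "\<eta> \<in> nat_trans C M N \<Longrightarrow> x \<in> Ob C \<Longrightarrow> a \<in> carrier (obm M x) \<Longrightarrow> \<eta> x a \<in> carrier (obm N x)"
  by (rule hom_in_carrier[OF nat_trans_hom])

lemma nat_trans_mult:
  "\<eta> \<in> nat_trans C M N \<Longrightarrow> x \<in> Ob C \<Longrightarrow> a \<in> carrier (obm M x) \<Longrightarrow> b \<in> carrier (obm M x)
    \<Longrightarrow> \<eta> x (a \<otimes>\<^bsub>obm M x\<^esub> b) = \<eta> x a \<otimes>\<^bsub>obm N x\<^esub> \<eta> x b"
  by (rule hom_mult[OF nat_trans_hom])

lemma nat_trans_natural:
  "\<eta> \<in> nat_trans C M N \<Longrightarrow> f \<in> Arr C \<Longrightarrow> a \<in> carrier (obm M (Dom C f))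
    \<Longrightarrow> \<eta> (Cod C f) (arm M f a) = arm N f (\<eta> (Dom C f) a)"
  by (simp add: nat_trans_def)

lemma nat_trans_group_hom:
  "cat_module C M \<Longrightarrow> cat_module C N \<Longrightarrow> \<eta> \<in> nat_trans C M N \<Longrightarrow> x \<in> Ob C
    \<Longrightarrow> group_hom (obm M x) (obm N x) (\<eta> x)"
  by (simp add: group_hom_def group_hom_axioms_def cat_module_group nat_trans_hom)

lemma nat_trans_one:
  "cat_module C M \<Longrightarrow> cat_module C N \<Longrightarrow> \<eta> \<in> nat_trans C M N \<Longrightarrow> x \<in> Ob C
    \<Longrightarrow> \<eta> x \<one>\<^bsub>obm M x\<^esub> = \<one>\<^bsub>obm N x\<^esub>"
  by (rule group_hom.hom_one[OF nat_trans_group_hom])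

lemma nat_trans_eqI:
  assumes "\<eta> \<in> nat_trans C M N" "\<theta> \<in> nat_trans C M N'"
    and "\<And>x a. x \<in> Ob C \<Longrightarrow> a \<in> carrier (obm M x) \<Longrightarrow> \<eta> x a = \<theta> x a"
  shows "\<eta> = \<theta>"
proof (rule extensionalityI)
  show "\<eta> \<in> extensional (Ob C)" "\<theta> \<in> extensional (Ob C)"
    using assms by (simp_all add: nat_trans_def)
  fix x assume x: "x \<in> Ob C"
  show "\<eta> x = \<theta> x"
  proof (rule extensionalityI)
    show "\<eta> x \<in> extensional (carrier (obm M x))" "\<theta> x \<in> extensional (carrier (obm M x))"
      using assms x by (simp_all add: nat_trans_def)
  qed (rule assms(3)[OF x])
qed

text \<open>The extensional form, required by \<open>nat_trans\<close>, of a family of functions that is defined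
  everywhere.\<close>

definition nt_of :: "('o, 'm) cat \<Rightarrow> ('o, 'm, 'a) cmod \<Rightarrow> ('o \<Rightarrow> 'a \<Rightarrow> 'b) \<Rightarrow> 'o \<Rightarrow> 'a \<Rightarrow> 'b" where
  "nt_of C M h = (\<lambda>x \<in> Ob C. \<lambda>a \<in> carrier (obm M x). h x a)"

lemma nt_of_apply [simp]: "x \<in> Ob C \<Longrightarrow> a \<in> carrier (obm M x) \<Longrightarrow> nt_of C M h x a = h x a"
  by (simp add: nt_of_def)

lemma nt_of_in:
  assumes M: "cat_module C M"
    and closed: "\<And>x a. x \<in> Ob C \<Longrightarrow> a \<in> carrier (obm M x) \<Longrightarrow> h x a \<in> carrier (obm N x)"
    and mult: "\<And>x a b. x \<in> Ob C \<Longrightarrow> a \<in> carrier (obm M x) \<Longrightarrow> b \<in> carrier (obm M x)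
      \<Longrightarrow> h x (a \<otimes>\<^bsub>obm M x\<^esub> b) = h x a \<otimes>\<^bsub>obm N x\<^esub> h x b"
    and natural: "\<And>f a. f \<in> Arr C \<Longrightarrow> a \<in> carrier (obm M (Dom C f))
           \<Longrightarrow> h (Cod C f) (arm M f a) = arm N f (h (Dom C f) a)"
  shows "nt_of C M h \<in> nat_trans C M N"
proof (rule nat_transI)
  show "nt_of C M h \<in> extensional (Ob C)" by (simp add: nt_of_def)
  show "nt_of C M h x \<in> extensional (carrier (obm M x))" if "x \<in> Ob C" for x
    using that by (simp add: nt_of_def)
  show "nt_of C M h x \<in> hom (obm M x) (obm N x)" if x: "x \<in> Ob C" for x
  proof (rule homI)
    fix a b assume ab: "a \<in> carrier (obm M x)" "b \<in> carrier (obm M x)"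
    then have "a \<otimes>\<^bsub>obm M x\<^esub> b \<in> carrier (obm M x)"
      using cat_module_group[OF M x] by (simp add: group.is_monoid monoid.m_closed)
    with ab x show "nt_of C M h x (a \<otimes>\<^bsub>obm M x\<^esub> b) = nt_of C M h x a \<otimes>\<^bsub>obm N x\<^esub> nt_of C M h x b"
      by (simp add: mult)
  qed (simp add: x closed)
  show "nt_of C M h (Cod C f) (arm M f a) = arm N f (nt_of C M h (Dom C f) a)"
    if "f \<in> Arr C" "a \<in> carrier (obm M (Dom C f))" for f a
    using that M by (simp add: Dom_Ob[OF M] Cod_Ob[OF M] arm_closed natural)
qed

lemma nt_comp_apply [simp]:
  "x \<in> Ob C \<Longrightarrow> a \<in> carrier (obm M x) \<Longrightarrow> nt_comp C M \<theta> \<eta> x a = \<theta> x (\<eta> x a)"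
  by (simp add: nt_comp_def compose_def)

lemma nt_comp_in:
  assumes M: "cat_module C M" and \<eta>: "\<eta> \<in> nat_trans C M N" and \<theta>: "\<theta> \<in> nat_trans C N L"
  shows "nt_comp C M \<theta> \<eta> \<in> nat_trans C M L"
proof -
  have "nt_comp C M \<theta> \<eta> = nt_of C M (\<lambda>x a. \<theta> x (\<eta> x a))"
    by (simp add: nt_comp_def nt_of_def compose_def)
  also have "\<dots> \<in> nat_trans C M L"
    by (rule nt_of_in[OF M])
      (simp_all add: nat_trans_closed[OF \<eta>] nat_trans_closed[OF \<theta>] nat_trans_mult[OF \<eta>]
        nat_trans_mult[OF \<theta>] nat_trans_natural[OF \<eta>] nat_trans_natural[OF \<theta>] Dom_Ob[OF M])
  finally show ?thesis .
qed

lemma nt_comp_assoc: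
  assumes "cat_module C M" "cat_module C N" "\<eta> \<in> nat_trans C M N" "\<theta> \<in> nat_trans C N L"
    "\<zeta> \<in> nat_trans C L K"
  shows "nt_comp C M (nt_comp C N \<zeta> \<theta>) \<eta> = nt_comp C M \<zeta> (nt_comp C M \<theta> \<eta>)"
  using assms
  by (intro nat_trans_eqI[OF nt_comp_in nt_comp_in])
      (auto intro!: nt_comp_in simp: nat_trans_closed)

definition nt_id :: "('o, 'm) cat \<Rightarrow> ('o, 'm, 'a) cmod \<Rightarrow> 'o \<Rightarrow> 'a \<Rightarrow> 'a" where
  "nt_id C M = nt_of C M (\<lambda>_ a. a)"

lemma nt_id_apply [simp]: "x \<in> Ob C \<Longrightarrow> a \<in> carrier (obm M x) \<Longrightarrow> nt_id C M x a = a"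
  by (simp add: nt_id_def)

lemma nt_id_in: "cat_module C M \<Longrightarrow> nt_id C M \<in> nat_trans C M M"
  unfolding nt_id_def by (rule nt_of_in) simp_all

lemma carrier_Hom_group [simp]: "carrier (Hom_group C M N) = nat_trans C M N"
  by (simp add: Hom_group_def)

lemma Hom_group_mult_apply [simp]:
  "x \<in> Ob C \<Longrightarrow> a \<in> carrier (obm M x)
    \<Longrightarrow> (\<eta> \<otimes>\<^bsub>Hom_group C M N\<^esub> \<theta>) x a = \<eta> x a \<otimes>\<^bsub>obm N x\<^esub> \<theta> x a"
  by (simp add: Hom_group_def)

lemma Hom_group_one_apply [simp]:
  "x \<in> Ob C \<Longrightarrow> a \<in> carrier (obm M x) \<Longrightarrow> \<one>\<^bsub>Hom_group C M N\<^esub> x a = \<one>\<^bsub>obm N x\<^esub>"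
  by (simp add: Hom_group_def)

lemma Hom_group_mult_in:
  assumes M: "cat_module C M" and N: "cat_module C N"
    and \<eta>: "\<eta> \<in> nat_trans C M N" and \<theta>: "\<theta> \<in> nat_trans C M N"
  shows "\<eta> \<otimes>\<^bsub>Hom_group C M N\<^esub> \<theta> \<in> nat_trans C M N"
proof -
  have "\<eta> \<otimes>\<^bsub>Hom_group C M N\<^esub> \<theta> = nt_of C M (\<lambda>x a. \<eta> x a \<otimes>\<^bsub>obm N x\<^esub> \<theta> x a)"
    by (simp add: Hom_group_def nt_of_def)
  also have "\<dots> \<in> nat_trans C M N"
  proof (rule nt_of_in[OF M])
    fix x a assume x: "x \<in> Ob C" and a: "a \<in> carrier (obm M x)"
    interpret comm_group "obm N x" using N x by (rule cat_module_groupD)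
    show "\<eta> x a \<otimes>\<^bsub>obm N x\<^esub> \<theta> x a \<in> carrier (obm N x)"
      by (simp add: x a nat_trans_closed[OF \<eta>] nat_trans_closed[OF \<theta>])
    fix b assume b: "b \<in> carrier (obm M x)"
    show "\<eta> x (a \<otimes>\<^bsub>obm M x\<^esub> b) \<otimes>\<^bsub>obm N x\<^esub> \<theta> x (a \<otimes>\<^bsub>obm M x\<^esub> b)
        = \<eta> x a \<otimes>\<^bsub>obm N x\<^esub> \<theta> x a \<otimes>\<^bsub>obm N x\<^esub> (\<eta> x b \<otimes>\<^bsub>obm N x\<^esub> \<theta> x b)"
      by (simp add: x a b nat_trans_closed[OF \<eta>] nat_trans_closed[OF \<theta>]
           nat_trans_mult[OF \<eta>] nat_trans_mult[OF \<theta>] m_ac)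
  next
    fix f a assume f: "f \<in> Arr C" and a: "a \<in> carrier (obm M (Dom C f))"
    then show "\<eta> (Cod C f) (arm M f a) \<otimes>\<^bsub>obm N (Cod C f)\<^esub> \<theta> (Cod C f) (arm M f a)
        = arm N f (\<eta> (Dom C f) a \<otimes>\<^bsub>obm N (Dom C f)\<^esub> \<theta> (Dom C f) a)"
      using hom_mult[OF cat_module.arm_hom[OF N f]]
      by (simp add: nat_trans_natural[OF \<eta>] nat_trans_natural[OF \<theta>] Dom_Ob[OF M]
           nat_trans_closed[OF \<eta>] nat_trans_closed[OF \<theta>])
  qed
  finally show ?thesis .
qed

lemma arm_group_hom:
  "cat_module C N \<Longrightarrow> f \<in> Arr C \<Longrightarrow> group_hom (obm N (Dom C f)) (obm N (Cod C f)) (arm N f)"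
  by (simp add: group_hom_def group_hom_axioms_def cat_module_group Dom_Ob Cod_Ob
      cat_module.arm_hom)

lemma Hom_group_comm_group:
  assumes M: "cat_module C M" and N: "cat_module C N"
  shows "comm_group (Hom_group C M N)"
proof -
  have one: "\<one>\<^bsub>Hom_group C M N\<^esub> \<in> nat_trans C M N"
  proof -
    have "nt_of C M (\<lambda>x a. \<one>\<^bsub>obm N x\<^esub>) \<in> nat_trans C M N"
      by (rule nt_of_in[OF M])
        (simp_all add: cat_module_group[OF N] group.is_monoid
            group_hom.hom_one[OF arm_group_hom[OF N]]
           monoid.one_closed monoid.l_one)
    then show ?thesis by (simp add: Hom_group_def nt_of_def)
  qed
  have inverse: "\<exists>\<theta> \<in> nat_trans C M N. \<theta> \<otimes>\<^bsub>Hom_group C M N\<^esub> \<eta> = \<one>\<^bsub>Hom_group C M N\<^esub>"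
    if \<eta>: "\<eta> \<in> nat_trans C M N" for \<eta>
  proof -
    have \<theta>: "nt_of C M (\<lambda>x a. inv\<^bsub>obm N x\<^esub> \<eta> x a) \<in> nat_trans C M N"
    proof (rule nt_of_in[OF M])
      fix x a assume x: "x \<in> Ob C" and a: "a \<in> carrier (obm M x)"
      interpret comm_group "obm N x" using N x by (rule cat_module_groupD)
      show "inv\<^bsub>obm N x\<^esub> \<eta> x a \<in> carrier (obm N x)" by (simp add: x a nat_trans_closed[OF \<eta>])
      fix b assume b: "b \<in> carrier (obm M x)"
      show "inv\<^bsub>obm N x\<^esub> \<eta> x (a \<otimes>\<^bsub>obm M x\<^esub> b) = inv\<^bsub>obm N x\<^esub> \<eta> x a \<otimes>\<^bsub>obm N x\<^esub> inv\<^bsub>obm N x\<^esub> \<eta> x b"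
        by (simp add: x a b nat_trans_closed[OF \<eta>] nat_trans_mult[OF \<eta>] inv_mult)
    next
      fix f a assume f: "f \<in> Arr C" and a: "a \<in> carrier (obm M (Dom C f))"
      then show "inv\<^bsub>obm N (Cod C f)\<^esub> \<eta> (Cod C f) (arm M f a)
          = arm N f (inv\<^bsub>obm N (Dom C f)\<^esub> \<eta> (Dom C f) a)"
        by (simp add: nat_trans_natural[OF \<eta>] nat_trans_closed[OF \<eta>] Dom_Ob[OF M]
             group_hom.hom_inv[OF arm_group_hom[OF N]])
    qed
    moreover have "nt_of C M (\<lambda>x a. inv\<^bsub>obm N x\<^esub> \<eta> x a) \<otimes>\<^bsub>Hom_group C M N\<^esub> \<eta> = \<one>\<^bsub>Hom_group C M N\<^esub>"
      by (rule nat_trans_eqI[OF Hom_group_mult_in[OF M N \<theta> \<eta>] one])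
        (simp add: nat_trans_closed[OF \<eta>] cat_module_group[OF N] group.l_inv)
    ultimately show ?thesis by blast
  qed
  note closed = Hom_group_mult_in[OF M N]
  show ?thesis
  proof (rule comm_groupI)
    fix \<eta> \<theta> \<zeta> assume *: "\<eta> \<in> carrier (Hom_group C M N)" "\<theta> \<in> carrier (Hom_group C M N)"
    then show "\<eta> \<otimes>\<^bsub>Hom_group C M N\<^esub> \<theta> \<in> carrier (Hom_group C M N)" by (simp add: closed)
    show "\<eta> \<otimes>\<^bsub>Hom_group C M N\<^esub> \<theta> = \<theta> \<otimes>\<^bsub>Hom_group C M N\<^esub> \<eta>"
    proof (rule nat_trans_eqI[OF closed closed])
      fix x a assume x: "x \<in> Ob C" and a: "a \<in> carrier (obm M x)"
      interpret comm_group "obm N x" using N x by (rule cat_module_groupD)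
      show "(\<eta> \<otimes>\<^bsub>Hom_group C M N\<^esub> \<theta>) x a = (\<theta> \<otimes>\<^bsub>Hom_group C M N\<^esub> \<eta>) x a"
        using * x a by (simp add: nat_trans_closed m_comm)
    qed (use * in simp_all)
    assume **: "\<zeta> \<in> carrier (Hom_group C M N)"
    show "\<eta> \<otimes>\<^bsub>Hom_group C M N\<^esub> \<theta> \<otimes>\<^bsub>Hom_group C M N\<^esub> \<zeta>
        = \<eta> \<otimes>\<^bsub>Hom_group C M N\<^esub> (\<theta> \<otimes>\<^bsub>Hom_group C M N\<^esub> \<zeta>)"
    proof (rule nat_trans_eqI[OF closed closed])
      fix x a assume x: "x \<in> Ob C" and a: "a \<in> carrier (obm M x)"
      interpret comm_group "obm N x" using N x by (rule cat_module_groupD)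
      show "(\<eta> \<otimes>\<^bsub>Hom_group C M N\<^esub> \<theta> \<otimes>\<^bsub>Hom_group C M N\<^esub> \<zeta>) x a
          = (\<eta> \<otimes>\<^bsub>Hom_group C M N\<^esub> (\<theta> \<otimes>\<^bsub>Hom_group C M N\<^esub> \<zeta>)) x a"
        using * ** x a by (simp add: nat_trans_closed m_assoc)
    qed (use * ** in \<open>simp_all add: closed\<close>)
  next
    fix \<eta> assume *: "\<eta> \<in> carrier (Hom_group C M N)"
    show "\<one>\<^bsub>Hom_group C M N\<^esub> \<otimes>\<^bsub>Hom_group C M N\<^esub> \<eta> = \<eta>"
      using * by (intro nat_trans_eqI[OF closed[OF one]])
        (auto simp: nat_trans_closed cat_module_group[OF N] group.is_monoid monoid.l_one)
    show "\<exists>\<theta> \<in> carrier (Hom_group C M N). \<theta> \<otimes>\<^bsub>Hom_group C M N\<^esub> \<eta> = \<one>\<^bsub>Hom_group C M N\<^esub>"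
      using inverse * by simp
  qed (simp add: one)
qed

lemma Hom_group_inv_apply:
  assumes M: "cat_module C M" and N: "cat_module C N" and \<eta>: "\<eta> \<in> nat_trans C M N"
    and x: "x \<in> Ob C" and a: "a \<in> carrier (obm M x)"
  shows "(inv\<^bsub>Hom_group C M N\<^esub> \<eta>) x a = inv\<^bsub>obm N x\<^esub> (\<eta> x a)"
proof -
  interpret H: comm_group "Hom_group C M N" by (rule Hom_group_comm_group[OF M N])
  interpret comm_group "obm N x" using N x by (rule cat_module_groupD)
  have i: "inv\<^bsub>Hom_group C M N\<^esub> \<eta> \<in> nat_trans C M N" using H.inv_closed \<eta> by simp
  have "(inv\<^bsub>Hom_group C M N\<^esub> \<eta> \<otimes>\<^bsub>Hom_group C M N\<^esub> \<eta>) x a = \<one>\<^bsub>obm N x\<^esub>"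
    using \<eta> x a H.l_inv[of \<eta>] by simp
  then have "(inv\<^bsub>Hom_group C M N\<^esub> \<eta>) x a \<otimes>\<^bsub>obm N x\<^esub> \<eta> x a = \<one>\<^bsub>obm N x\<^esub>"
    using x a by simp
  then show ?thesis
    using inv_equality nat_trans_closed[OF i x a] nat_trans_closed[OF \<eta> x a] by metis
qed

lemma precomp_hom:
  assumes P: "cat_module C P" and Q: "cat_module C Q" and A: "cat_module C A"
    and \<eta>: "\<eta> \<in> nat_trans C P Q"
  shows "(\<lambda>f. nt_comp C P f \<eta>) \<in> hom (Hom_group C Q A) (Hom_group C P A)"
proof (rule homI)
  fix f g assume "f \<in> carrier (Hom_group C Q A)" "g \<in> carrier (Hom_group C Q A)"
  then have fg: "f \<in> nat_trans C Q A" "g \<in> nat_trans C Q A" by simp_all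
  show "nt_comp C P f \<eta> \<in> carrier (Hom_group C P A)" by (simp add: nt_comp_in[OF P \<eta> fg(1)])
  show "nt_comp C P (f \<otimes>\<^bsub>Hom_group C Q A\<^esub> g) \<eta>
      = nt_comp C P f \<eta> \<otimes>\<^bsub>Hom_group C P A\<^esub> nt_comp C P g \<eta>"
    by (rule nat_trans_eqI[OF nt_comp_in[OF P \<eta> Hom_group_mult_in[OF Q A fg]]
          Hom_group_mult_in[OF P A nt_comp_in[OF P \<eta> fg(1)] nt_comp_in[OF P \<eta> fg(2)]]])
      (simp add: nat_trans_closed[OF \<eta>])
qed

lemma postcomp_hom:
  assumes P: "cat_module C P" and A: "cat_module C A" and A': "cat_module C A'"
    and \<alpha>: "\<alpha> \<in> nat_trans C A A'"
  shows "(\<lambda>f. nt_comp C P \<alpha> f) \<in> hom (Hom_group C P A) (Hom_group C P A')"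
proof (rule homI)
  fix f g assume "f \<in> carrier (Hom_group C P A)" "g \<in> carrier (Hom_group C P A)"
  then have fg: "f \<in> nat_trans C P A" "g \<in> nat_trans C P A" by simp_all
  show "nt_comp C P \<alpha> f \<in> carrier (Hom_group C P A')" by (simp add: nt_comp_in[OF P fg(1) \<alpha>])
  show "nt_comp C P \<alpha> (f \<otimes>\<^bsub>Hom_group C P A\<^esub> g)
      = nt_comp C P \<alpha> f \<otimes>\<^bsub>Hom_group C P A'\<^esub> nt_comp C P \<alpha> g"
    by (rule nat_trans_eqI[OF nt_comp_in[OF P Hom_group_mult_in[OF P A fg] \<alpha>]
          Hom_group_mult_in[OF P A' nt_comp_in[OF P fg(1) \<alpha>] nt_comp_in[OF P fg(2) \<alpha>]]])
      (simp add: nat_trans_closed[OF fg(1)] nat_trans_closed[OF fg(2)] nat_trans_mult[OF \<alpha>])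
qed


section \<open>Lifting through surjections\<close>

text \<open>The structure of \<open>N\<close> carried over to another type. The injection may vary with the object, which
  admits pointwise sections of a natural transformation as \<open>j\<close>.\<close>

definition transport_mod ::
  "('o, 'm) cat \<Rightarrow> ('o \<Rightarrow> 'a \<Rightarrow> 'u) \<Rightarrow> ('o, 'm, 'a) cmod \<Rightarrow> ('o, 'm, 'u) cmod" where
  "transport_mod C j N = \<lparr>
     obm = (\<lambda>x. \<lparr>carrier = j x ` carrier (obm N x),
       monoid.mult = (\<lambda>a b. j x (inv_into (carrier (obm N x)) (j x) a
          \<otimes>\<^bsub>obm N x\<^esub> inv_into (carrier (obm N x)) (j x) b)),
       one = j x \<one>\<^bsub>obm N x\<^esub>\<rparr>),
     arm = (\<lambda>f a. j (Cod C f) (arm N f (inv_into (carrier (obm N (Dom C f))) (j (Dom C f)) a)))\<rparr>"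

definition transport_to ::
  "('o, 'm) cat \<Rightarrow> ('o \<Rightarrow> 'a \<Rightarrow> 'u) \<Rightarrow> ('o, 'm, 'a) cmod \<Rightarrow> 'o \<Rightarrow> 'a \<Rightarrow> 'u" where
  "transport_to C j N = nt_of C N j"

definition transport_from ::
  "('o, 'm) cat \<Rightarrow> ('o \<Rightarrow> 'a \<Rightarrow> 'u) \<Rightarrow> ('o, 'm, 'a) cmod \<Rightarrow> 'o \<Rightarrow> 'u \<Rightarrow> 'a" where
  "transport_from C j N = nt_of C (transport_mod C j N) (\<lambda>x. inv_into (carrier (obm N x)) (j x))"

locale transport =
  fixes C :: "('o, 'm) cat" and j :: "'o \<Rightarrow> 'a \<Rightarrow> 'u" and N :: "('o, 'm, 'a) cmod"
  assumes mod: "cat_module C N" and inj: "x \<in> Ob C \<Longrightarrow> inj_on (j x) (carrier (obm N x))"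
begin

lemma carrier_transport [simp]: "carrier (obm (transport_mod C j N) x) = j x ` carrier (obm N x)"
  by (simp add: transport_mod_def)

lemma inv_j [simp]: "x \<in> Ob C \<Longrightarrow> a \<in> carrier (obm N x)
    \<Longrightarrow> inv_into (carrier (obm N x)) (j x) (j x a) = a"
  by (simp add: inj)

lemma mult_transport [simp]:
  "x \<in> Ob C \<Longrightarrow> a \<in> carrier (obm N x) \<Longrightarrow> b \<in> carrier (obm N x)
    \<Longrightarrow> j x a \<otimes>\<^bsub>obm (transport_mod C j N) x\<^esub> j x b = j x (a \<otimes>\<^bsub>obm N x\<^esub> b)"
  by (simp add: transport_mod_def)

lemma one_transport [simp]: "\<one>\<^bsub>obm (transport_mod C j N) x\<^esub> = j x \<one>\<^bsub>obm N x\<^esub>"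
  by (simp add: transport_mod_def)

lemma arm_transport [simp]:
  "f \<in> Arr C \<Longrightarrow> a \<in> carrier (obm N (Dom C f))
    \<Longrightarrow> arm (transport_mod C j N) f (j (Dom C f) a) = j (Cod C f) (arm N f a)"
  by (simp add: transport_mod_def Dom_Ob[OF mod])

lemma transport_module: "cat_module C (transport_mod C j N)"
proof -
  interpret small_category C by (rule cat_module_category[OF mod])
  show ?thesis
  proof (intro cat_module.intro cat_module_axioms.intro)
    show "small_category C" by (rule small_category_axioms)
  next
    fix x assume x: "x \<in> Ob C"
    interpret comm_group "obm N x" using mod x by (rule cat_module_groupD)
    show "comm_group (obm (transport_mod C j N) x)"
    proof (rule comm_groupI)
      fix a assume "a \<in> carrier (obm (transport_mod C j N) x)"
      then obtain a' where a': "a' \<in> carrier (obm N x)" "a = j x a'" by auto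
      then have "j x (inv\<^bsub>obm N x\<^esub> a') \<in> carrier (obm (transport_mod C j N) x)"
        "j x (inv\<^bsub>obm N x\<^esub> a') \<otimes>\<^bsub>obm (transport_mod C j N) x\<^esub> a = \<one>\<^bsub>obm (transport_mod C j N) x\<^esub>"
        using x by simp_all
      then show "\<exists>y \<in> carrier (obm (transport_mod C j N) x).
          y \<otimes>\<^bsub>obm (transport_mod C j N) x\<^esub> a = \<one>\<^bsub>obm (transport_mod C j N) x\<^esub>" by blast
    qed (use x in \<open>auto simp: m_ac\<close>)
  next
    fix f assume f: "f \<in> Arr C"
    show "arm (transport_mod C j N) f \<in> hom (obm (transport_mod C j N) (Dom C f))
        (obm (transport_mod C j N) (Cod C f))"
    proof (rule homI)
      fix a assume "a \<in> carrier (obm (transport_mod C j N) (Dom C f))"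
      then obtain a' where a: "a' \<in> carrier (obm N (Dom C f))" "a = j (Dom C f) a'" by auto
      then show "arm (transport_mod C j N) f a \<in> carrier (obm (transport_mod C j N) (Cod C f))"
        using f by (simp add: arm_closed[OF mod])
      fix b assume "b \<in> carrier (obm (transport_mod C j N) (Dom C f))"
      then obtain b' where b: "b' \<in> carrier (obm N (Dom C f))" "b = j (Dom C f) b'" by auto
      have "a' \<otimes>\<^bsub>obm N (Dom C f)\<^esub> b' \<in> carrier (obm N (Dom C f))"
        using a b f cat_module_group[OF mod] by (simp add: group.is_monoid monoid.m_closed)
      then show "arm (transport_mod C j N) f (a \<otimes>\<^bsub>obm (transport_mod C j N) (Dom C f)\<^esub> b)
          = arm (transport_mod C j N) f a \<otimes>\<^bsub>obm (transport_mod C j N) (Cod C f)\<^esub> arm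
              (transport_mod C j N) f b"
        using f a b by (simp add: arm_closed[OF mod] hom_mult[OF cat_module.arm_hom[OF mod]])
    qed
  next
    fix x a assume x: "x \<in> Ob C" and "a \<in> carrier (obm (transport_mod C j N) x)"
    then obtain a' where a': "a' \<in> carrier (obm N x)" "a = j x a'" by auto
    then show "arm (transport_mod C j N) (Idn C x) a = a"
      using x arm_transport[of "Idn C x" a'] by (simp add: cat_module.arm_Idn[OF mod])
  next
    fix f g a assume fg: "f \<in> Arr C" "g \<in> Arr C" "Cod C f = Dom C g"
      and "a \<in> carrier (obm (transport_mod C j N) (Dom C f))"
    then obtain a' where a': "a' \<in> carrier (obm N (Dom C f))" "a = j (Dom C f) a'" by auto
    have c: "arm N f a' \<in> carrier (obm N (Dom C g))"
      using arm_closed[OF mod fg(1) a'(1)] fg by simp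
    show "arm (transport_mod C j N) (Cmp C f g) a
        = arm (transport_mod C j N) g (arm (transport_mod C j N) f a)"
      using fg a' arm_transport[of "Cmp C f g" a'] arm_transport[OF fg(2) c]
      by (simp add: cat_module.arm_Cmp[OF mod])
  qed
qed

lemma transport_to_in: "transport_to C j N \<in> nat_trans C N (transport_mod C j N)"
  unfolding transport_to_def by (rule nt_of_in[OF mod]) simp_all

lemma transport_from_in: "transport_from C j N \<in> nat_trans C (transport_mod C j N) N"
  unfolding transport_from_def
proof (rule nt_of_in[OF transport_module])
  fix x a assume x: "x \<in> Ob C" and a: "a \<in> carrier (obm (transport_mod C j N) x)"
  show "inv_into (carrier (obm N x)) (j x) a \<in> carrier (obm N x)"
    using a by (simp add: inv_into_into)
  fix b assume b: "b \<in> carrier (obm (transport_mod C j N) x)"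
  obtain a' b' where "a' \<in> carrier (obm N x)" "a = j x a'" "b' \<in> carrier (obm N x)" "b = j x b'"
    using a b by auto
  moreover from this have "a' \<otimes>\<^bsub>obm N x\<^esub> b' \<in> carrier (obm N x)"
    using x cat_module_group[OF mod] by (simp add: group.is_monoid monoid.m_closed)
  ultimately show "inv_into (carrier (obm N x)) (j x) (a \<otimes>\<^bsub>obm (transport_mod C j N) x\<^esub> b)
      = inv_into (carrier (obm N x)) (j x) a \<otimes>\<^bsub>obm N x\<^esub> inv_into (carrier (obm N x)) (j x) b"
    using x by simp
next
  fix f a assume f: "f \<in> Arr C" and "a \<in> carrier (obm (transport_mod C j N) (Dom C f))"
  then obtain a' where "a' \<in> carrier (obm N (Dom C f))" "a = j (Dom C f) a'" by auto
  then show "inv_into (carrier (obm N (Cod C f))) (j (Cod C f)) (arm (transport_mod C j N) f a)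
      = arm N f (inv_into (carrier (obm N (Dom C f))) (j (Dom C f)) a)"
    using f by (simp add: Dom_Ob[OF mod] Cod_Ob[OF mod] arm_closed[OF mod])
qed

lemma transport_to_apply: "x \<in> Ob C \<Longrightarrow> a \<in> carrier (obm N x) \<Longrightarrow> transport_to C j N x a = j x a"
  by (simp add: transport_to_def)

lemma transport_from_to [simp]:
  "x \<in> Ob C \<Longrightarrow> a \<in> carrier (obm N x) \<Longrightarrow> transport_from C j N x (transport_to C j N x a) = a"
  by (simp add: transport_to_def transport_from_def)

lemma transport_from_j [simp]:
  "x \<in> Ob C \<Longrightarrow> a \<in> carrier (obm N x) \<Longrightarrow> transport_from C j N x (j x a) = a"
  by (simp add: transport_to_def transport_from_def)

end

text \<open>Lifting through the surjections with source \<open>N\<close>. The target ranges over modules with the carrier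
  type of \<open>N\<close>; up to isomorphism these are all quotients of \<open>N\<close>. In contrast to projectivity, no
  type other than those of \<open>P\<close> and \<open>N\<close> enters.\<close>

definition lifts_from :: "('o, 'm) cat \<Rightarrow> ('o, 'm, 'p) cmod \<Rightarrow> ('o, 'm, 'q) cmod \<Rightarrow> bool" where
  "lifts_from C P N \<longleftrightarrow> (\<forall>(N' :: ('o, 'm, 'q) cmod) \<pi> \<phi>. cat_module C N' \<longrightarrow>
     \<pi> \<in> nat_trans C N N' \<longrightarrow> (\<forall>x \<in> Ob C. \<pi> x ` carrier (obm N x) = carrier (obm N' x)) \<longrightarrow>
     \<phi> \<in> nat_trans C P N' \<longrightarrow>
     (\<exists>\<psi> \<in> nat_trans C P N. \<forall>x \<in> Ob C. \<forall>a \<in> carrier (obm P x). \<pi> x (\<psi> x a) = \<phi> x a))"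

text \<open>A pointwise section of \<open>\<pi>\<close> embeds the target in the carrier type of \<open>N\<close>. Transport along
  it brings the target within the scope of \<open>lifts_from\<close>.\<close>

lemma lifts_through_surjection:
  fixes N :: "('o, 'm, 'q) cmod" and N' :: "('o, 'm, 'v) cmod"
  assumes lifts: "lifts_from C P N" and P: "cat_module C P" and N: "cat_module C N"
    and N': "cat_module C N'"
    and \<pi>: "\<pi> \<in> nat_trans C N N'"
    and surj: "\<And>x. x \<in> Ob C \<Longrightarrow> \<pi> x ` carrier (obm N x) = carrier (obm N' x)"
    and \<phi>: "\<phi> \<in> nat_trans C P N'"
  obtains \<psi> where "\<psi> \<in> nat_trans C P N"
    "\<And>x a. x \<in> Ob C \<Longrightarrow> a \<in> carrier (obm P x) \<Longrightarrow> \<pi> x (\<psi> x a) = \<phi> x a"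
proof -
  \<comment> \<open>a pointwise section of \<open>\<pi>\<close>; it is injective but not a homomorphism\<close>
  define s where "s x = inv_into (carrier (obm N x)) (\<pi> x)" for x
  have s: "\<pi> x (s x b) = b" if "x \<in> Ob C" "b \<in> carrier (obm N' x)" for x b
    unfolding s_def using that surj by (metis f_inv_into_f)
  interpret transport C s N'
  proof (rule transport.intro[OF N'])
    show "inj_on (s x) (carrier (obm N' x))" if "x \<in> Ob C" for x
      using s[OF that] by (metis inj_onI)
  qed
  have to: "transport_to C s N' \<in> nat_trans C N' (transport_mod C s N')" by (rule transport_to_in)
  have "nt_comp C N (transport_to C s N') \<pi> x ` carrier (obm N x)
      = carrier (obm (transport_mod C s N') x)"
    if x: "x \<in> Ob C" for x
  proof -
    have "nt_comp C N (transport_to C s N') \<pi> x ` carrier (obm N x) = s x ` \<pi> x ` carrier (obm N x)"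
      unfolding image_image
      by (rule image_cong) (simp_all add: x transport_to_apply nat_trans_closed[OF \<pi>])
    then show ?thesis using surj[OF x] by simp
  qed
  with lifts[unfolded lifts_from_def, rule_format, OF transport_module nt_comp_in[OF N \<pi> to] _
      nt_comp_in[OF P \<phi> to]]
  obtain \<psi> where \<psi>: "\<psi> \<in> nat_trans C P N" and eq: "\<And>x a. x \<in> Ob C \<Longrightarrow> a \<in> carrier (obm P x) \<Longrightarrow>
      nt_comp C N (transport_to C s N') \<pi> x (\<psi> x a) = nt_comp C P (transport_to C s N') \<phi> x a"
    by blast
  show thesis
  proof (rule that[OF \<psi>])
    fix x a assume x: "x \<in> Ob C" and a: "a \<in> carrier (obm P x)"
    have "transport_to C s N' x (\<pi> x (\<psi> x a)) = transport_to C s N' x (\<phi> x a)"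
      using eq[OF x a] x a nat_trans_closed[OF \<psi> x a] by simp
    then show "\<pi> x (\<psi> x a) = \<phi> x a"
      using transport_from_to[OF x] nat_trans_closed[OF \<pi> x] nat_trans_closed[OF \<psi> x a]
        nat_trans_closed[OF \<phi> x a] by metis
  qed
qed

text \<open>Projectivity of \<open>P\<close> concerns modules with the carrier type of \<open>P\<close>. If the carrier type of \<open>N\<close>
  embeds there, then \<open>N\<close> has an isomorphic copy in that type, and the targets are dealt with by
  the preceding lemma.\<close>

lemma projective_lifts_from:
  fixes P :: "('o, 'm, 'u) cmod" and N :: "('o, 'm, 'q) cmod" and j :: "'q \<Rightarrow> 'u"
  assumes proj: "projective_mod C P" and N: "cat_module C N" and j: "inj j"
  shows "lifts_from C P N"
  unfolding lifts_from_def
proof (intro allI impI)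
  fix N' :: "('o, 'm, 'q) cmod" and \<pi> \<phi>
  assume N': "cat_module C N'" and \<pi>: "\<pi> \<in> nat_trans C N N'"
    and surj: "\<forall>x \<in> Ob C. \<pi> x ` carrier (obm N x) = carrier (obm N' x)"
        and \<phi>: "\<phi> \<in> nat_trans C P N'"
  have P: "cat_module C P" using proj by (simp add: projective_mod_def)
  interpret T: transport C "\<lambda>_. j" N by (rule transport.intro[OF N inj_on_subset[OF j]]) simp
  have self: "lifts_from C P (transport_mod C (\<lambda>_. j) N)"
    unfolding lifts_from_def
  proof (intro allI impI)
    fix M' :: "('o, 'm, 'u) cmod" and \<pi> \<phi>
    assume "cat_module C M'" "\<pi> \<in> nat_trans C (transport_mod C (\<lambda>_. j) N) M'"
      "\<forall>x \<in> Ob C. \<pi> x ` carrier (obm (transport_mod C (\<lambda>_. j) N) x) = carrier (obm M' x)"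
      "\<phi> \<in> nat_trans C P M'"
    with proj T.transport_module obtain \<psi> where "\<psi> \<in> nat_trans C P (transport_mod C (\<lambda>_. j) N)"
      "nt_comp C P \<pi> \<psi> = \<phi>" unfolding projective_mod_def by meson
    then show "\<exists>\<psi> \<in> nat_trans C P (transport_mod C (\<lambda>_. j) N).
        \<forall>x \<in> Ob C. \<forall>a \<in> carrier (obm P x). \<pi> x (\<psi> x a) = \<phi> x a"
      using nt_comp_apply by metis
  qed
  note from_in = T.transport_from_in
  have "nt_comp C (transport_mod C (\<lambda>_. j) N) \<pi> (transport_from C (\<lambda>_. j) N) x
      ` carrier (obm (transport_mod C (\<lambda>_. j) N) x) = carrier (obm N' x)" if x: "x \<in> Ob C" for x
  proof -
    have "nt_comp C (transport_mod C (\<lambda>_. j) N) \<pi> (transport_from C (\<lambda>_. j) N) x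
      ` carrier (obm (transport_mod C (\<lambda>_. j) N) x) = \<pi> x ` carrier (obm N x)"
      unfolding T.carrier_transport image_image
      by (rule image_cong) (simp_all add: x)
    then show ?thesis using surj x by simp
  qed
  from lifts_through_surjection[OF self P T.transport_module N'
      nt_comp_in[OF T.transport_module from_in \<pi>] this \<phi>]
  obtain \<psi> where \<psi>: "\<psi> \<in> nat_trans C P (transport_mod C (\<lambda>_. j) N)"
    and eq: "\<And>x a. x \<in> Ob C \<Longrightarrow> a \<in> carrier (obm P x) \<Longrightarrow>
      nt_comp C (transport_mod C (\<lambda>_. j) N) \<pi> (transport_from C (\<lambda>_. j) N) x (\<psi> x a) = \<phi> x a"
    by blast
  show "\<exists>\<psi> \<in> nat_trans C P N. \<forall>x \<in> Ob C. \<forall>a \<in> carrier (obm P x). \<pi> x (\<psi> x a) = \<phi> x a"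
  proof (intro bexI ballI)
    show "nt_comp C P (transport_from C (\<lambda>_. j) N) \<psi> \<in> nat_trans C P N"
      by (rule nt_comp_in[OF P \<psi> from_in])
    fix x a assume x: "x \<in> Ob C" and a: "a \<in> carrier (obm P x)"
    show "\<pi> x (nt_comp C P (transport_from C (\<lambda>_. j) N) \<psi> x a) = \<phi> x a"
      using eq[OF x a] nat_trans_closed[OF \<psi> x a] x a by simp
  qed
qed

lemma transport_lifts_from:
  fixes N :: "('o, 'm, 'q) cmod" and P :: "('o, 'm, 'p) cmod"
  assumes "transport C j P" and lifts: "lifts_from C P N"
  shows "lifts_from C (transport_mod C j P) N"
  unfolding lifts_from_def
proof (intro allI impI)
  interpret T: transport C j P by fact
  fix N' :: "('o, 'm, 'q) cmod" and \<pi> \<phi>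
  assume N': "cat_module C N'" and \<pi>: "\<pi> \<in> nat_trans C N N'"
    and surj: "\<forall>x \<in> Ob C. \<pi> x ` carrier (obm N x) = carrier (obm N' x)"
    and \<phi>: "\<phi> \<in> nat_trans C (transport_mod C j P) N'"
  obtain \<psi> where \<psi>: "\<psi> \<in> nat_trans C P N"
    and eq: "\<forall>x \<in> Ob C. \<forall>a \<in> carrier (obm P x). \<pi> x (\<psi> x a)
        = nt_comp C P \<phi> (transport_to C j P) x a"
    using lifts[unfolded lifts_from_def, rule_format, OF N' \<pi> surj[rule_format]
        nt_comp_in[OF T.mod T.transport_to_in \<phi>]] by blast
  show "\<exists>\<psi> \<in> nat_trans C (transport_mod C j P) N. \<forall>x \<in> Ob C.
      \<forall>a \<in> carrier (obm (transport_mod C j P) x). \<pi> x (\<psi> x a) = \<phi> x a"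
  proof (intro bexI ballI)
    show "nt_comp C (transport_mod C j P) \<psi> (transport_from C j P)
        \<in> nat_trans C (transport_mod C j P) N"
      by (rule nt_comp_in[OF T.transport_module T.transport_from_in \<psi>])
    fix x a assume x: "x \<in> Ob C" and "a \<in> carrier (obm (transport_mod C j P) x)"
    then obtain a' where "a' \<in> carrier (obm P x)" "a = j x a'" by auto
    then show "\<pi> x (nt_comp C (transport_mod C j P) \<psi> (transport_from C j P) x a) = \<phi> x a"
      using x eq by (simp add: T.transport_to_apply)
  qed
qed

definition kernel_mod ::
  "('o, 'm, 'a) cmod \<Rightarrow> ('o, 'm, 'b) cmod \<Rightarrow> ('o \<Rightarrow> 'a \<Rightarrow> 'b) \<Rightarrow> ('o, 'm, 'a) cmod" where
  "kernel_mod N N' \<eta> = \<lparr>obm = (\<lambda>x. (obm N x)\<lparr>carrier := kernel (obm N x) (obm N' x) (\<eta> x)\<rparr>), arm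
      = arm N\<rparr>"

lemma kernel_mod_module:
  assumes N: "cat_module C N" and N': "cat_module C N'" and \<eta>: "\<eta> \<in> nat_trans C N N'"
  shows "cat_module C (kernel_mod N N' \<eta>)"
proof -
  interpret small_category C by (rule cat_module_category[OF N])
  show ?thesis
  proof (intro cat_module.intro cat_module_axioms.intro)
    show "small_category C" by (rule small_category_axioms)
  next
    fix x assume x: "x \<in> Ob C"
    interpret Nx: comm_group "obm N x" by (rule cat_module_groupD[OF N x])
    have sub: "subgroup (kernel (obm N x) (obm N' x) (\<eta> x)) (obm N x)"
      by (rule group_hom.subgroup_kernel[OF nat_trans_group_hom[OF N N' \<eta> x]])
    then have "group ((obm N x)\<lparr>carrier := kernel (obm N x) (obm N' x) (\<eta> x)\<rparr>)"
      by (rule Nx.subgroup_imp_group)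
    then have "comm_group ((obm N x)\<lparr>carrier := kernel (obm N x) (obm N' x) (\<eta> x)\<rparr>)"
      by (rule group.group_comm_groupI) (simp add: Nx.m_comm subgroup.mem_carrier[OF sub])
    then show "comm_group (obm (kernel_mod N N' \<eta>) x)"
      by (simp add: kernel_mod_def)
  next
    fix f assume f: "f \<in> Arr C"
    show "arm (kernel_mod N N' \<eta>) f
        \<in> hom (obm (kernel_mod N N' \<eta>) (Dom C f)) (obm (kernel_mod N N' \<eta>) (Cod C f))"
      using f hom_mult[OF cat_module.arm_hom[OF N f]]
      by (intro homI) (auto simp: kernel_mod_def kernel_def arm_closed[OF N]
          nat_trans_natural[OF \<eta>] group_hom.hom_one[OF arm_group_hom[OF N']])
  qed (auto simp: kernel_mod_def kernel_def cat_module.arm_Idn[OF N] cat_module.arm_Cmp[OF N])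
qed

text \<open>Exactness makes \<open>N\<close> surject onto the kernel of \<open>e\<close>, and \<open>\<phi>\<close> takes its values in this
  kernel.\<close>

lemma lifts_through_exact:
  fixes N :: "('o, 'm, 'q) cmod"
  assumes lifts: "lifts_from C P N" and P: "cat_module C P" and N: "cat_module C N"
    and N': "cat_module C N'" and N'': "cat_module C N''"
    and d: "d \<in> nat_trans C N N'" and e: "e \<in> nat_trans C N' N''"
    and exact: "\<And>x. x \<in> Ob C \<Longrightarrow> d x ` carrier (obm N x) = kernel (obm N' x) (obm N'' x) (e x)"
    and \<phi>: "\<phi> \<in> nat_trans C P N'"
    and \<phi>_ker: "\<And>x a. x \<in> Ob C \<Longrightarrow> a \<in> carrier (obm P x) \<Longrightarrow> e x (\<phi> x a) = \<one>\<^bsub>obm N'' x\<^esub>"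
  obtains \<psi> where "\<psi> \<in> nat_trans C P N"
    "\<And>x a. x \<in> Ob C \<Longrightarrow> a \<in> carrier (obm P x) \<Longrightarrow> d x (\<psi> x a) = \<phi> x a"
proof (rule lifts_through_surjection[OF lifts P N kernel_mod_module[OF N' N'' e]])
  have d_ker: "d x a \<in> kernel (obm N' x) (obm N'' x) (e x)" if "x \<in> Ob C" "a \<in> carrier (obm N x)"
      for x a
    using exact that by blast
  show "d \<in> nat_trans C N (kernel_mod N' N'' e)"
    using d d_ker unfolding nat_trans_def kernel_mod_def by (auto simp: hom_def)
  show "d x ` carrier (obm N x) = carrier (obm (kernel_mod N' N'' e) x)" if "x \<in> Ob C" for x
    using exact[OF that] by (simp add: kernel_mod_def)
  show "\<phi> \<in> nat_trans C P (kernel_mod N' N'' e)"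
    using \<phi> \<phi>_ker unfolding nat_trans_def kernel_mod_def kernel_def by (auto simp: hom_def)
qed (use that in blast)


section \<open>Comparison of resolutions\<close>

text \<open>Exactness alone, for modules with carriers in any type. Lifting properties are added
  where maps out of \<open>P\<close> are constructed.\<close>

locale resolution =
  fixes C :: "('o, 'm) cat" and M :: "('o, 'm, 'b) cmod" and P :: "nat \<Rightarrow> ('o, 'm, 'p) cmod"
    and d :: "nat \<Rightarrow> 'o \<Rightarrow> 'p \<Rightarrow> 'p" and \<epsilon> :: "'o \<Rightarrow> 'p \<Rightarrow> 'b"
  assumes M_module: "cat_module C M"
    and P_module: "cat_module C (P n)"
    and d_in: "d n \<in> nat_trans C (P (Suc n)) (P n)"
    and \<epsilon>_in: "\<epsilon> \<in> nat_trans C (P 0) M"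
    and \<epsilon>_surj: "x \<in> Ob C \<Longrightarrow> \<epsilon> x ` carrier (obm (P 0) x) = carrier (obm M x)"
    and exact_0: "x \<in> Ob C \<Longrightarrow> d 0 x ` carrier (obm (P 1) x) = kernel (obm (P 0) x) (obm M x) (\<epsilon> x)"
    and exact_Suc: "x \<in> Ob C \<Longrightarrow> d (Suc n) x ` carrier (obm (P (Suc (Suc n))) x)
               = kernel (obm (P (Suc n)) x) (obm (P n) x) (d n x)"
begin

text \<open>The cycles of the augmented complex, with \<open>M\<close> below degree \<open>0\<close>. The case distinction absorbs the
  change of carrier type between \<open>P 0\<close> and \<open>M\<close>.\<close>

definition is_cycle :: "nat \<Rightarrow> 'o \<Rightarrow> 'p \<Rightarrow> bool" where
  "is_cycle n x a = (case n of 0 \<Rightarrow> \<epsilon> x a = \<one>\<^bsub>obm M x\<^esub> | Suc m \<Rightarrow> d m x a = \<one>\<^bsub>obm (P m) x\<^esub>)"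

lemma boundary_is_cycle:
  assumes x: "x \<in> Ob C" and a: "a \<in> carrier (obm (P (Suc n)) x)"
  shows "is_cycle n x (d n x a)"
proof (cases n)
  case 0
  have "d 0 x a \<in> d 0 x ` carrier (obm (P 1) x)" using a 0 by simp
  then show ?thesis unfolding exact_0[OF x] by (simp add: 0 is_cycle_def kernel_def)
next
  case (Suc m)
  have "d (Suc m) x a \<in> d (Suc m) x ` carrier (obm (P (Suc (Suc m))) x)" using a Suc by simp
  then show ?thesis unfolding exact_Suc[OF x] by (simp add: Suc is_cycle_def kernel_def)
qed

lemma d_d:
  "x \<in> Ob C \<Longrightarrow> a \<in> carrier (obm (P (Suc (Suc n))) x) \<Longrightarrow> d n x (d (Suc n) x a) = \<one>\<^bsub>obm (P n) x\<^esub>"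
  using boundary_is_cycle[of x a "Suc n"] by (simp add: is_cycle_def)

lemma d_closed: "x \<in> Ob C \<Longrightarrow> a \<in> carrier (obm (P (Suc n)) x) \<Longrightarrow> d n x a \<in> carrier (obm (P n) x)"
  by (rule nat_trans_closed[OF d_in])

lemma lift_cycles:
  assumes lifts: "lifts_from C R (P (Suc n))" and R: "cat_module C R"
      and \<phi>: "\<phi> \<in> nat_trans C R (P n)"
    and cyc: "\<And>x a. x \<in> Ob C \<Longrightarrow> a \<in> carrier (obm R x) \<Longrightarrow> is_cycle n x (\<phi> x a)"
  obtains \<psi> where "\<psi> \<in> nat_trans C R (P (Suc n))"
    "\<And>x a. x \<in> Ob C \<Longrightarrow> a \<in> carrier (obm R x) \<Longrightarrow> d n x (\<psi> x a) = \<phi> x a"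
proof (cases n)
  case 0
  show thesis
  proof (rule lifts_through_exact[OF lifts R P_module P_module[of n] M_module d_in _ _ \<phi>])
    show "\<epsilon> \<in> nat_trans C (P n) M" using \<epsilon>_in 0 by simp
    show "d n x ` carrier (obm (P (Suc n)) x) = kernel (obm (P n) x) (obm M x) (\<epsilon> x)"
        if "x \<in> Ob C" for x
      using exact_0[OF that] 0 by simp
    show "\<epsilon> x (\<phi> x a) = \<one>\<^bsub>obm M x\<^esub>" if "x \<in> Ob C" "a \<in> carrier (obm R x)" for x a
      using cyc[OF that] 0 by (simp add: is_cycle_def)
  qed (use that in blast)
next
  case (Suc m)
  show thesis
  proof (rule lifts_through_exact[OF lifts R P_module P_module[of n] P_module[of m] d_in _ _ \<phi>])
    show "d m \<in> nat_trans C (P n) (P m)" using d_in Suc by simp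
    show "d n x ` carrier (obm (P (Suc n)) x) = kernel (obm (P n) x) (obm (P m) x) (d m x)"
        if "x \<in> Ob C" for x
      using exact_Suc[OF that] Suc by simp
    show "d m x (\<phi> x a) = \<one>\<^bsub>obm (P m) x\<^esub>" if "x \<in> Ob C" "a \<in> carrier (obm R x)" for x a
      using cyc[OF that] Suc by (simp add: is_cycle_def)
  qed (use that in blast)
qed

lemma Hom_cochain_complex:
  assumes A: "cat_module C A"
  shows "cochain_complex (\<lambda>n. Hom_group C (P n) A) (\<lambda>n f. nt_comp C (P (Suc n)) f (d n))"
proof (rule cochain_complex.intro)
  fix n
  show "comm_group (Hom_group C (P n) A)" by (rule Hom_group_comm_group[OF P_module A])
  show "(\<lambda>f. nt_comp C (P (Suc n)) f (d n)) \<in> hom (Hom_group C (P n) A) (Hom_group C (P (Suc n)) A)"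
    by (rule precomp_hom[OF P_module P_module A d_in])
  fix f assume "f \<in> carrier (Hom_group C (P n) A)"
  then have f: "f \<in> nat_trans C (P n) A" by simp
  have one: "\<one>\<^bsub>Hom_group C (P (Suc (Suc n))) A\<^esub> \<in> nat_trans C (P (Suc (Suc n))) A"
    using group.is_monoid[OF comm_group.axioms(2)[OF Hom_group_comm_group[OF P_module A]]]
      monoid.one_closed by fastforce
  show "nt_comp C (P (Suc (Suc n))) (nt_comp C (P (Suc n)) f (d n)) (d (Suc n))
      = \<one>\<^bsub>Hom_group C (P (Suc (Suc n))) A\<^esub>"
    by (rule nat_trans_eqI[OF nt_comp_in[OF P_module d_in nt_comp_in[OF P_module d_in f]] one])
      (simp add: d_closed d_d nat_trans_one[OF P_module A f])
qed

lemma postcomp_cochain_map: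
  assumes A: "cat_module C A" and A': "cat_module C A'" and \<alpha>: "\<alpha> \<in> nat_trans C A A'"
  shows "cochain_map (\<lambda>n. Hom_group C (P n) A) (\<lambda>n f. nt_comp C (P (Suc n)) f (d n))
    (\<lambda>n. Hom_group C (P n) A') (\<lambda>n f. nt_comp C (P (Suc n)) f (d n)) (\<lambda>n. nt_comp C (P n) \<alpha>)"
proof (intro cochain_map.intro cochain_map_axioms.intro Hom_cochain_complex A A')
  fix n
  show "nt_comp C (P n) \<alpha> \<in> hom (Hom_group C (P n) A) (Hom_group C (P n) A')"
    using postcomp_hom[OF P_module A A' \<alpha>] .
  fix f assume "f \<in> carrier (Hom_group C (P n) A)"
  then have f: "f \<in> nat_trans C (P n) A" by simp
  show "nt_comp C (P (Suc n)) \<alpha> (nt_comp C (P (Suc n)) f (d n))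
      = nt_comp C (P (Suc n)) (nt_comp C (P n) \<alpha> f) (d n)"
    by (rule nt_comp_assoc[OF P_module P_module d_in f \<alpha>, symmetric])
qed

end

locale resolution_pair = P: resolution C M P d \<epsilon> + Q: resolution C M Q d' \<epsilon>'
  for C :: "('o, 'm) cat" and M :: "('o, 'm, 'b) cmod" and P :: "nat \<Rightarrow> ('o, 'm, 'p) cmod"
    and d \<epsilon> and Q :: "nat \<Rightarrow> ('o, 'm, 'q) cmod" and d' \<epsilon>' +
  assumes lifts: "lifts_from C (P n) (Q m)"
begin

definition chain_map :: "(nat \<Rightarrow> 'o \<Rightarrow> 'p \<Rightarrow> 'q) \<Rightarrow> bool" where
  "chain_map p \<longleftrightarrow> (\<forall>n. p n \<in> nat_trans C (P n) (Q n)) \<and>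
    (\<forall>x \<in> Ob C. \<forall>a \<in> carrier (obm (P 0) x). \<epsilon>' x (p 0 x a) = \<epsilon> x a) \<and>
    (\<forall>n. \<forall>x \<in> Ob C. \<forall>a \<in> carrier (obm (P (Suc n)) x). d' n x (p (Suc n) x a) = p n x (d n x a))"

lemma chain_mapD:
  assumes "chain_map p"
  shows "p n \<in> nat_trans C (P n) (Q n)"
    and "x \<in> Ob C \<Longrightarrow> a \<in> carrier (obm (P 0) x) \<Longrightarrow> \<epsilon>' x (p 0 x a) = \<epsilon> x a"
    and "x \<in> Ob C \<Longrightarrow> a \<in> carrier (obm (P (Suc n)) x) \<Longrightarrow> d' n x (p (Suc n) x a) = p n x (d n x a)"
    and "x \<in> Ob C \<Longrightarrow> a \<in> carrier (obm (P n) x) \<Longrightarrow> p n x a \<in> carrier (obm (Q n) x)"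
  using assms nat_trans_closed[of "p n" C "P n" "Q n" x a] unfolding chain_map_def by blast+

text \<open>The maps are lifted one degree at a time. A lift in degree \<open>n + 1\<close> exists because \<open>p n\<close> sends
  boundaries to cycles, which is the invariant of the recursion.\<close>

lemma chain_map_exists: "\<exists>p. chain_map p"
proof -
  let ?ok = "\<lambda>n p. p \<in> nat_trans C (P n) (Q n)
      \<and> (n = 0 \<longrightarrow> (\<forall>x \<in> Ob C. \<forall>a \<in> carrier (obm (P 0) x). \<epsilon>' x (p x a) = \<epsilon> x a))
     \<and> (\<forall>x \<in> Ob C. \<forall>a \<in> carrier (obm (P (Suc n)) x). Q.is_cycle n x (p x (d n x a)))"
  have "\<exists>p. \<forall>n. ?ok n (p n) \<and>
      (\<forall>x \<in> Ob C. \<forall>a \<in> carrier (obm (P (Suc n)) x). d' n x (p (Suc n) x a) = p n x (d n x a))"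
  proof (rule dependent_nat_choice)
    obtain p where p: "p \<in> nat_trans C (P 0) (Q 0)"
      "\<And>x a. x \<in> Ob C \<Longrightarrow> a \<in> carrier (obm (P 0) x) \<Longrightarrow> \<epsilon>' x (p x a) = \<epsilon> x a"
      using lifts_through_surjection[OF lifts P.P_module Q.P_module P.M_module Q.\<epsilon>_in Q.\<epsilon>_surj
          P.\<epsilon>_in]
      by blast
    have "?ok 0 p"
      using p P.d_closed[of _ _ 0] P.boundary_is_cycle[of _ _ 0]
          by (simp add: Q.is_cycle_def P.is_cycle_def)
    then show "\<exists>p. ?ok 0 p" by blast
  next
    fix p n assume p: "?ok n p"
    then have p_in: "p \<in> nat_trans C (P n) (Q n)" by simp
    have cyc: "Q.is_cycle n x (nt_comp C (P (Suc n)) p (d n) x a)"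
      if "x \<in> Ob C" "a \<in> carrier (obm (P (Suc n)) x)" for x a
      using p that by simp
    obtain p' where p': "p' \<in> nat_trans C (P (Suc n)) (Q (Suc n))"
      "\<And>x a. x \<in> Ob C \<Longrightarrow> a \<in> carrier (obm (P (Suc n)) x) \<Longrightarrow> d' n x (p' x a)
          = nt_comp C (P (Suc n)) p (d n) x a"
      using Q.lift_cycles[OF lifts P.P_module nt_comp_in[OF P.P_module P.d_in p_in] cyc] by blast
    have "?ok (Suc n) p'"
      using p' by (simp add: Q.is_cycle_def P.d_closed P.d_d
          nat_trans_one[OF P.P_module Q.P_module p_in])
    then show "\<exists>p'. ?ok (Suc n) p' \<and>
        (\<forall>x \<in> Ob C. \<forall>a \<in> carrier (obm (P (Suc n)) x). d' n x (p' x a) = p x (d n x a))"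
      using p'(2) by (intro exI[of _ p']) simp
  qed
  then obtain p where p: "\<forall>n. ?ok n (p n) \<and>
      (\<forall>x \<in> Ob C. \<forall>a \<in> carrier (obm (P (Suc n)) x). d' n x (p (Suc n) x a) = p n x (d n x a))"
    by (rule exE)
  have ok: "?ok n (p n)" for n by (rule conjunct1[OF spec[OF p]])
  have "chain_map p"
    unfolding chain_map_def
  proof (intro conjI allI)
    show "p n \<in> nat_trans C (P n) (Q n)" for n by (rule conjunct1[OF ok])
    show "\<forall>x \<in> Ob C. \<forall>a \<in> carrier (obm (P 0) x). \<epsilon>' x (p 0 x a) = \<epsilon> x a"
      using conjunct1[OF conjunct2[OF ok[of 0]]] by simp
    show "\<forall>x \<in> Ob C. \<forall>a \<in> carrier (obm (P (Suc n)) x). d' n x (p (Suc n) x a) = p n x (d n x a)"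
        for n
      by (rule conjunct2[OF spec[OF p]])
  qed
  then show ?thesis by blast
qed

text \<open>The difference \<open>k\<close> of \<open>f\<close> and \<open>g\<close> commutes with the differentials and is killed by the
  augmentation. Since \<open>d' n \<circ> h n\<close> and \<open>k n\<close> agree on boundaries, \<open>k (Suc n) - h n \<circ> d n\<close>
  has values in the cycles, and \<open>h (Suc n)\<close> is a lift of it.\<close>

lemma chain_homotopy:
  assumes f: "chain_map f" and g: "chain_map g"
  obtains h where "\<And>n. h n \<in> nat_trans C (P n) (Q (Suc n))"
    "\<And>x a. x \<in> Ob C \<Longrightarrow> a \<in> carrier (obm (P 0) x) \<Longrightarrow>
      f 0 x a \<otimes>\<^bsub>obm (Q 0) x\<^esub> inv\<^bsub>obm (Q 0) x\<^esub> g 0 x a = d' 0 x (h 0 x a)"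
    "\<And>n x a. x \<in> Ob C \<Longrightarrow> a \<in> carrier (obm (P (Suc n)) x) \<Longrightarrow>
      f (Suc n) x a \<otimes>\<^bsub>obm (Q (Suc n)) x\<^esub> inv\<^bsub>obm (Q (Suc n)) x\<^esub> g (Suc n) x a
       = d' (Suc n) x (h (Suc n) x a) \<otimes>\<^bsub>obm (Q (Suc n)) x\<^esub> h n x (d n x a)"
proof -
  define k where "k n = f n \<otimes>\<^bsub>Hom_group C (P n) (Q n)\<^esub> inv\<^bsub>Hom_group C (P n) (Q n)\<^esub> g n" for n
  have Hom: "group (Hom_group C (P n) (Q m))" for n m
    by (rule comm_group.axioms(2)[OF Hom_group_comm_group[OF P.P_module Q.P_module]])
  have inv_in: "inv\<^bsub>Hom_group C (P n) (Q m)\<^esub> \<eta> \<in> nat_trans C (P n) (Q m)"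
      if "\<eta> \<in> nat_trans C (P n) (Q m)" for n m \<eta>
    using group.inv_closed[OF Hom, of \<eta> n m] that by simp
  note mult_in = Hom_group_mult_in[OF P.P_module Q.P_module]
  have k_in: "k n \<in> nat_trans C (P n) (Q n)" for n
    unfolding k_def by (rule mult_in[OF chain_mapD(1)[OF f] inv_in[OF chain_mapD(1)[OF g]]])
  have k: "k n x a = f n x a \<otimes>\<^bsub>obm (Q n) x\<^esub> inv\<^bsub>obm (Q n) x\<^esub> g n x a"
    if "x \<in> Ob C" "a \<in> carrier (obm (P n) x)" for n x a
    using that by (simp add: k_def Hom_group_inv_apply[OF P.P_module Q.P_module
        chain_mapD(1)[OF g]])
  have k_closed: "k n x a \<in> carrier (obm (Q n) x)" if "x \<in> Ob C" "a \<in> carrier (obm (P n) x)"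
      for n x a
    by (rule nat_trans_closed[OF k_in that])
  have k_d: "d' n x (k (Suc n) x a) = k n x (d n x a)"
    if x: "x \<in> Ob C" and a: "a \<in> carrier (obm (P (Suc n)) x)" for n x a
  proof -
    interpret h: group_hom "obm (Q (Suc n)) x" "obm (Q n) x" "d' n x"
      by (rule nat_trans_group_hom[OF Q.P_module Q.P_module Q.d_in x])
    show ?thesis
      using x a by (simp add: k P.d_closed chain_mapD[OF f] chain_mapD[OF g])
  qed
  have k_0: "\<epsilon>' x (k 0 x a) = \<one>\<^bsub>obm M x\<^esub>"
    if x: "x \<in> Ob C" and a: "a \<in> carrier (obm (P 0) x)" for x a
  proof -
    interpret h: group_hom "obm (Q 0) x" "obm M x" "\<epsilon>' x"
      by (rule nat_trans_group_hom[OF Q.P_module P.M_module Q.\<epsilon>_in x])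
    show ?thesis
      using x a nat_trans_closed[OF P.\<epsilon>_in x a] by (simp add: k chain_mapD[OF f] chain_mapD[OF g])
  qed
  \<comment> \<open>In degree \<open>0\<close> the recursion starts from \<open>k 0 = d' 0 \<circ> h 0\<close>; \<open>?next\<close> is the homotopy
      identity in degree \<open>n + 1\<close>, and the last clause of \<open>?ok\<close> makes the map to be lifted there
      a cycle.\<close>
  let ?ok = "\<lambda>n h. h \<in> nat_trans C (P n) (Q (Suc n)) \<and>
     (n = 0 \<longrightarrow> (\<forall>x \<in> Ob C. \<forall>a \<in> carrier (obm (P n) x). k 0 x a = d' 0 x (h x a))) \<and>
     (\<forall>x \<in> Ob C. \<forall>a \<in> carrier (obm (P (Suc n)) x). d' n x (h x (d n x a)) = k n x (d n x a))"
  let ?next = "\<lambda>n h h'. \<forall>x \<in> Ob C. \<forall>a \<in> carrier (obm (P (Suc n)) x).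
      k (Suc n) x a = d' (Suc n) x (h' x a) \<otimes>\<^bsub>obm (Q (Suc n)) x\<^esub> h x (d n x a)"
  have "\<exists>h. \<forall>n. ?ok n (h n) \<and> ?next n (h n) (h (Suc n))"
  proof (rule dependent_nat_choice)
    obtain h where "h \<in> nat_trans C (P 0) (Q (Suc 0))"
      "\<And>x a. x \<in> Ob C \<Longrightarrow> a \<in> carrier (obm (P 0) x) \<Longrightarrow> d' 0 x (h x a) = k 0 x a"
      by (rule Q.lift_cycles[OF lifts P.P_module k_in[of 0]]) (simp_all add: Q.is_cycle_def k_0)
    then have "?ok 0 h" using P.d_closed by simp
    then show "\<exists>h. ?ok 0 h" by blast
  next
    fix h n assume h: "?ok n h"
    then have h_in: "h \<in> nat_trans C (P n) (Q (Suc n))" by blast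
    define l where "l = nt_comp C (P (Suc n)) h (d n)"
    have l_in: "l \<in> nat_trans C (P (Suc n)) (Q (Suc n))"
      unfolding l_def by (rule nt_comp_in[OF P.P_module P.d_in h_in])
    define r where "r = k (Suc n) \<otimes>\<^bsub>Hom_group C (P (Suc n)) (Q (Suc n))\<^esub> inv\<^bsub>Hom_group C
        (P (Suc n)) (Q (Suc n))\<^esub> l"
    have r_in: "r \<in> nat_trans C (P (Suc n)) (Q (Suc n))"
      unfolding r_def by (rule mult_in[OF k_in inv_in[OF l_in]])
    have r: "r x a = k (Suc n) x a \<otimes>\<^bsub>obm (Q (Suc n)) x\<^esub> inv\<^bsub>obm (Q (Suc n)) x\<^esub> h x (d n x a)"
      if "x \<in> Ob C" "a \<in> carrier (obm (P (Suc n)) x)" for x a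
      using that by (simp add: r_def Hom_group_inv_apply[OF P.P_module Q.P_module l_in])
          (simp add: l_def)
    have r_cycle: "Q.is_cycle (Suc n) x (r x a)"
      if x: "x \<in> Ob C" and a: "a \<in> carrier (obm (P (Suc n)) x)" for x a
    proof -
      interpret h: group_hom "obm (Q (Suc n)) x" "obm (Q n) x" "d' n x"
        by (rule nat_trans_group_hom[OF Q.P_module Q.P_module Q.d_in x])
      have "h x (d n x a) \<in> carrier (obm (Q (Suc n)) x)"
        using nat_trans_closed[OF h_in x] P.d_closed[OF x a] .
      moreover have "d' n x (h x (d n x a)) = k n x (d n x a)" using h x a by blast
      ultimately show ?thesis
        using x a by (simp add: Q.is_cycle_def r k_closed k_d P.d_closed)
    qed
    obtain h' where h': "h' \<in> nat_trans C (P (Suc n)) (Q (Suc (Suc n)))"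
      "\<And>x a. x \<in> Ob C \<Longrightarrow> a \<in> carrier (obm (P (Suc n)) x) \<Longrightarrow> d' (Suc n) x (h' x a) = r x a"
      using Q.lift_cycles[OF lifts P.P_module r_in r_cycle] by blast
    have "d' (Suc n) x (h' x (d (Suc n) x a)) = k (Suc n) x (d (Suc n) x a)"
      if x: "x \<in> Ob C" and a: "a \<in> carrier (obm (P (Suc (Suc n))) x)" for x a
    proof -
      interpret q: comm_group "obm (Q (Suc n)) x" using Q.P_module x by (rule cat_module_groupD)
      show ?thesis
        using x a by (simp add: h'(2) r P.d_closed P.d_d
            nat_trans_one[OF P.P_module Q.P_module h_in] k_closed)
    qed
    then have "?ok (Suc n) h'" using h'(1) by simp
    moreover have "?next n h h'"
    proof (intro ballI)
      fix x a assume x: "x \<in> Ob C" and a: "a \<in> carrier (obm (P (Suc n)) x)"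
      interpret q: comm_group "obm (Q (Suc n)) x" using Q.P_module x by (rule cat_module_groupD)
      have "h x (d n x a) \<in> carrier (obm (Q (Suc n)) x)"
        using nat_trans_closed[OF h_in x] P.d_closed[OF x a] .
      then show "k (Suc n) x a = d' (Suc n) x (h' x a) \<otimes>\<^bsub>obm (Q (Suc n)) x\<^esub> h x (d n x a)"
        using x a by (simp add: h'(2) r k_closed q.m_assoc)
    qed
    ultimately show "\<exists>h'. ?ok (Suc n) h' \<and> ?next n h h'" by blast
  qed
  then obtain h where h: "\<forall>n. ?ok n (h n) \<and> ?next n (h n) (h (Suc n))" by (rule exE)
  show thesis
  proof (rule that[of h])
    show "h n \<in> nat_trans C (P n) (Q (Suc n))" for n
        by (rule conjunct1[OF conjunct1[OF spec[OF h]]])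
    show "f 0 x a \<otimes>\<^bsub>obm (Q 0) x\<^esub> inv\<^bsub>obm (Q 0) x\<^esub> g 0 x a = d' 0 x (h 0 x a)"
      if "x \<in> Ob C" "a \<in> carrier (obm (P 0) x)" for x a
      unfolding k[OF that, symmetric] using spec[OF h, of 0] that by simp
    show "f (Suc n) x a \<otimes>\<^bsub>obm (Q (Suc n)) x\<^esub> inv\<^bsub>obm (Q (Suc n)) x\<^esub> g (Suc n) x a
       = d' (Suc n) x (h (Suc n) x a) \<otimes>\<^bsub>obm (Q (Suc n)) x\<^esub> h n x (d n x a)"
      if "x \<in> Ob C" "a \<in> carrier (obm (P (Suc n)) x)" for n x a
      unfolding k[OF that, symmetric] using spec[OF h, of n] that by simp
  qed
qed

lemma chain_map_cochain_map:
  assumes p: "chain_map p" and A: "cat_module C A"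
  shows "cochain_map (\<lambda>n. Hom_group C (Q n) A) (\<lambda>n f. nt_comp C (Q (Suc n)) f (d' n))
    (\<lambda>n. Hom_group C (P n) A) (\<lambda>n f. nt_comp C (P (Suc n)) f (d n)) (\<lambda>n f. nt_comp C (P n) f (p n))"
proof (intro cochain_map.intro cochain_map_axioms.intro)
  show "cochain_complex (\<lambda>n. Hom_group C (Q n) A) (\<lambda>n f. nt_comp C (Q (Suc n)) f (d' n))"
    by (rule Q.Hom_cochain_complex[OF A])
  show "cochain_complex (\<lambda>n. Hom_group C (P n) A) (\<lambda>n f. nt_comp C (P (Suc n)) f (d n))"
    by (rule P.Hom_cochain_complex[OF A])
  fix n
  note p_in = chain_mapD(1)[OF p]
  show "(\<lambda>f. nt_comp C (P n) f (p n)) \<in> hom (Hom_group C (Q n) A) (Hom_group C (P n) A)"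
    by (rule precomp_hom[OF P.P_module Q.P_module A p_in])
  fix f assume "f \<in> carrier (Hom_group C (Q n) A)"
  then have f: "f \<in> nat_trans C (Q n) A" by simp
  show "nt_comp C (P (Suc n)) (nt_comp C (Q (Suc n)) f (d' n)) (p (Suc n))
      = nt_comp C (P (Suc n)) (nt_comp C (P n) f (p n)) (d n)"
    by (rule nat_trans_eqI[OF nt_comp_in[OF P.P_module p_in nt_comp_in[OF Q.P_module Q.d_in f]]
          nt_comp_in[OF P.P_module P.d_in nt_comp_in[OF P.P_module p_in f]]])
      (simp add: chain_mapD[OF p] P.d_closed)
qed

text \<open>With a homotopy \<open>h\<close>, the difference of \<open>z \<circ> f\<close> and \<open>z \<circ> g\<close> is
  \<open>z \<circ> d' \<circ> h + z \<circ> h \<circ> d\<close>. The first summand vanishes because \<open>z\<close> is a cocycle, and the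
  second is the coboundary of \<open>z \<circ> h\<close>, or trivial in degree \<open>0\<close>.\<close>

lemma chain_maps_cohomologous:
  assumes f: "chain_map f" and g: "chain_map g" and A: "cat_module C A"
    and z: "z \<in> cocycle_set (\<lambda>n. Hom_group C (Q n) A) (\<lambda>n f. nt_comp C (Q (Suc n)) f (d' n)) n"
  shows "nt_comp C (P n) z (f n) \<otimes>\<^bsub>Hom_group C (P n) A\<^esub> inv\<^bsub>Hom_group C (P n) A\<^esub> nt_comp C (P n)
      z (g n)
    \<in> coboundary_set (\<lambda>n. Hom_group C (P n) A) (\<lambda>n f. nt_comp C (P (Suc n)) f (d n)) n"
proof -
  interpret K: cochain_complex "\<lambda>n. Hom_group C (Q n) A" "\<lambda>n f. nt_comp C (Q (Suc n)) f (d' n)"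
    by (rule Q.Hom_cochain_complex[OF A])
  interpret H: comm_group "Hom_group C (P n) A" by (rule Hom_group_comm_group[OF P.P_module A])
  have z_in: "z \<in> nat_trans C (Q n) A" using z K.cocycle_iff by simp
  have z_d: "z x (d' n x b) = \<one>\<^bsub>obm A x\<^esub>" if "x \<in> Ob C" "b \<in> carrier (obm (Q (Suc n)) x)" for x b
  proof -
    have "nt_comp C (Q (Suc n)) z (d' n) x b = \<one>\<^bsub>Hom_group C (Q (Suc n)) A\<^esub> x b"
      using z K.cocycle_iff by simp
    then show ?thesis using that by simp
  qed
  define w where "w = nt_comp C (P n) z (f n) \<otimes>\<^bsub>Hom_group C (P n) A\<^esub> inv\<^bsub>Hom_group C (P n) A\<^esub>
      nt_comp C (P n) z (g n)"
  note zf = nt_comp_in[OF P.P_module chain_mapD(1)[OF f] z_in]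
    and zg = nt_comp_in[OF P.P_module chain_mapD(1)[OF g] z_in]
  have w_in: "w \<in> nat_trans C (P n) A"
    unfolding w_def using H.m_closed H.inv_closed zf zg by simp
  have w: "w x a = z x (f n x a \<otimes>\<^bsub>obm (Q n) x\<^esub> inv\<^bsub>obm (Q n) x\<^esub> g n x a)"
    if x: "x \<in> Ob C" and a: "a \<in> carrier (obm (P n) x)" for x a
  proof -
    interpret h: group_hom "obm (Q n) x" "obm A x" "z x"
      by (rule nat_trans_group_hom[OF Q.P_module A z_in x])
    show ?thesis
      using x a chain_mapD(4)[OF f x a] chain_mapD(4)[OF g x a]
      by (simp add: w_def Hom_group_inv_apply[OF P.P_module A zg])
  qed
  obtain h where h_in: "\<And>n. h n \<in> nat_trans C (P n) (Q (Suc n))"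
      and h_0: "\<And>x a. x \<in> Ob C \<Longrightarrow> a \<in> carrier (obm (P 0) x) \<Longrightarrow>
      f 0 x a \<otimes>\<^bsub>obm (Q 0) x\<^esub> inv\<^bsub>obm (Q 0) x\<^esub> g 0 x a = d' 0 x (h 0 x a)"
    and h_Suc: "\<And>n x a. x \<in> Ob C \<Longrightarrow> a \<in> carrier (obm (P (Suc n)) x) \<Longrightarrow>
      f (Suc n) x a \<otimes>\<^bsub>obm (Q (Suc n)) x\<^esub> inv\<^bsub>obm (Q (Suc n)) x\<^esub> g (Suc n) x a
       = d' (Suc n) x (h (Suc n) x a) \<otimes>\<^bsub>obm (Q (Suc n)) x\<^esub> h n x (d n x a)"
    using chain_homotopy[OF f g] by blast
  have "w \<in> coboundary_set (\<lambda>n. Hom_group C (P n) A) (\<lambda>n f. nt_comp C (P (Suc n)) f (d n)) n"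
  proof (cases n)
    case 0
    have "w = \<one>\<^bsub>Hom_group C (P n) A\<^esub>"
    proof (rule nat_trans_eqI[OF w_in])
      show "\<one>\<^bsub>Hom_group C (P n) A\<^esub> \<in> nat_trans C (P n) A" using H.one_closed by simp
      show "w x a = \<one>\<^bsub>Hom_group C (P n) A\<^esub> x a" if "x \<in> Ob C" "a \<in> carrier (obm (P n) x)" for x a
        using that z_d nat_trans_closed[OF h_in] h_0 0 by (simp add: w)
    qed
    then show ?thesis using 0 by simp
  next
    case (Suc m)
    have hm: "h m \<in> nat_trans C (P m) (Q n)" and zn: "z \<in> nat_trans C (Q n) A"
        using h_in z_in Suc by simp_all
    have zh: "nt_comp C (P m) z (h m) \<in> nat_trans C (P m) A"
        by (rule nt_comp_in[OF P.P_module hm zn])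
    have "w = nt_comp C (P n) (nt_comp C (P m) z (h m)) (d m)"
    proof (rule nat_trans_eqI[OF w_in])
      show "nt_comp C (P n) (nt_comp C (P m) z (h m)) (d m) \<in> nat_trans C (P n) A"
        using nt_comp_in[OF P.P_module P.d_in zh] Suc by simp
      fix x a assume x: "x \<in> Ob C" and a: "a \<in> carrier (obm (P n) x)"
      interpret h: group_hom "obm (Q n) x" "obm A x" "z x"
        by (rule nat_trans_group_hom[OF Q.P_module A z_in x])
      have da: "d m x a \<in> carrier (obm (P m) x)" using P.d_closed x a Suc by simp
      have hd: "h m x (d m x a) \<in> carrier (obm (Q n) x)" by (rule nat_trans_closed[OF hm x da])
      have hn: "h n x a \<in> carrier (obm (Q (Suc n)) x)" by (rule nat_trans_closed[OF h_in x a])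
      have "f n x a \<otimes>\<^bsub>obm (Q n) x\<^esub> inv\<^bsub>obm (Q n) x\<^esub> g n x a
          = d' n x (h n x a) \<otimes>\<^bsub>obm (Q n) x\<^esub> h m x (d m x a)"
        using h_Suc[of x a m] x a Suc by simp
      then have "w x a = z x (h m x (d m x a))"
        using hd z_d[OF x hn] Q.d_closed[OF x hn] by (simp add: w x a)
      then show "w x a = nt_comp C (P n) (nt_comp C (P m) z (h m)) (d m) x a"
        using x a da by simp
    qed
    then show ?thesis using zh Suc by auto
  qed
  then show ?thesis by (simp add: w_def)
qed

end

lemma (in group) mem_subgroup_of_quotient:
  assumes S: "subgroup S G" and z: "z \<in> carrier G" and a: "a \<in> S" "a \<otimes> inv z \<in> S"
  shows "z \<in> S"
proof -
  have "inv (a \<otimes> inv z) \<otimes> a \<in> S" using S a by (simp add: subgroup.m_closed subgroup.m_inv_closed)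
  then show ?thesis
    using z subgroup.mem_carrier[OF S a(1)] by (simp add: inv_mult_group m_assoc)
qed

text \<open>Both composites of the comparison maps are homotopic to identities. The same \<open>p\<close> serves all
  coefficient modules \<open>A\<close>, which is what makes the resulting isomorphisms natural.\<close>

lemma resolutions_quasi_isomorphic:
  fixes M :: "('o, 'm, 'b) cmod"
  assumes PQ: "resolution_pair C M P d \<epsilon> Q d' \<epsilon>'" and QP: "resolution_pair C M Q d' \<epsilon>' P d \<epsilon>"
    and PP: "resolution_pair C M P d \<epsilon> P d \<epsilon>" and QQ: "resolution_pair C M Q d' \<epsilon>' Q d' \<epsilon>'"
  shows "\<exists>p. (\<forall>n. p n \<in> nat_trans C (P n) (Q n)) \<and>
    (\<forall>A :: ('o, 'm, 'a) cmod. cat_module C A \<longrightarrow>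
       quasi_isomorphism (\<lambda>n. Hom_group C (Q n) A) (\<lambda>n f. nt_comp C (Q (Suc n)) f (d' n))
         (\<lambda>n. Hom_group C (P n) A) (\<lambda>n f. nt_comp C (P (Suc n)) f (d n))
             (\<lambda>n f. nt_comp C (P n) f (p n)))"
proof -
  interpret PQ: resolution_pair C M P d \<epsilon> Q d' \<epsilon>' by fact
  interpret QP: resolution_pair C M Q d' \<epsilon>' P d \<epsilon> by fact
  interpret PP: resolution_pair C M P d \<epsilon> P d \<epsilon> by fact
  interpret QQ: resolution_pair C M Q d' \<epsilon>' Q d' \<epsilon>' by fact
  obtain p where p: "PQ.chain_map p" using PQ.chain_map_exists by blast
  obtain q where q: "QP.chain_map q" using QP.chain_map_exists by blast
  note pD = PQ.chain_mapD[OF p] and qD = QP.chain_mapD[OF q]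
  note P_mod = PQ.P.P_module and Q_mod = PQ.Q.P_module
  have qp: "PP.chain_map (\<lambda>n. nt_comp C (P n) (q n) (p n))"
    unfolding PP.chain_map_def by (simp add: nt_comp_in[OF P_mod pD(1) qD(1)] pD qD PQ.P.d_closed)
  have pq: "QQ.chain_map (\<lambda>n. nt_comp C (Q n) (p n) (q n))"
    unfolding QQ.chain_map_def by (simp add: nt_comp_in[OF Q_mod qD(1) pD(1)] pD qD PQ.Q.d_closed)
  have idP: "PP.chain_map (\<lambda>n. nt_id C (P n))"
    unfolding PP.chain_map_def by (simp add: nt_id_in[OF P_mod] PQ.P.d_closed)
  have idQ: "QQ.chain_map (\<lambda>n. nt_id C (Q n))"
    unfolding QQ.chain_map_def by (simp add: nt_id_in[OF Q_mod] PQ.Q.d_closed)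
  show ?thesis
  proof (intro exI[of _ p] conjI allI impI)
    show "p n \<in> nat_trans C (P n) (Q n)" for n by (rule pD(1))
    fix A :: "('o, 'm, 'a) cmod" assume A: "cat_module C A"
    let ?KP = "\<lambda>n. Hom_group C (P n) A" and ?KQ = "\<lambda>n. Hom_group C (Q n) A"
    let ?dP = "\<lambda>n f. nt_comp C (P (Suc n)) f (d n)" and ?dQ = "\<lambda>n f. nt_comp C (Q (Suc n)) f (d' n)"
    interpret p: cochain_map ?KQ ?dQ ?KP ?dP "\<lambda>n f. nt_comp C (P n) f (p n)"
      by (rule PQ.chain_map_cochain_map[OF p A])
    interpret q: cochain_map ?KP ?dP ?KQ ?dQ "\<lambda>n f. nt_comp C (Q n) f (q n)"
      by (rule QP.chain_map_cochain_map[OF q A])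
    have id: "nt_comp C N z (nt_id C N) = z" if "z \<in> nat_trans C N A" "cat_module C N"
      for N :: "('o, 'm, 'v) cmod" and z
      by (rule nat_trans_eqI[OF nt_comp_in[OF that(2) nt_id_in[OF that(2)] that(1)] that(1)]) simp
    show "quasi_isomorphism ?KQ ?dQ ?KP ?dP (\<lambda>n f. nt_comp C (P n) f (p n))"
    proof (intro quasi_isomorphism.intro quasi_isomorphism_axioms.intro p.cochain_map_axioms)
      fix n z assume z: "z \<in> cocycle_set ?KQ ?dQ n"
          and b: "nt_comp C (P n) z (p n) \<in> coboundary_set ?KP ?dP n"
      have z_in: "z \<in> nat_trans C (Q n) A" using z p.K.cocycle_iff by simp
      interpret H: comm_group "?KQ n" by (rule p.K.cochain_group)
      note sub = p.K.subgroup_coboundaries[of n]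
      have zpq: "nt_comp C (Q n) z (nt_comp C (Q n) (p n) (q n)) \<in> coboundary_set ?KQ ?dQ n"
        using q.map_coboundary[OF b] by (simp add: nt_comp_assoc[OF Q_mod P_mod qD(1) pD(1) z_in])
      have "nt_comp C (Q n) z (nt_comp C (Q n) (p n) (q n)) \<otimes>\<^bsub>?KQ n\<^esub> inv\<^bsub>?KQ n\<^esub> z
          \<in> coboundary_set ?KQ ?dQ n"
        using QQ.chain_maps_cohomologous[OF pq idQ A z] by (simp add: id[OF z_in Q_mod])
      then show "z \<in> coboundary_set ?KQ ?dQ n"
        by (rule H.mem_subgroup_of_quotient[OF sub _ zpq, rotated]) (simp add: z_in)
    next
      fix n z assume z: "z \<in> cocycle_set ?KP ?dP n"
      have z_in: "z \<in> nat_trans C (P n) A" using z p.K'.cocycle_iff by simp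
      show "\<exists>y \<in> cocycle_set ?KQ ?dQ n. nt_comp C (P n) y (p n) \<otimes>\<^bsub>?KP n\<^esub> inv\<^bsub>?KP n\<^esub> z
          \<in> coboundary_set ?KP ?dP n"
        using PP.chain_maps_cohomologous[OF qp idP A z] q.map_cocycle[OF z]
        by (intro bexI[of _ "nt_comp C (Q n) z (q n)"])
          (simp_all add: nt_comp_assoc[OF P_mod Q_mod pD(1) qD(1) z_in] id[OF z_in P_mod])
    qed
  qed
qed


section \<open>Projective resolutions in a prescribed carrier type\<close>

text \<open>Transport along an injection preserves exactness, and lifting against all modules of the new
  carrier type becomes projectivity there.\<close>

lemma projective_resolution_transport:
  fixes P :: "nat \<Rightarrow> ('o, 'm, 'v) cmod" and j :: "'v \<Rightarrow> 'u"
  assumes res: "resolution C M P d \<epsilon>" and j: "inj j"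
    and lifts: "\<And>n (N :: ('o, 'm, 'u) cmod). cat_module C N \<Longrightarrow> lifts_from C (P n) N"
  shows "\<exists>(P' :: nat \<Rightarrow> ('o, 'm, 'u) cmod) d' \<epsilon>'. projective_resolution C M P' d' \<epsilon>'"
proof -
  interpret P: resolution C M P d \<epsilon> by fact
  interpret T: transport C "\<lambda>_. j" "P n" for n
    by (rule transport.intro[OF P.P_module inj_on_subset[OF j]]) simp
  define P' where "P' n = transport_mod C (\<lambda>_. j) (P n)" for n
  define d' where "d' n = nt_comp C (P' (Suc n))
      (nt_comp C (P (Suc n)) (transport_to C (\<lambda>_. j) (P n)) (d n))
      (transport_from C (\<lambda>_. j) (P (Suc n)))" for n
  define \<epsilon>' where "\<epsilon>' = nt_comp C (P' 0) \<epsilon> (transport_from C (\<lambda>_. j) (P 0))"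
  have mod: "cat_module C (P' n)" for n unfolding P'_def by (rule T.transport_module)
  have carrier: "carrier (obm (P' n) x) = j ` carrier (obm (P n) x)" for n x by (simp add: P'_def)
  have d'_in: "d' n \<in> nat_trans C (P' (Suc n)) (P' n)" for n
    unfolding d'_def P'_def
    by (rule nt_comp_in[OF T.transport_module T.transport_from_in
        nt_comp_in[OF P.P_module P.d_in T.transport_to_in]])
  have \<epsilon>'_in: "\<epsilon>' \<in> nat_trans C (P' 0) M"
    unfolding \<epsilon>'_def P'_def by (rule nt_comp_in[OF T.transport_module T.transport_from_in P.\<epsilon>_in])
  have d': "d' n x (j a) = j (d n x a)" if "x \<in> Ob C" "a \<in> carrier (obm (P (Suc n)) x)" for n x a
    using that by (simp add: d'_def carrier P.d_closed T.transport_to_apply)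
  have \<epsilon>': "\<epsilon>' x (j a) = \<epsilon> x a" if "x \<in> Ob C" "a \<in> carrier (obm (P 0) x)" for x a
    using that by (simp add: \<epsilon>'_def carrier)
  have image: "d' n x ` carrier (obm (P' (Suc n)) x) = j ` d n x ` carrier (obm (P (Suc n)) x)"
    if "x \<in> Ob C" for n x
    unfolding carrier image_image by (rule image_cong) (simp_all add: d' that)
  have one: "\<one>\<^bsub>obm (P' n) x\<^esub> = j \<one>\<^bsub>obm (P n) x\<^esub>" for n x by (simp add: P'_def)
  have exact_0: "d' 0 x ` carrier (obm (P' 1) x) = kernel (obm (P' 0) x) (obm M x) (\<epsilon>' x)"
      if x: "x \<in> Ob C" for x
  proof -
    have "kernel (obm (P' 0) x) (obm M x) (\<epsilon>' x) = j ` kernel (obm (P 0) x) (obm M x) (\<epsilon> x)"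
      using \<epsilon>'[OF x] by (auto simp: kernel_def carrier)
    then show ?thesis using image[OF x, of 0] P.exact_0[OF x] by simp
  qed
  have exact_Suc: "d' (Suc n) x ` carrier (obm (P' (Suc (Suc n))) x)
      = kernel (obm (P' (Suc n)) x) (obm (P' n) x) (d' n x)"
    if x: "x \<in> Ob C" for n x
  proof -
    have "kernel (obm (P' (Suc n)) x) (obm (P' n) x) (d' n x)
        = j ` kernel (obm (P (Suc n)) x) (obm (P n) x) (d n x)"
      using d'[OF x] injD[OF j] by (auto simp: kernel_def carrier one)
    then show ?thesis using image[OF x, of "Suc n"] P.exact_Suc[OF x, of n] by simp
  qed
  have proj: "projective_mod C (P' n)" for n
    unfolding projective_mod_def
  proof (intro conjI allI impI mod)
    fix N N' :: "('o, 'm, 'u) cmod" and \<pi> \<phi>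
    assume N: "cat_module C N" and N': "cat_module C N'" and \<pi>: "\<pi> \<in> nat_trans C N N'"
      and surj: "\<forall>x \<in> Ob C. \<pi> x ` carrier (obm N x) = carrier (obm N' x)"
          and \<phi>: "\<phi> \<in> nat_trans C (P' n) N'"
    have "lifts_from C (P' n) N"
      unfolding P'_def by (rule transport_lifts_from[OF T.transport_axioms lifts[OF N]])
    from lifts_through_surjection[OF this mod N N' \<pi> surj[rule_format] \<phi>]
    obtain \<psi> where \<psi>: "\<psi> \<in> nat_trans C (P' n) N"
      "\<And>x a. x \<in> Ob C \<Longrightarrow> a \<in> carrier (obm (P' n) x) \<Longrightarrow> \<pi> x (\<psi> x a) = \<phi> x a" by blast
    have "nt_comp C (P' n) \<pi> \<psi> = \<phi>"
      by (rule nat_trans_eqI[OF nt_comp_in[OF mod \<psi>(1) \<pi>] \<phi>]) (simp add: \<psi>(2))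
    with \<psi>(1) show "\<exists>\<psi> \<in> nat_trans C (P' n) N. nt_comp C (P' n) \<pi> \<psi> = \<phi>" by blast
  qed
  have surj: "\<epsilon>' x ` carrier (obm (P' 0) x) = carrier (obm M x)" if x: "x \<in> Ob C" for x
  proof -
    have "\<epsilon>' x ` carrier (obm (P' 0) x) = \<epsilon> x ` carrier (obm (P 0) x)"
      unfolding carrier image_image by (rule image_cong) (simp_all add: \<epsilon>' x)
    then show ?thesis using P.\<epsilon>_surj[OF x] by simp
  qed
  have "projective_resolution C M P' d' \<epsilon>'"
    unfolding projective_resolution_def using proj d'_in \<epsilon>'_in surj exact_0 exact_Suc by simp
  then show ?thesis by blast
qed

lemma projective_resolution_resolution:
  assumes "projective_resolution C M P d \<epsilon>" "cat_module C M"
  shows "resolution C M P d \<epsilon>"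
  using assms by (intro resolution.intro)
      (simp_all add: projective_resolution_def projective_mod_def)

lemma cochains_eq: "cochains C M A = (\<lambda>n. Hom_group C (res_mod C M n) A)"
  by (simp add: cochains_def fun_eq_iff)

lemma coboundary_eq: "coboundary C M = (\<lambda>n f. nt_comp C (res_mod C M (Suc n)) f (res_diff C M n))"
  by (simp add: coboundary_def fun_eq_iff)

lemma Ext_eq_cohomology: "Ext C n M A = cohomology (cochains C M A) (coboundary C M) n"
proof -
  have "coboundaries C M A n = coboundary_set (cochains C M A) (coboundary C M) n"
      by (cases n) simp_all
  then show ?thesis by (simp add: Ext_def cohomology_def cocycles_def cocycle_set_def)
qed

lemma Ext_map_eq_cohomology_map:
  "Ext_map C n M A' \<alpha> =
    cohomology_map (cochains C M A') (coboundary C M) (\<lambda>n. nt_comp C (res_mod C M n) \<alpha>) n"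
proof -
  have "coboundaries C M A' n = coboundary_set (cochains C M A') (coboundary C M) n"
      by (cases n) simp_all
  then show ?thesis by (simp add: Ext_map_def cohomology_map_def fun_eq_iff)
qed

text \<open>A resolution that computes \<open>Ext\<close>: it is comparable with the resolution chosen in the definition
  of \<open>Ext\<close>, because its carrier type embeds in \<open>res_carrier\<close> and its modules lift against both
  resolutions.\<close>

locale lifting_resolution = resolution C M P d \<epsilon>
  for C :: "('o, 'm) cat" and M :: "('o, 'm, 'b) cmod" and P :: "nat \<Rightarrow> ('o, 'm, 'v) cmod" and d \<epsilon> +
  fixes j :: "'v \<Rightarrow> ('m, 'b) res_carrier"
  assumes inj_j: "inj j"
    and lifts_chosen: "cat_module C (N :: ('o, 'm, ('m, 'b) res_carrier) cmod)
        \<Longrightarrow> lifts_from C (P n) N"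
    and lifts_self: "lifts_from C (P n) (P m)"
begin

lemma res_mod_projective_resolution: "\<exists>\<epsilon>'. projective_resolution C M (res_mod C M) (res_diff C M)
    \<epsilon>'"
proof -
  have "\<exists>Pd. case Pd of (P :: nat \<Rightarrow> ('o, 'm, ('m, 'b) res_carrier) cmod, d) \<Rightarrow> \<exists>\<epsilon>.
      projective_resolution C M P d \<epsilon>"
    using projective_resolution_transport[OF resolution_axioms inj_j lifts_chosen] by auto
  then have "case chosen_resolution C M of (P, d) \<Rightarrow> \<exists>\<epsilon>. projective_resolution C M P d \<epsilon>"
    unfolding chosen_resolution_def by (rule someI_ex)
  then show ?thesis
    by (auto simp: res_mod_def res_diff_def split: prod.splits)
qed

lemma res_mod_resolution: "\<exists>\<epsilon>'. resolution C M (res_mod C M) (res_diff C M) \<epsilon>'"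
  using res_mod_projective_resolution projective_resolution_resolution[OF _ M_module] by blast

lemma res_mod_module: "cat_module C (res_mod C M n)"
  using res_mod_resolution resolution.P_module by blast

lemma cochains_postcomp:
  assumes "cat_module C A" "cat_module C A'" "\<alpha> \<in> nat_trans C A A'"
  shows "cochain_map (cochains C M A) (coboundary C M) (cochains C M A') (coboundary C M)
    (\<lambda>n. nt_comp C (res_mod C M n) \<alpha>)"
proof -
  obtain \<epsilon>' where "resolution C M (res_mod C M) (res_diff C M) \<epsilon>'"
    using res_mod_resolution by blast
  from resolution.postcomp_cochain_map[OF this assms] show ?thesis
    unfolding cochains_eq coboundary_eq .
qed

lemma resolution_pairs:
  obtains \<epsilon>' where "resolution_pair C M P d \<epsilon> (res_mod C M) (res_diff C M) \<epsilon>'"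
    "resolution_pair C M (res_mod C M) (res_diff C M) \<epsilon>' P d \<epsilon>"
    "resolution_pair C M P d \<epsilon> P d \<epsilon>"
    "resolution_pair C M (res_mod C M) (res_diff C M) \<epsilon>' (res_mod C M) (res_diff C M) \<epsilon>'"
proof -
  obtain \<epsilon>' where Q: "projective_resolution C M (res_mod C M) (res_diff C M) \<epsilon>'"
    using res_mod_projective_resolution by blast
  interpret Q: resolution C M "res_mod C M" "res_diff C M" \<epsilon>'
    by (rule projective_resolution_resolution[OF Q M_module])
  have proj: "projective_mod C (res_mod C M n)" for n using Q
      by (simp add: projective_resolution_def)
  show thesis
  proof (rule that)
    show "resolution_pair C M P d \<epsilon> (res_mod C M) (res_diff C M) \<epsilon>'"
      by (intro resolution_pair.intro resolution_pair_axioms.intro resolution_axioms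
          Q.resolution_axioms
          lifts_chosen Q.P_module)
    show "resolution_pair C M (res_mod C M) (res_diff C M) \<epsilon>' P d \<epsilon>"
      by (intro resolution_pair.intro resolution_pair_axioms.intro resolution_axioms
          Q.resolution_axioms
          projective_lifts_from[OF proj P_module inj_j])
    show "resolution_pair C M P d \<epsilon> P d \<epsilon>"
      by (intro resolution_pair.intro resolution_pair_axioms.intro resolution_axioms lifts_self)
    show "resolution_pair C M (res_mod C M) (res_diff C M) \<epsilon>' (res_mod C M) (res_diff C M) \<epsilon>'"
      by (intro resolution_pair.intro resolution_pair_axioms.intro Q.resolution_axioms
          projective_lifts_from[OF proj Q.P_module inj_on_id])
  qed
qed

lemma cochains_to_resolution:
  "\<exists>p. (\<forall>n. p n \<in> nat_trans C (P n) (res_mod C M n)) \<and>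
    (\<forall>A :: ('o, 'm, 'a) cmod. cat_module C A \<longrightarrow> quasi_isomorphism (cochains C M A) (coboundary C M)
        (\<lambda>n. Hom_group C (P n) A) (\<lambda>n f. nt_comp C (P (Suc n)) f (d n))
            (\<lambda>n f. nt_comp C (P n) f (p n)))"
  unfolding cochains_eq coboundary_eq
  by (rule resolution_pairs) (rule resolutions_quasi_isomorphic)

lemma resolution_to_cochains:
  "\<exists>q. (\<forall>n. q n \<in> nat_trans C (res_mod C M n) (P n)) \<and>
    (\<forall>A :: ('o, 'm, 'a) cmod. cat_module C A \<longrightarrow> quasi_isomorphism
        (\<lambda>n. Hom_group C (P n) A) (\<lambda>n f. nt_comp C (P (Suc n)) f (d n)) (cochains C M A)
            (coboundary C M)
        (\<lambda>n f. nt_comp C (res_mod C M n) f (q n)))"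
  unfolding cochains_eq coboundary_eq
  by (rule resolution_pairs) (rule resolutions_quasi_isomorphic)

end


section \<open>Composition through corestriction\<close>

context ordered_groupoid
begin

text \<open>Composition in \<open>Lcat G\<close> and the action of its arrows on \<open>ZG G\<close> are both given by this partial
  operation, which is meaningful if \<open>Dom G y \<preceq> Cod G x\<close>.\<close>

definition rcomp :: "'g \<Rightarrow> 'g \<Rightarrow> 'g" where
  "rcomp x y = corestr G x (Dom G y) \<cdot> y"

lemma Ob_Arr: "e \<in> Ob G \<Longrightarrow> e \<in> Arr G"
  using Idn_in[of e] by simp

lemma Dom_identity [simp]: "e \<in> Ob G \<Longrightarrow> Dom G e = e"
  and Cod_identity [simp]: "e \<in> Ob G \<Longrightarrow> Cod G e = e"
  using Dom_Idn[of e] Cod_Idn[of e] by simp_all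

lemma id_left [simp]: "x \<in> Arr G \<Longrightarrow> Dom G x \<cdot> x = x"
  and id_right [simp]: "x \<in> Arr G \<Longrightarrow> x \<cdot> Cod G x = x"
  using Idn_left[of x] Idn_right[of x] by simp_all

lemma leq_Arr: "x \<preceq> y \<Longrightarrow> x \<in> Arr G \<and> y \<in> Arr G"
  using order by (auto simp: partial_order_on_def preorder_on_def)

lemma leq_refl: "x \<in> Arr G \<Longrightarrow> x \<preceq> x"
  using order by (auto simp: partial_order_on_def preorder_on_def refl_on_def)

lemma leq_trans: "x \<preceq> y \<Longrightarrow> y \<preceq> z \<Longrightarrow> x \<preceq> z"
  using order unfolding partial_order_on_def preorder_on_def by (blast dest: transD)

lemma ginv_props:
  assumes x: "x \<in> Arr G"
  shows "ginv G x \<in> Arr G" "Dom G (ginv G x) = Cod G x" "Cod G (ginv G x) = Dom G x"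
    "x \<cdot> ginv G x = Dom G x" "ginv G x \<cdot> x = Cod G x"
proof -
  have "\<exists>!y. y \<in> Arr G \<and> Dom G y = Cod G x \<and> Cod G y = Dom G x \<and>
      x \<cdot> y = Idn G (Dom G x) \<and> y \<cdot> x = Idn G (Cod G x)" (is "\<exists>!y. ?inv y")
  proof -
    obtain y where y: "?inv y" using invertible[OF x] by blast
    moreover have "z = y" if z: "?inv z" for z
    proof -
      have "z = z \<cdot> (x \<cdot> y)" using y z x by (metis Idn_right)
      also have "\<dots> = (z \<cdot> x) \<cdot> y" using y z x Cmp_assoc[of z x y] by simp
      also have "\<dots> = y" using y z x by (metis Idn_left)
      finally show ?thesis .
    qed
    ultimately show ?thesis by blast
  qed
  then have "?inv (ginv G x)" unfolding ginv_def by (rule theI')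
  then show "ginv G x \<in> Arr G" "Dom G (ginv G x) = Cod G x" "Cod G (ginv G x) = Dom G x"
    "x \<cdot> ginv G x = Dom G x" "ginv G x \<cdot> x = Cod G x"
    using x by simp_all
qed

lemma leq_Dom: "x \<preceq> y \<Longrightarrow> Dom G x \<preceq> Dom G y"
  using OG2[OF _ OG1, of x y x y] leq_Arr[of x y] by (simp add: ginv_props)

lemma leq_Cod: "x \<preceq> y \<Longrightarrow> Cod G x \<preceq> Cod G y"
  using OG2[OF OG1, of x y x y] leq_Arr[of x y] by (simp add: ginv_props)

lemma corestr_props:
  assumes "x \<in> Arr G" "e \<in> Ob G" "e \<preceq> Cod G x"
  shows "corestr G x e \<preceq> x" "Cod G (corestr G x e) = e" "corestr G x e \<in> Arr G"
  using theI'[OF OG4[OF assms]] leq_Arr unfolding corestr_def by blast+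

lemma corestr_unique:
  assumes y: "y \<preceq> x"
  shows "corestr G x (Cod G y) = y"
proof -
  have "y \<in> Arr G" "x \<in> Arr G" using leq_Arr[OF y] by simp_all
  then have "\<exists>!z. z \<preceq> x \<and> Cod G z = Cod G y" using OG4 leq_Cod[OF y] by simp
  then show ?thesis unfolding corestr_def by (rule the1_equality) (simp add: y)
qed

lemma corestr_Ob: "e \<in> Ob G \<Longrightarrow> f \<in> Ob G \<Longrightarrow> f \<preceq> e \<Longrightarrow> corestr G e f = f"
  using corestr_unique[of f e] by simp

lemma rcomp_props:
  assumes x: "x \<in> Arr G" and y: "y \<in> Arr G" and le: "Dom G y \<preceq> Cod G x"
  shows "rcomp x y \<in> Arr G" "Cod G (rcomp x y) = Cod G y" "Dom G (rcomp x y) \<preceq> Dom G x"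
  using corestr_props[OF x _ le] leq_Dom[OF corestr_props(1)[OF x _ le]] y
  by (simp_all add: rcomp_def)

lemma rcomp_Ob_left: "e \<in> Ob G \<Longrightarrow> y \<in> Arr G \<Longrightarrow> Dom G y \<preceq> e \<Longrightarrow> rcomp e y = y"
  by (simp add: rcomp_def corestr_Ob)

lemma rcomp_Cod: "x \<in> Arr G \<Longrightarrow> rcomp x (Cod G x) = x"
  using corestr_unique[of x x] by (simp add: rcomp_def leq_refl)

text \<open>Both sides equal the product \<open>x' \<cdot> y' \<cdot> z\<close>, where \<open>y'\<close> is the corestriction of \<open>y\<close> to the
  start of \<open>z\<close> and \<open>x'\<close> that of \<open>x\<close> to the start of \<open>y'\<close>; uniqueness of corestrictions
  identifies the factors.\<close>

lemma rcomp_assoc: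
  assumes x: "x \<in> Arr G" and y: "y \<in> Arr G" and z: "z \<in> Arr G"
    and xy: "Dom G y \<preceq> Cod G x" and yz: "Dom G z \<preceq> Cod G y"
  shows "rcomp (rcomp x y) z = rcomp x (rcomp y z)"
proof -
  define y' where "y' = corestr G y (Dom G z)"
  have y': "y' \<preceq> y" "Cod G y' = Dom G z" "y' \<in> Arr G"
    unfolding y'_def using corestr_props[OF y _ yz] z by simp_all
  define x1 where "x1 = corestr G x (Dom G y)"
  have x1: "x1 \<preceq> x" "Cod G x1 = Dom G y" "x1 \<in> Arr G"
    unfolding x1_def using corestr_props[OF x _ xy] y by simp_all
  define x' where "x' = corestr G x1 (Dom G y')"
  have x': "x' \<preceq> x1" "Cod G x' = Dom G y'" "x' \<in> Arr G"
    unfolding x'_def using corestr_props[OF x1(3), of "Dom G y'"] x1(2) leq_Dom[OF y'(1)] y'(3)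
        by simp_all
  have "corestr G x (Dom G y') = x'"
    using corestr_unique[OF leq_trans[OF x'(1) x1(1)]] x'(2) by simp
  moreover have "corestr G (x1 \<cdot> y) (Dom G z) = x' \<cdot> y'"
    using corestr_unique[OF OG2[OF x'(1) y'(1) x'(2) x1(2)]] x' y' by simp
  moreover have "Dom G (y' \<cdot> z) = Dom G y'" using y' z by simp
  ultimately show ?thesis
    using x' y' z by (simp add: rcomp_def flip: x1_def y'_def) (simp add: Cmp_assoc x1 y)
qed

end


text \<open>Common ground of \<open>Lcat G\<close>, where \<open>H\<close> consists of all arrows, and \<open>Ecat G\<close>, where it consists
  of the identities. Codomain and composition are prescribed for labels in \<open>H\<close> and composable
  pairs, where the two records agree.\<close>

locale arrow_category = ordered_groupoid G for G :: "'g ogpd" (structure) +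
  fixes C :: "('g, 'g \<times> 'g) cat" and H :: "'g set"
  assumes Ob_C: "Ob C = Ob G"
    and Arr_C: "Arr C = {(e, g). e \<in> Ob G \<and> g \<in> H \<and> Dom G g \<preceq> e}"
    and Dom_C: "Dom C (e, g) = e"
    and Cod_C: "g \<in> H \<Longrightarrow> Cod C (e, g) = Cod G g"
    and Idn_C: "Idn C e = (e, e)"
    and Cmp_C: "g \<in> H \<Longrightarrow> h \<in> H \<Longrightarrow> f = Cod G g \<Longrightarrow> Dom G h \<preceq> f
      \<Longrightarrow> Cmp C (e, g) (f, h) = (e, rcomp g h)"
    and H_Arr: "H \<subseteq> Arr G"
    and Ob_H: "Ob G \<subseteq> H"
    and H_rcomp: "g \<in> H \<Longrightarrow> h \<in> H \<Longrightarrow> Dom G h \<preceq> Cod G g \<Longrightarrow> rcomp g h \<in> H"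
begin

lemma C_category: "small_category C"
proof
  fix f g assume "f \<in> Arr C" "g \<in> Arr C" "Cod C f = Dom C g"
  then obtain e x y where *: "f = (e, x)" "g = (Cod G x, y)" "e \<in> Ob G"
    "x \<in> H" "y \<in> H" "Dom G x \<preceq> e" "Dom G y \<preceq> Cod G x"
    by (auto simp: Arr_C Dom_C Cod_C)
  then have "x \<in> Arr G" "y \<in> Arr G" using H_Arr by auto
  with * show "Cmp C f g \<in> Arr C"
    using leq_trans[OF rcomp_props(3)[of x y] *(6)] by (simp add: Arr_C Cmp_C H_rcomp)
next
  fix f g h assume "f \<in> Arr C" "g \<in> Arr C" "h \<in> Arr C" "Cod C f = Dom C g" "Cod C g = Dom C h"
  then obtain e x y z where *: "f = (e, x)" "g = (Cod G x, y)" "h = (Cod G y, z)"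
    "x \<in> H" "y \<in> H" "z \<in> H" "Dom G y \<preceq> Cod G x" "Dom G z \<preceq> Cod G y"
    by (auto simp: Arr_C Dom_C Cod_C)
  then have "x \<in> Arr G" "y \<in> Arr G" "z \<in> Arr G" using H_Arr by auto
  with * show "Cmp C (Cmp C f g) h = Cmp C f (Cmp C g h)"
    using leq_trans[OF rcomp_props(3)[of y z] *(7)]
    by (simp add: Cmp_C H_rcomp rcomp_props rcomp_assoc)
qed (use H_Arr Ob_H in \<open>auto simp: Ob_C Arr_C Dom_C Cod_C Idn_C Cmp_C H_rcomp rcomp_props
      subset_iff leq_refl Ob_Arr rcomp_Ob_left rcomp_Cod\<close>)

end

lemma (in ordered_groupoid) Lcat_arrow_category: "arrow_category G (Lcat G) (Arr G)"
  by unfold_locales (auto simp: Lcat_def rcomp_def[symmetric] Ob_Arr rcomp_props)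

lemma (in ordered_groupoid) Ecat_arrow_category: "arrow_category G (Ecat G) (Ob G)"
  by unfold_locales (auto simp: Ecat_def Ob_Arr rcomp_Ob_left)


section \<open>Signed boundaries of lists\<close>

definition cone :: "'a \<Rightarrow> ('a list \<times> 'b \<Rightarrow>\<^sub>0 int) \<Rightarrow> ('a list \<times> 'b \<Rightarrow>\<^sub>0 int)" where
  "cone x = frag_extend (\<lambda>(\<sigma>, g). frag_of (x # \<sigma>, g))"

text \<open>The alternating sum of the faces of a simplex. A list \<open>x # \<sigma>\<close> is the cone over \<open>\<sigma>\<close> with
  apex \<open>x\<close>, so its faces are the base and the cones over the faces of the base; this form
  avoids signs and indices. The second component is a label that the boundary leaves alone.\<close>

fun list_boundary :: "'a list \<Rightarrow> 'b \<Rightarrow> ('a list \<times> 'b \<Rightarrow>\<^sub>0 int)" where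
  "list_boundary [] g = 0"
| "list_boundary (x # \<sigma>) g = frag_of (\<sigma>, g) - cone x (list_boundary \<sigma> g)"

definition boundary :: "('a list \<times> 'b \<Rightarrow>\<^sub>0 int) \<Rightarrow> ('a list \<times> 'b \<Rightarrow>\<^sub>0 int)" where
  "boundary = frag_extend (\<lambda>(\<sigma>, g). list_boundary \<sigma> g)"

definition relabel :: "('b \<Rightarrow> 'c) \<Rightarrow> ('a list \<times> 'b \<Rightarrow>\<^sub>0 int) \<Rightarrow> ('a list \<times> 'c \<Rightarrow>\<^sub>0 int)" where
  "relabel t = frag_extend (\<lambda>(\<sigma>, g). frag_of (\<sigma>, t g))"

definition contraction :: "('b \<Rightarrow> 'a) \<Rightarrow> ('a list \<times> 'b \<Rightarrow>\<^sub>0 int) \<Rightarrow> ('a list \<times> 'b \<Rightarrow>\<^sub>0 int)" where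
  "contraction s = frag_extend (\<lambda>(\<sigma>, g). frag_of (s g # \<sigma>, g))"

lemma cone_simps [simp]:
  "cone x 0 = 0" "cone x (frag_of (\<sigma>, g)) = frag_of (x # \<sigma>, g)"
      "cone x (a - b) = cone x a - cone x b"
  by (simp_all add: cone_def frag_extend_diff)

lemma boundary_simps [simp]:
  "boundary 0 = 0" "boundary (frag_of (\<sigma>, g)) = list_boundary \<sigma> g"
      "boundary (a - b) = boundary a - boundary b"
  "boundary (a + b) = boundary a + boundary b"
  by (simp_all add: boundary_def frag_extend_diff frag_extend_add)

lemma relabel_simps [simp]:
  "relabel t 0 = 0" "relabel t (frag_of (\<sigma>, g)) = frag_of (\<sigma>, t g)"
      "relabel t (a - b) = relabel t a - relabel t b"
  by (simp_all add: relabel_def frag_extend_diff)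

lemma contraction_simps [simp]:
  "contraction s 0 = 0" "contraction s (frag_of (\<sigma>, g)) = frag_of (s g # \<sigma>, g)"
  "contraction s (a - b) = contraction s a - contraction s b"
  by (simp_all add: contraction_def frag_extend_diff)

lemma frag_UNIV_induct [case_names zero one diff]:
  assumes "P 0" "\<And>x. P (frag_of x)" "\<And>a b. P a \<Longrightarrow> P b \<Longrightarrow> P (a - b)"
  shows "P c"
  by (rule frag_induction[OF subset_UNIV]) (use assms in auto)

lemma boundary_cone: "boundary (cone x c) = c - cone x (boundary c)"
  by (induction c rule: frag_UNIV_induct) auto

lemma boundary_list_boundary: "boundary (list_boundary \<sigma> g) = 0"
  by (induction \<sigma>) (simp_all add: boundary_cone)

lemma boundary_boundary: "boundary (boundary c) = 0"
  by (induction c rule: frag_UNIV_induct) (auto simp: boundary_list_boundary)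

lemma relabel_cone: "relabel t (cone x c) = cone x (relabel t c)"
  by (induction c rule: frag_UNIV_induct) auto

lemma relabel_list_boundary: "relabel t (list_boundary \<sigma> g) = list_boundary \<sigma> (t g)"
  by (induction \<sigma>) (simp_all add: relabel_cone)

lemma relabel_boundary: "relabel t (boundary c) = boundary (relabel t c)"
  by (induction c rule: frag_UNIV_induct) (auto simp: relabel_list_boundary)

lemma keys_cone: "Poly_Mapping.keys (cone x c) \<subseteq> (\<lambda>(\<sigma>, g). (x # \<sigma>, g)) ` Poly_Mapping.keys c"
  using keys_frag_extend[of "\<lambda>(\<sigma>, g). frag_of (x # \<sigma>, g)" c] unfolding cone_def by fastforce

lemma keys_list_boundary:
  "(\<tau>, h) \<in> Poly_Mapping.keys (list_boundary \<sigma> g) \<Longrightarrow>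
    h = g \<and> Suc (length \<tau>) = length \<sigma> \<and> set \<tau> \<subseteq> set \<sigma> \<and> (sorted_wrt R \<sigma> \<longrightarrow> sorted_wrt R \<tau>)"
proof (induction \<sigma> arbitrary: \<tau> h)
  case (Cons x \<sigma>)
  have "(\<tau>, h) \<in> {(\<sigma>, g)} \<union> Poly_Mapping.keys (cone x (list_boundary \<sigma> g))"
    using Cons.prems keys_diff[of "frag_of (\<sigma>, g)" "cone x (list_boundary \<sigma> g)"] by auto
  then consider "(\<tau>, h) = (\<sigma>, g)" | \<tau>'
      where "\<tau> = x # \<tau>'" "(\<tau>', h) \<in> Poly_Mapping.keys (list_boundary \<sigma> g)"
    using keys_cone[of x "list_boundary \<sigma> g"] by auto
  then show ?case
  proof cases
    case 2
    then show ?thesis using Cons.IH[of \<tau>' h] by auto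
  qed auto
qed simp

lemma contraction_list_boundary: "contraction s (list_boundary \<sigma> g)
    = cone (s g) (list_boundary \<sigma> g)"
  unfolding contraction_def cone_def
  by (rule frag_extend_eq) (auto dest: keys_list_boundary[where R = "\<lambda>_ _. True"])

text \<open>All faces of \<open>(\<sigma>, g)\<close> carry the label \<open>g\<close>, so on them the contraction agrees with the cone
  of apex \<open>s g\<close>, for which the homotopy identity is \<open>boundary_cone\<close>.\<close>

lemma boundary_contraction: "boundary (contraction s c) = c - contraction s (boundary c)"
  by (induction c rule: frag_UNIV_induct) (auto simp: contraction_list_boundary)

lemma keys_frag_extend_subset:
  assumes "Poly_Mapping.keys c \<subseteq> S" "\<And>x. x \<in> S \<Longrightarrow> Poly_Mapping.keys (f x) \<subseteq> T"
  shows "Poly_Mapping.keys (frag_extend f c) \<subseteq> T"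
  using keys_frag_extend[of f c] assms by fast


section \<open>Modules freely spanned by a functor to sets\<close>

text \<open>The linearisation of a functor \<open>S\<close> to sets with action \<open>t\<close>.\<close>

definition span_mod :: "('o \<Rightarrow> 's set) \<Rightarrow> ('m \<Rightarrow> 's \<Rightarrow> 's) \<Rightarrow> ('o, 'm, 's \<Rightarrow>\<^sub>0 int) cmod" where
  "span_mod S t = \<lparr>obm = (\<lambda>x. free_Abelian_group (S x)), arm
      = (\<lambda>f. frag_extend (\<lambda>s. frag_of (t f s)))\<rparr>"

lemma obm_span_mod [simp]: "obm (span_mod S t) x = free_Abelian_group (S x)"
  and arm_span_mod: "arm (span_mod S t) f = frag_extend (\<lambda>s. frag_of (t f s))"
  by (simp_all add: span_mod_def)

lemma span_mod_module:
  assumes C: "small_category C"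
    and closed: "\<And>f s. f \<in> Arr C \<Longrightarrow> s \<in> S (Dom C f) \<Longrightarrow> t f s \<in> S (Cod C f)"
    and ident: "\<And>x s. x \<in> Ob C \<Longrightarrow> s \<in> S x \<Longrightarrow> t (Idn C x) s = s"
    and comp: "\<And>f g s. f \<in> Arr C \<Longrightarrow> g \<in> Arr C \<Longrightarrow> Cod C f = Dom C g \<Longrightarrow> s \<in> S (Dom C f)
      \<Longrightarrow> t (Cmp C f g) s = t g (t f s)"
  shows "cat_module C (span_mod S t)"
proof (intro cat_module.intro cat_module_axioms.intro C)
  show "comm_group (obm (span_mod S t) x)" for x
    by (simp add: abelian_free_Abelian_group)
next
  fix f assume f: "f \<in> Arr C"
  show "arm (span_mod S t) f \<in> hom (obm (span_mod S t) (Dom C f)) (obm (span_mod S t) (Cod C f))"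
  proof (rule homI)
    fix c assume "c \<in> carrier (obm (span_mod S t) (Dom C f))"
    then have "Poly_Mapping.keys c \<subseteq> S (Dom C f)" by simp
    then have "Poly_Mapping.keys (arm (span_mod S t) f c) \<subseteq> S (Cod C f)"
      unfolding arm_span_mod by (rule keys_frag_extend_subset) (simp add: closed f)
    then show "arm (span_mod S t) f c \<in> carrier (obm (span_mod S t) (Cod C f))" by simp
  qed (simp add: arm_span_mod frag_extend_add)
next
  fix x a assume x: "x \<in> Ob C" and a: "a \<in> carrier (obm (span_mod S t) x)"
  from a have "Poly_Mapping.keys a \<subseteq> S x" by simp
  then show "arm (span_mod S t) (Idn C x) a = a"
    by (induction a rule: frag_induction) (simp_all add: arm_span_mod frag_extend_diff ident x)
next
  fix f g a assume fg: "f \<in> Arr C" "g \<in> Arr C" "Cod C f = Dom C g"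
      and a: "a \<in> carrier (obm (span_mod S t) (Dom C f))"
  from a have "Poly_Mapping.keys a \<subseteq> S (Dom C f)" by simp
  then show "arm (span_mod S t) (Cmp C f g) a = arm (span_mod S t) g (arm (span_mod S t) f a)"
    by (induction a rule: frag_induction) (simp_all add: arm_span_mod frag_extend_diff comp fg)
qed

lemma free_hom_eqI:
  assumes h: "h \<in> hom (free_Abelian_group S) K" and k: "k \<in> hom (free_Abelian_group S) K"
      and K: "group K"
    and eq: "\<And>s. s \<in> S \<Longrightarrow> h (frag_of s) = k (frag_of s)" and c: "Poly_Mapping.keys c \<subseteq> S"
  shows "h c = k c"
proof -
  interpret h: group_hom "free_Abelian_group S" K h using h K
      by (simp add: group_hom_def group_hom_axioms_def)
  interpret k: group_hom "free_Abelian_group S" K k using k K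
      by (simp add: group_hom_def group_hom_axioms_def)
  have diff: "l (a - b) = l a \<otimes>\<^bsub>K\<^esub> inv\<^bsub>K\<^esub> l b"
    if "group_hom (free_Abelian_group S) K l" "Poly_Mapping.keys a \<subseteq> S" "Poly_Mapping.keys b \<subseteq> S"
        for l a b
    using group_hom.hom_mult[OF that(1), of a "- b"] group_hom.hom_inv[OF that(1), of b] that
        by simp
  show ?thesis
    using c
  proof (rule free_Abelian_group_induct)
    show "h 0 = k 0" using h.hom_one k.hom_one by simp
  next
    fix a b assume "Poly_Mapping.keys a \<subseteq> S" "Poly_Mapping.keys b \<subseteq> S" "h a = k a" "h b = k b"
    then show "h (a - b) = k (a - b)"
      using diff[OF h.group_hom_axioms] diff[OF k.group_hom_axioms] by simp
  qed (rule eq)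
qed


section \<open>The bar resolution\<close>

context arrow_category
begin

definition chains :: "nat \<Rightarrow> 'g list set" where
  "chains n = {\<sigma>. length \<sigma> = n \<and> set \<sigma> \<subseteq> Ob G \<and> sorted_wrt (\<lambda>x y. x \<preceq> y) \<sigma>}"

text \<open>A chain lists objects in increasing order, and \<open>(\<sigma>, g)\<close> encodes a chain together with the arrow
  \<open>(hd \<sigma>, g)\<close> of \<open>C\<close> that leads from its least object to \<open>y\<close>. For the empty chain the order
  condition is void, so that \<open>bar 0\<close> is spanned by \<open>H\<close>; the resolution proper starts with
  \<open>bar 1\<close>.\<close>

definition simplices :: "nat \<Rightarrow> 'g \<Rightarrow> ('g list \<times> 'g) set" where
  "simplices n y = {(\<sigma>, g). \<sigma> \<in> chains n \<and> g \<in> H \<and> Cod G g = y \<and> (\<forall>x \<in> set \<sigma>. Dom G g \<preceq> x)}"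

definition bar :: "nat \<Rightarrow> ('g, 'g \<times> 'g, 'g list \<times> 'g \<Rightarrow>\<^sub>0 int) cmod" where
  "bar n = span_mod (simplices n) (\<lambda>f (\<sigma>, h). (\<sigma>, rcomp h (snd f)))"

definition bar_diff :: "nat \<Rightarrow> 'g \<Rightarrow> ('g list \<times> 'g \<Rightarrow>\<^sub>0 int) \<Rightarrow> ('g list \<times> 'g \<Rightarrow>\<^sub>0 int)" where
  "bar_diff n = nt_of C (bar (Suc n)) (\<lambda>_. boundary)"

lemma arm_bar: "arm (bar n) f = relabel (\<lambda>h. rcomp h (snd f))"
  by (simp add: bar_def arm_span_mod relabel_def case_prod_unfold)

lemma obm_bar [simp]: "obm (bar n) x = free_Abelian_group (simplices n x)"
  by (simp add: bar_def)

lemma bar_module: "cat_module C (bar n)"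
  unfolding bar_def
proof (rule span_mod_module[OF C_category])
  fix f s assume "f \<in> Arr C" and s: "s \<in> simplices n (Dom C f)"
  then obtain e g where f: "f = (e, g)" "g \<in> H" "Dom G g \<preceq> e" by (auto simp: Arr_C)
  with s obtain \<sigma> h where h: "s = (\<sigma>, h)" "\<sigma> \<in> chains n" "h \<in> H" "Cod G h = e"
      "\<forall>x \<in> set \<sigma>. Dom G h \<preceq> x"
    by (auto simp: simplices_def Dom_C)
  have "g \<in> Arr G" "h \<in> Arr G" using f h H_Arr by auto
  then have "\<forall>x \<in> set \<sigma>. Dom G (rcomp h g) \<preceq> x" "Cod G (rcomp h g) = Cod G g"
    using f h leq_trans[OF rcomp_props(3)] rcomp_props(2) by blast+
  then show "(case s of (\<sigma>, h) \<Rightarrow> (\<sigma>, rcomp h (snd f))) \<in> simplices n (Cod C f)"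
    using f h by (simp add: simplices_def Cod_C H_rcomp)
next
  fix x s assume "x \<in> Ob C" "s \<in> simplices n x"
  then show "(case s of (\<sigma>, h) \<Rightarrow> (\<sigma>, rcomp h (snd (Idn C x)))) = s"
    using H_Arr rcomp_Cod by (auto simp: simplices_def Idn_C)
next
  fix f g s assume "f \<in> Arr C" "g \<in> Arr C" "Cod C f = Dom C g" "s \<in> simplices n (Dom C f)"
  then show "(case s of (\<sigma>, h) \<Rightarrow> (\<sigma>, rcomp h (snd (Cmp C f g))))
      = (case case s of (\<sigma>, h) \<Rightarrow> (\<sigma>, rcomp h (snd f)) of (\<sigma>, h) \<Rightarrow> (\<sigma>, rcomp h (snd g)))"
    using H_Arr by (auto simp: Arr_C simplices_def Dom_C Cod_C Cmp_C rcomp_assoc subset_iff)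
qed

lemma boundary_closed:
  assumes "Poly_Mapping.keys c \<subseteq> simplices (Suc n) x"
  shows "Poly_Mapping.keys (boundary c) \<subseteq> simplices n x"
  unfolding boundary_def
proof (rule keys_frag_extend_subset[OF assms])
  fix s assume "s \<in> simplices (Suc n) x"
  then show "Poly_Mapping.keys (case s of (\<sigma>, g) \<Rightarrow> list_boundary \<sigma> g) \<subseteq> simplices n x"
    by (auto simp: simplices_def chains_def dest!: keys_list_boundary[where R = "\<lambda>x y. x \<preceq> y"])
qed

lemma bar_diff_in: "bar_diff n \<in> nat_trans C (bar (Suc n)) (bar n)"
  unfolding bar_diff_def
  by (rule nt_of_in[OF bar_module])
      (auto simp: arm_bar relabel_boundary dest: subsetD[OF boundary_closed])

text \<open>The start of \<open>g\<close> lies below the whole chain, hence extends it. The contraction does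
  not commute with the arrows of \<open>C\<close>, which may change \<open>Dom g\<close>.\<close>

lemma contraction_closed:
  assumes "Poly_Mapping.keys c \<subseteq> simplices n x"
  shows "Poly_Mapping.keys (contraction (Dom G) c) \<subseteq> simplices (Suc n) x"
  unfolding contraction_def
  by (rule keys_frag_extend_subset[OF assms])
    (use H_Arr in \<open>auto simp: simplices_def chains_def leq_refl Ob_Arr subset_iff\<close>)

lemma bar_exact:
  "boundary ` carrier (obm (bar (Suc n)) x) = {c \<in> carrier (obm (bar n) x). boundary c = 0}"
proof
  show "boundary ` carrier (obm (bar (Suc n)) x) \<subseteq> {c \<in> carrier (obm (bar n) x). boundary c = 0}"
    by (auto simp: boundary_boundary dest: subsetD[OF boundary_closed])
  show "{c \<in> carrier (obm (bar n) x). boundary c = 0} \<subseteq> boundary ` carrier (obm (bar (Suc n)) x)"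
  proof
    fix c assume "c \<in> {c \<in> carrier (obm (bar n) x). boundary c = 0}"
    then have "Poly_Mapping.keys (contraction (Dom G) c) \<subseteq> simplices (Suc n) x"
        "c = boundary (contraction (Dom G) c)"
      by (simp_all add: contraction_closed boundary_contraction)
    then show "c \<in> boundary ` carrier (obm (bar (Suc n)) x)" by auto
  qed
qed

lemma boundary_bar_0:
  assumes "c \<in> carrier (obm (bar 0) x)"
  shows "boundary c = 0"
proof -
  from assms have "Poly_Mapping.keys c \<subseteq> simplices 0 x" by simp
  then show ?thesis
    by (induction c rule: frag_induction) (auto simp: simplices_def chains_def)
qed

text \<open>The augmentation \<open>\<epsilon>\<close> is the last boundary map \<open>bar 1 \<rightarrow> bar 0\<close> followed by an
  identification \<open>\<theta>\<close> of \<open>bar 0\<close> with the module to be resolved.\<close>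

lemma bar_resolution:
  assumes M: "cat_module C M" and \<theta>: "\<theta> \<in> nat_trans C (bar 0) M"
    and bij: "\<And>x. x \<in> Ob C \<Longrightarrow> bij_betw (\<theta> x) (carrier (obm (bar 0) x)) (carrier (obm M x))"
  shows "resolution C M (\<lambda>n. bar (Suc n)) (\<lambda>n. bar_diff (Suc n)) (nt_comp C (bar 1) \<theta> (bar_diff 0))"
proof (intro resolution.intro M bar_module bar_diff_in)
  show "nt_comp C (bar 1) \<theta> (bar_diff 0) \<in> nat_trans C (bar (Suc 0)) M"
    using nt_comp_in[OF bar_module bar_diff_in \<theta>] by simp
  fix x assume x: "x \<in> Ob C"
  have d: "bar_diff n x c = boundary c" if "c \<in> carrier (obm (bar (Suc n)) x)" for n c
    using that x by (simp add: bar_diff_def)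
  have \<epsilon>: "nt_comp C (bar 1) \<theta> (bar_diff 0) x c = \<theta> x (boundary c)"
      if "c \<in> carrier (obm (bar (Suc 0)) x)" for c
    using that x d[of c 0] by simp
  have d_image: "bar_diff n x ` carrier (obm (bar (Suc n)) x)
      = {c \<in> carrier (obm (bar n) x). boundary c = 0}" for n
  proof -
    have "bar_diff n x ` carrier (obm (bar (Suc n)) x) = boundary ` carrier (obm (bar (Suc n)) x)"
      by (rule image_cong[OF refl d])
    then show ?thesis by (simp only: bar_exact)
  qed
  have "nt_comp C (bar 1) \<theta> (bar_diff 0) x ` carrier (obm (bar (Suc 0)) x)
      = \<theta> x ` boundary ` carrier (obm (bar (Suc 0)) x)"
    unfolding image_image by (rule image_cong[OF refl \<epsilon>])
  also have "\<dots> = \<theta> x ` carrier (obm (bar 0) x)"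
    unfolding bar_exact using boundary_bar_0 by (intro arg_cong[of _ _ "image (\<theta> x)"]) blast
  finally show "nt_comp C (bar 1) \<theta> (bar_diff 0) x ` carrier (obm (bar (Suc 0)) x)
      = carrier (obm M x)"
    using bij[OF x] by (simp add: bij_betw_def)
  have "\<theta> x b = \<one>\<^bsub>obm M x\<^esub> \<longleftrightarrow> b = 0" if "b \<in> carrier (obm (bar 0) x)" for b
  proof -
    have one: "\<theta> x 0 = \<one>\<^bsub>obm M x\<^esub>" using nat_trans_one[OF bar_module M \<theta> x] by simp
    have "0 \<in> carrier (obm (bar 0) x)" by simp
    then show ?thesis using one that bij[OF x] unfolding bij_betw_def inj_on_def by metis
  qed
  then have "kernel (obm (bar (Suc 0)) x) (obm M x) (nt_comp C (bar 1) \<theta> (bar_diff 0) x)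
      = {c \<in> carrier (obm (bar 1) x). boundary c = 0}"
    using \<epsilon> boundary_closed[of _ 0 x] by (auto simp: kernel_def simp del: nt_comp_apply)
  then show "bar_diff (Suc 0) x ` carrier (obm (bar (Suc 1)) x)
      = kernel (obm (bar (Suc 0)) x) (obm M x) (nt_comp C (bar 1) \<theta> (bar_diff 0) x)"
    using d_image[of 1] by simp
  show "bar_diff (Suc (Suc n)) x ` carrier (obm (bar (Suc (Suc (Suc n)))) x)
      = kernel (obm (bar (Suc (Suc n))) x) (obm (bar (Suc n)) x) (bar_diff (Suc n) x)" for n
    using d_image[of "Suc (Suc n)"] d[of _ "Suc n"] by (auto simp: kernel_def)
qed

lemma chain_simplex:
  assumes "\<sigma> \<in> chains (Suc m)"
  shows "hd \<sigma> \<in> Ob G" "(\<sigma>, hd \<sigma>) \<in> simplices (Suc m) (hd \<sigma>)"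
  using assms Ob_H by (cases \<sigma>; auto simp: chains_def simplices_def leq_refl Ob_Arr subset_iff)+

text \<open>Each basis element \<open>(\<sigma>, g)\<close> comes from \<open>(\<sigma>, hd \<sigma>)\<close> by the arrow \<open>(hd \<sigma>, g)\<close>. In this
  sense the module is generated freely by its chains.\<close>

lemma simplex_arrow:
  assumes "(\<sigma>, g) \<in> simplices (Suc m) y"
  shows "\<sigma> \<in> chains (Suc m)" "g \<in> H" "Cod G g = y" "(hd \<sigma>, g) \<in> Arr C" "Dom C (hd \<sigma>, g) = hd \<sigma>"
      "Cod C (hd \<sigma>, g) = y"
    "arm (bar (Suc m)) (hd \<sigma>, g) (frag_of (\<sigma>, hd \<sigma>)) = frag_of (\<sigma>, g)"
proof -
  show *: "\<sigma> \<in> chains (Suc m)" "g \<in> H" "Cod G g = y" using assms by (auto simp: simplices_def)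
  then have e: "hd \<sigma> \<in> Ob G" using chain_simplex by blast
  have "hd \<sigma> \<in> set \<sigma>" using * by (cases \<sigma>) (auto simp: chains_def)
  then have le: "Dom G g \<preceq> hd \<sigma>" using assms by (auto simp: simplices_def)
  then show "(hd \<sigma>, g) \<in> Arr C" using * e by (simp add: Arr_C)
  show "Dom C (hd \<sigma>, g) = hd \<sigma>" "Cod C (hd \<sigma>, g) = y" using * by (simp_all add: Dom_C Cod_C)
  show "arm (bar (Suc m)) (hd \<sigma>, g) (frag_of (\<sigma>, hd \<sigma>)) = frag_of (\<sigma>, g)"
    using * e le H_Arr by (auto simp: arm_bar rcomp_Ob_left)
qed

lemma bar_nat_trans_eqI:
  assumes A: "cat_module C A" and \<eta>: "\<eta> \<in> nat_trans C (bar (Suc m)) A"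
      and \<theta>: "\<theta> \<in> nat_trans C (bar (Suc m)) A"
    and eq: "\<And>\<sigma>. \<sigma> \<in> chains (Suc m) \<Longrightarrow> \<eta> (hd \<sigma>) (frag_of (\<sigma>, hd \<sigma>)) = \<theta> (hd \<sigma>) (frag_of (\<sigma>, hd \<sigma>))"
  shows "\<eta> = \<theta>"
proof (rule nat_trans_eqI[OF \<eta> \<theta>])
  fix y c assume y: "y \<in> Ob C" and c: "c \<in> carrier (obm (bar (Suc m)) y)"
  show "\<eta> y c = \<theta> y c"
  proof (rule free_hom_eqI)
    show "\<eta> y \<in> hom (free_Abelian_group (simplices (Suc m) y)) (obm A y)"
      "\<theta> y \<in> hom (free_Abelian_group (simplices (Suc m) y)) (obm A y)"
      using nat_trans_hom[OF \<eta> y] nat_trans_hom[OF \<theta> y] by simp_all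
    show "group (obm A y)" by (rule cat_module_group[OF A y])
    fix s assume s: "s \<in> simplices (Suc m) y"
    obtain \<sigma> g where s_eq: "s = (\<sigma>, g)" by (cases s)
    note sg = simplex_arrow[OF s[unfolded s_eq]]
    have "\<zeta> y (frag_of s) = arm A (hd \<sigma>, g) (\<zeta> (hd \<sigma>) (frag_of (\<sigma>, hd \<sigma>)))"
      if \<zeta>: "\<zeta> \<in> nat_trans C (bar (Suc m)) A" for \<zeta>
      using nat_trans_natural[OF \<zeta> sg(4), of "frag_of (\<sigma>, hd \<sigma>)"] chain_simplex(2)[OF sg(1)] sg
      by (simp add: s_eq)
    from this[OF \<eta>] this[OF \<theta>] show "\<eta> y (frag_of s) = \<theta> y (frag_of s)"
      using eq[OF sg(1)] by simp
  next
    show "Poly_Mapping.keys c \<subseteq> simplices (Suc m) y" using c by simp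
  qed
qed

lemma bar_extension:
  assumes A: "cat_module C A" and a: "\<And>\<sigma>. \<sigma> \<in> chains (Suc m) \<Longrightarrow> a \<sigma> \<in> carrier (obm A (hd \<sigma>))"
  obtains \<eta> where "\<eta> \<in> nat_trans C (bar (Suc m)) A"
    "\<And>\<sigma>. \<sigma> \<in> chains (Suc m) \<Longrightarrow> \<eta> (hd \<sigma>) (frag_of (\<sigma>, hd \<sigma>)) = a \<sigma>"
proof -
  define b where "b = (\<lambda>(\<sigma>, g). arm A (hd \<sigma>, g) (a \<sigma>))"
  have b: "b s \<in> carrier (obm A y)" if "s \<in> simplices (Suc m) y" for s y
  proof -
    obtain \<sigma> g where s: "s = (\<sigma>, g)" by (cases s)
    note sg = simplex_arrow[OF that[unfolded s]]
    show ?thesis using arm_closed[OF A sg(4), of "a \<sigma>"] a[OF sg(1)] sg by (simp add: s b_def)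
  qed
  have "\<exists>h. h \<in> hom (obm (bar (Suc m)) y) (obm A y)
      \<and> (\<forall>s \<in> simplices (Suc m) y. h (frag_of s) = b s)"
    if y: "y \<in> Ob C" for y
  proof -
    have "b ` simplices (Suc m) y \<subseteq> carrier (obm A y)" using b by auto
    from comm_group.free_Abelian_group_universal[OF cat_module_groupD[OF A y] this]
    show ?thesis by (metis obm_bar)
  qed
  then have "\<forall>y \<in> Ob C. \<exists>h. h \<in> hom (obm (bar (Suc m)) y) (obm A y)
      \<and> (\<forall>s \<in> simplices (Suc m) y. h (frag_of s) = b s)"
    by blast
  then obtain h where h': "\<forall>y \<in> Ob C. h y \<in> hom (obm (bar (Suc m)) y) (obm A y)
      \<and> (\<forall>s \<in> simplices (Suc m) y. h y (frag_of s) = b s)"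
    by (rule bchoice[THEN exE])
  then have h: "h y \<in> hom (obm (bar (Suc m)) y) (obm A y)"
    and h_of: "s \<in> simplices (Suc m) y \<Longrightarrow> h y (frag_of s) = b s" if "y \<in> Ob C" for y s
    using that by simp_all
  have in_nt: "nt_of C (bar (Suc m)) h \<in> nat_trans C (bar (Suc m)) A"
  proof (rule nt_of_in[OF bar_module])
    show "h x c \<in> carrier (obm A x)" if "x \<in> Ob C" "c \<in> carrier (obm (bar (Suc m)) x)" for x c
      by (rule hom_in_carrier[OF h that(2)]) (rule that(1))
    show "h x (c \<otimes>\<^bsub>obm (bar (Suc m)) x\<^esub> c') = h x c \<otimes>\<^bsub>obm A x\<^esub> h x c'"
      if "x \<in> Ob C" "c \<in> carrier (obm (bar (Suc m)) x)" "c' \<in> carrier (obm (bar (Suc m)) x)"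
          for x c c'
      by (rule hom_mult[OF h that(2,3)]) (rule that(1))
    fix f c assume f: "f \<in> Arr C" and c: "c \<in> carrier (obm (bar (Suc m)) (Dom C f))"
    obtain e k where fe: "f = (e, k)" "e \<in> Ob G" "k \<in> H" "Dom G k \<preceq> e" using f by (auto simp: Arr_C)
    have De: "Dom C f \<in> Ob C" "Cod C f \<in> Ob C" by (rule Dom_Ob[OF A f], rule Cod_Ob[OF A f])
    \<comment> \<open>both sides are homomorphisms in \<open>c\<close>, so naturality is only needed on the basis, where it
        is functoriality of \<open>A\<close>\<close>
    have "(h (Cod C f) \<circ> arm (bar (Suc m)) f) c = (arm A f \<circ> h (Dom C f)) c"
    proof (rule free_hom_eqI)
      show "h (Cod C f) \<circ> arm (bar (Suc m)) f
          \<in> hom (free_Abelian_group (simplices (Suc m) (Dom C f))) (obm A (Cod C f))"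
        using hom_compose[OF cat_module.arm_hom[OF bar_module f] h[OF De(2)]] by simp
      show "arm A f \<circ> h (Dom C f) \<in> hom (free_Abelian_group (simplices (Suc m) (Dom C f)))
          (obm A (Cod C f))"
        using hom_compose[OF h[OF De(1)] cat_module.arm_hom[OF A f]] by simp
      show "group (obm A (Cod C f))" by (rule cat_module_group[OF A De(2)])
      fix s assume s: "s \<in> simplices (Suc m) (Dom C f)"
      obtain \<sigma> g where s_eq: "s = (\<sigma>, g)" by (cases s)
      note sg = simplex_arrow[OF s[unfolded s_eq]]
      have "frag_of s \<in> carrier (obm (bar (Suc m)) (Dom C f))" using s by simp
      then have "arm (bar (Suc m)) f (frag_of s) \<in> carrier (obm (bar (Suc m)) (Cod C f))"
        by (rule arm_closed[OF bar_module f])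
      then have s': "(\<sigma>, rcomp g k) \<in> simplices (Suc m) (Cod C f)" by (simp add: arm_bar s_eq fe(1))
      have gk: "Dom G k \<preceq> Cod G g" "Cod G g = e" using sg fe by (simp_all add: Dom_C)
      have "h (Cod C f) (arm (bar (Suc m)) f (frag_of s)) = arm A (hd \<sigma>, rcomp g k) (a \<sigma>)"
        using h_of[OF De(2) s'] by (simp add: arm_bar s_eq fe(1) b_def)
      also have "(hd \<sigma>, rcomp g k) = Cmp C (hd \<sigma>, g) f"
        using gk fe sg(2) by (simp add: Cmp_C)
      also have "arm A (Cmp C (hd \<sigma>, g) f) (a \<sigma>) = arm A f (arm A (hd \<sigma>, g) (a \<sigma>))"
        using a[OF sg(1)] sg by (intro cat_module.arm_Cmp[OF A sg(4) f]) simp_all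
      also have "\<dots> = arm A f (h (Dom C f) (frag_of s))"
        using h_of[OF De(1) s] by (simp add: s_eq b_def)
      finally show "(h (Cod C f) \<circ> arm (bar (Suc m)) f) (frag_of s)
          = (arm A f \<circ> h (Dom C f)) (frag_of s)" by simp
    qed (use c in simp)
    then show "h (Cod C f) (arm (bar (Suc m)) f c) = arm A f (h (Dom C f) c)" by simp
  qed
  show thesis
  proof (rule that[OF in_nt])
    fix \<sigma> assume \<sigma>: "\<sigma> \<in> chains (Suc m)"
    note cs = chain_simplex[OF \<sigma>]
    have "nt_of C (bar (Suc m)) h (hd \<sigma>) (frag_of (\<sigma>, hd \<sigma>)) = arm A (hd \<sigma>, hd \<sigma>) (a \<sigma>)"
      using cs h_of[OF _ cs(2)] by (simp add: Ob_C b_def)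
    also have "\<dots> = a \<sigma>"
      using cat_module.arm_Idn[OF A, of "hd \<sigma>" "a \<sigma>"] a[OF \<sigma>] cs by (simp add: Ob_C Idn_C)
    finally show "nt_of C (bar (Suc m)) h (hd \<sigma>) (frag_of (\<sigma>, hd \<sigma>)) = a \<sigma>" .
  qed
qed

text \<open>A free module lifts: preimages are chosen for the values at the generators \<open>(\<sigma>, hd \<sigma>)\<close>.\<close>

lemma bar_lifts_from:
  fixes N :: "('g, 'g \<times> 'g, 'q) cmod"
  assumes N: "cat_module C N"
  shows "lifts_from C (bar (Suc m)) N"
  unfolding lifts_from_def
proof (intro allI impI)
  fix N' :: "('g, 'g \<times> 'g, 'q) cmod" and \<pi> \<phi>
  assume N': "cat_module C N'" and \<pi>: "\<pi> \<in> nat_trans C N N'"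
    and surj: "\<forall>x \<in> Ob C. \<pi> x ` carrier (obm N x) = carrier (obm N' x)"
    and \<phi>: "\<phi> \<in> nat_trans C (bar (Suc m)) N'"
  define a where "a \<sigma> = inv_into (carrier (obm N (hd \<sigma>))) (\<pi> (hd \<sigma>))
      (\<phi> (hd \<sigma>) (frag_of (\<sigma>, hd \<sigma>)))" for \<sigma>
  have a: "a \<sigma> \<in> carrier (obm N (hd \<sigma>))" "\<pi> (hd \<sigma>) (a \<sigma>) = \<phi> (hd \<sigma>) (frag_of (\<sigma>, hd \<sigma>))"
    if \<sigma>: "\<sigma> \<in> chains (Suc m)" for \<sigma>
  proof -
    note cs = chain_simplex[OF \<sigma>]
    have "\<phi> (hd \<sigma>) (frag_of (\<sigma>, hd \<sigma>)) \<in> carrier (obm N' (hd \<sigma>))"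
      using nat_trans_closed[OF \<phi>, of "hd \<sigma>"] cs by (simp add: Ob_C)
    then have "\<phi> (hd \<sigma>) (frag_of (\<sigma>, hd \<sigma>)) \<in> \<pi> (hd \<sigma>) ` carrier (obm N (hd \<sigma>))"
      using surj cs by (simp add: Ob_C)
    then show "a \<sigma> \<in> carrier (obm N (hd \<sigma>))" "\<pi> (hd \<sigma>) (a \<sigma>) = \<phi> (hd \<sigma>) (frag_of (\<sigma>, hd \<sigma>))"
      unfolding a_def by (rule inv_into_into, rule f_inv_into_f)
  qed
  obtain \<psi> where \<psi>: "\<psi> \<in> nat_trans C (bar (Suc m)) N"
    "\<And>\<sigma>. \<sigma> \<in> chains (Suc m) \<Longrightarrow> \<psi> (hd \<sigma>) (frag_of (\<sigma>, hd \<sigma>)) = a \<sigma>"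
    using bar_extension[OF N a(1)] by blast
  have "nt_comp C (bar (Suc m)) \<pi> \<psi> = \<phi>"
  proof (rule bar_nat_trans_eqI[OF N' nt_comp_in[OF bar_module \<psi>(1) \<pi>] \<phi>])
    fix \<sigma> assume \<sigma>: "\<sigma> \<in> chains (Suc m)"
    then show "nt_comp C (bar (Suc m)) \<pi> \<psi> (hd \<sigma>) (frag_of (\<sigma>, hd \<sigma>))
        = \<phi> (hd \<sigma>) (frag_of (\<sigma>, hd \<sigma>))"
      using chain_simplex[OF \<sigma>] by (simp add: Ob_C \<psi>(2) a(2))
  qed
  then have "\<pi> x (\<psi> x c) = \<phi> x c" if "x \<in> Ob C" "c \<in> carrier (obm (bar (Suc m)) x)" for x c
    using that nt_comp_apply by metis
  then show "\<exists>\<psi> \<in> nat_trans C (bar (Suc m)) N. \<forall>x \<in> Ob C. \<forall>c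
      \<in> carrier (obm (bar (Suc m)) x). \<pi> x (\<psi> x c) = \<phi> x c"
    using \<psi>(1) by blast
qed

end


section \<open>Comparing the two bar resolutions\<close>

text \<open>The free abelian group on an infinite set is equipotent to that set, and a pair \<open>(xs, x)\<close> can be
  read off the list \<open>x # xs\<close>.\<close>

lemma bar_carrier_embeds: "\<exists>j :: ('a list \<times> 'a \<Rightarrow>\<^sub>0 int) \<Rightarrow> ('a \<times> 'a, 'b) res_carrier. inj j"
proof -
  have "infinite (UNIV :: ('a list \<times> 'a) set)"
    by (simp add: infinite_UNIV_listI finite_prod)
  then have "carrier (free_Abelian_group (UNIV :: ('a list \<times> 'a) set)) \<approx>
      (UNIV :: ('a list \<times> 'a) set)"
    by (rule eqpoll_free_Abelian_group_infinite)
  moreover have "carrier (free_Abelian_group (UNIV :: ('a list \<times> 'a) set)) = UNIV" by auto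
  ultimately obtain f :: "('a list \<times> 'a \<Rightarrow>\<^sub>0 int) \<Rightarrow> 'a list \<times> 'a" where "inj f"
    by (auto simp: eqpoll_def bij_betw_def)
  moreover have "inj (\<lambda>(xs, x :: 'a). map (\<lambda>y. Inl (y, y) :: 'a \<times> 'a + 'b + nat) (x # xs))"
  proof (rule injI)
    have "inj (\<lambda>y. Inl (y, y) :: 'a \<times> 'a + 'b + nat)" by (rule injI) simp
    then show "p = q" if "(\<lambda>(xs, x :: 'a). map (\<lambda>y. Inl (y, y) :: 'a \<times> 'a + 'b + nat) (x # xs)) p
        = (\<lambda>(xs, x). map (\<lambda>y. Inl (y, y)) (x # xs)) q" for p q
      using that by (auto simp: case_prod_unfold prod_eq_iff dest: map_injective)
  qed
  ultimately show ?thesis using inj_compose by blast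
qed

context ordered_groupoid
begin

interpretation L: arrow_category G "Lcat G" "Arr G" by (rule Lcat_arrow_category)
interpretation E: arrow_category G "Ecat G" "Ob G" by (rule Ecat_arrow_category)

lemma ZG_eq: "ZG G = span_mod (\<lambda>e. {g \<in> Arr G. Cod G g = e}) (\<lambda>f h. rcomp h (snd f))"
  by (auto simp: ZG_def span_mod_def rcomp_def ginv_props fun_eq_iff
      intro!: arg_cong[of _ _ free_Abelian_group])

lemma ZG_module: "cat_module (Lcat G) (ZG G)"
  unfolding ZG_eq
  by (rule span_mod_module[OF L.C_category])
    (auto simp: L.Arr_C L.Dom_C L.Cod_C L.Idn_C L.Cmp_C rcomp_props rcomp_Cod rcomp_assoc)

lemma ZG_augmentation:
  obtains \<theta> where "\<theta> \<in> nat_trans (Lcat G) (L.bar 0) (ZG G)"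
    "\<And>x. x \<in> Ob (Lcat G) \<Longrightarrow> bij_betw (\<theta> x) (carrier (obm (L.bar 0) x)) (carrier (obm (ZG G) x))"
proof
  let ?drop = "frag_extend (\<lambda>(\<sigma> :: 'g list, g :: 'g). frag_of g)"
  let ?add = "frag_extend (\<lambda>g :: 'g. frag_of ([] :: 'g list, g))"
  have S: "L.simplices 0 x = {([], g) | g. g \<in> Arr G \<and> Cod G g = x}" for x
    by (auto simp: L.simplices_def L.chains_def)
  have closed: "Poly_Mapping.keys (?drop c) \<subseteq> {g \<in> Arr G. Cod G g = x}"
      if "Poly_Mapping.keys c \<subseteq> L.simplices 0 x" for c x
    by (rule keys_frag_extend_subset[OF that]) (auto simp: S)
  have closed': "Poly_Mapping.keys (?add c) \<subseteq> L.simplices 0 x"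
      if "Poly_Mapping.keys c \<subseteq> {g \<in> Arr G. Cod G g = x}" for c x
    by (rule keys_frag_extend_subset[OF that]) (auto simp: S)
  show nt: "nt_of (Lcat G) (L.bar 0) (\<lambda>_. ?drop) \<in> nat_trans (Lcat G) (L.bar 0) (ZG G)"
  proof (rule nt_of_in[OF L.bar_module])
    show "?drop a \<in> carrier (obm (ZG G) x)" if "a \<in> carrier (obm (L.bar 0) x)" for x a
      using closed that by (simp add: ZG_eq)
    show "?drop (a \<otimes>\<^bsub>obm (L.bar 0) x\<^esub> b) = ?drop a \<otimes>\<^bsub>obm (ZG G) x\<^esub> ?drop b" for x a b
      by (simp add: ZG_eq frag_extend_add)
    show "?drop (arm (L.bar 0) f a) = arm (ZG G) f (?drop a)" for f a
      by (induction a rule: frag_UNIV_induct)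
          (auto simp: L.arm_bar ZG_eq arm_span_mod frag_extend_diff)
  qed
  fix x assume x: "x \<in> Ob (Lcat G)"
  show "bij_betw (nt_of (Lcat G) (L.bar 0) (\<lambda>_. ?drop) x) (carrier (obm (L.bar 0) x))
      (carrier (obm (ZG G) x))"
  proof (rule bij_betw_byWitness[where f' = ?add])
    have "?add (?drop a) = a" if "Poly_Mapping.keys a \<subseteq> L.simplices 0 x" for a
      using that by (induction a rule: frag_induction) (auto simp: S frag_extend_diff)
    then show "\<forall>a \<in> carrier (obm (L.bar 0) x). ?add (nt_of (Lcat G) (L.bar 0) (\<lambda>_. ?drop) x a) = a"
      using x by simp
    have "?drop (?add a) = a" for a
      by (induction a rule: frag_UNIV_induct) (auto simp: frag_extend_diff)
    then show "\<forall>a \<in> carrier (obm (ZG G) x). nt_of (Lcat G) (L.bar 0) (\<lambda>_. ?drop) x (?add a) = a"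
      using x closed' by (simp add: ZG_eq)
    show "nt_of (Lcat G) (L.bar 0) (\<lambda>_. ?drop) x ` carrier (obm (L.bar 0) x)
        \<subseteq> carrier (obm (ZG G) x)"
      using nat_trans_closed[OF nt x] by blast
    show "?add ` carrier (obm (ZG G) x) \<subseteq> carrier (obm (L.bar 0) x)"
      using closed' by (auto simp: ZG_eq)
  qed
qed

lemma const_Z_module: "cat_module (Ecat G) const_Z"
  by (intro cat_module.intro cat_module_axioms.intro E.C_category)
    (auto simp: const_Z_def abelian_integer_group hom_def)

lemma const_Z_augmentation:
  obtains \<theta> where "\<theta> \<in> nat_trans (Ecat G) (E.bar 0) const_Z"
    "\<And>x. x \<in> Ob (Ecat G) \<Longrightarrow> bij_betw (\<theta> x) (carrier (obm (E.bar 0) x))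
        (carrier (obm (const_Z :: ('g, 'g \<times> 'g, int) cmod) x))"
proof
  let ?coeff = "\<lambda>x c. Poly_Mapping.lookup c ([] :: 'g list, x :: 'g)"
  have S: "E.simplices 0 x = {([], x)}" if "x \<in> Ob G" for x
    using that by (auto simp: E.simplices_def L.chains_def)
  show nt: "nt_of (Ecat G) (E.bar 0) ?coeff \<in> nat_trans (Ecat G) (E.bar 0) const_Z"
  proof (rule nt_of_in[OF E.bar_module])
    show "?coeff x a \<in> carrier (obm const_Z x)" for x a by (simp add: const_Z_def)
    show "?coeff x (a \<otimes>\<^bsub>obm (E.bar 0) x\<^esub> b) = ?coeff x a \<otimes>\<^bsub>obm const_Z x\<^esub> ?coeff x b" for x a b
      by (simp add: const_Z_def lookup_add)
    fix f a assume f: "f \<in> Arr (Ecat G)" and a: "a \<in> carrier (obm (E.bar 0) (Dom (Ecat G) f))"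
    obtain x y where xy: "f = (x, y)" "x \<in> Ob G" "y \<in> Ob G" "y \<preceq> x" using f by (auto simp: E.Arr_C)
    have "Poly_Mapping.keys a \<subseteq> {([], x)}" using a xy S by (simp add: E.Dom_C)
    then have "?coeff y (arm (E.bar 0) f a) = ?coeff x a"
      using xy by (induction a rule: frag_induction)
          (auto simp: E.arm_bar rcomp_Ob_left Ob_Arr lookup_minus)
    then show "?coeff (Cod (Ecat G) f) (arm (E.bar 0) f a)
        = arm const_Z f (?coeff (Dom (Ecat G) f) a)"
      using xy by (simp add: E.Dom_C E.Cod_C const_Z_def)
  qed
  fix x assume x: "x \<in> Ob (Ecat G)"
  show "bij_betw (nt_of (Ecat G) (E.bar 0) ?coeff x) (carrier (obm (E.bar 0) x))
      (carrier (obm (const_Z :: ('g, 'g \<times> 'g, int) cmod) x))"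
  proof (rule bij_betw_byWitness[where f' = "\<lambda>k. frag_cmul k (frag_of ([], x))"])
    have S': "E.simplices 0 x = {([], x)}" using x S by (simp add: E.Ob_C)
    have "frag_cmul (?coeff x a) (frag_of ([], x)) = a" if "Poly_Mapping.keys a \<subseteq> {([], x)}" for a
      using that by (intro poly_mapping_eqI) (auto simp: in_keys_iff subset_iff)
    then show "\<forall>a \<in> carrier (obm (E.bar 0) x). frag_cmul (nt_of (Ecat G) (E.bar 0) ?coeff x a)
        (frag_of ([], x)) = a"
      using x S' by simp
    show "\<forall>k \<in> carrier (obm const_Z x). nt_of (Ecat G) (E.bar 0) ?coeff x
        (frag_cmul k (frag_of ([], x))) = k"
    proof
      fix k :: int
      have "Poly_Mapping.keys (frag_cmul k (frag_of ([], x))) \<subseteq> E.simplices 0 x"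
        using keys_cmul[of k "frag_of ([], x)"] unfolding S' keys_frag_of .
      then have "frag_cmul k (frag_of ([], x)) \<in> carrier (obm (E.bar 0) x)"
        unfolding E.obm_bar carrier_free_Abelian_group_iff .
      then show "nt_of (Ecat G) (E.bar 0) ?coeff x (frag_cmul k (frag_of ([], x))) = k"
        by (simp only: nt_of_apply[OF x] lookup_frag_cmul lookup_frag_of refl if_True mult_1_right)
    qed
    show "nt_of (Ecat G) (E.bar 0) ?coeff x ` carrier (obm (E.bar 0) x) \<subseteq> carrier (obm const_Z x)"
      by (simp add: const_Z_def)
    show "(\<lambda>k. frag_cmul k (frag_of ([], x))) ` carrier (obm const_Z x) \<subseteq> carrier (obm (E.bar 0) x)"
      using S' by auto
  qed
qed

lemma ZG_resolution:
  "\<exists>\<epsilon> j. lifting_resolution (Lcat G) (ZG G) (\<lambda>n. L.bar (Suc n)) (\<lambda>n. L.bar_diff (Suc n)) \<epsilon> j"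
proof -
  obtain \<theta> where \<theta>: "\<theta> \<in> nat_trans (Lcat G) (L.bar 0) (ZG G)"
    "\<And>x. x \<in> Ob (Lcat G) \<Longrightarrow> bij_betw (\<theta> x) (carrier (obm (L.bar 0) x)) (carrier (obm (ZG G) x))"
    by (rule ZG_augmentation) blast
  obtain j :: "('g list \<times> 'g \<Rightarrow>\<^sub>0 int) \<Rightarrow> ('g \<times> 'g, 'g \<Rightarrow>\<^sub>0 int) res_carrier" where "inj j"
    using bar_carrier_embeds by blast
  then have "lifting_resolution (Lcat G) (ZG G) (\<lambda>n. L.bar (Suc n)) (\<lambda>n. L.bar_diff (Suc n))
      (nt_comp (Lcat G) (L.bar 1) \<theta> (L.bar_diff 0)) j"
    by (intro lifting_resolution.intro lifting_resolution_axioms.intro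
        L.bar_resolution[OF ZG_module \<theta>] L.bar_lifts_from L.bar_module)
  then show ?thesis by blast
qed

lemma const_Z_resolution:
  "\<exists>\<epsilon> j. lifting_resolution (Ecat G) const_Z (\<lambda>n. E.bar (Suc n)) (\<lambda>n. E.bar_diff (Suc n)) \<epsilon> j"
proof -
  obtain \<theta> where \<theta>: "\<theta> \<in> nat_trans (Ecat G) (E.bar 0) const_Z"
    "\<And>x. x \<in> Ob (Ecat G) \<Longrightarrow>
      bij_betw (\<theta> x) (carrier (obm (E.bar 0) x))
          (carrier (obm (const_Z :: ('g, 'g \<times> 'g, int) cmod) x))"
    by (rule const_Z_augmentation) blast
  obtain j :: "('g list \<times> 'g \<Rightarrow>\<^sub>0 int) \<Rightarrow> ('g \<times> 'g, int) res_carrier" where "inj j"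
    using bar_carrier_embeds by blast
  then have "lifting_resolution (Ecat G) const_Z (\<lambda>n. E.bar (Suc n)) (\<lambda>n. E.bar_diff (Suc n))
      (nt_comp (Ecat G) (E.bar 1) \<theta> (E.bar_diff 0)) j"
    by (intro lifting_resolution.intro lifting_resolution_axioms.intro
        E.bar_resolution[OF const_Z_module \<theta>] E.bar_lifts_from E.bar_module)
  then show ?thesis by blast
qed

lemma cochains_ZG_postcomp:
  assumes "cat_module (Lcat G) A" "cat_module (Lcat G) A'" "\<alpha> \<in> nat_trans (Lcat G) A A'"
  shows "cochain_map (cochains (Lcat G) (ZG G) A) (coboundary (Lcat G) (ZG G))
    (cochains (Lcat G) (ZG G) A') (coboundary (Lcat G) (ZG G))
        (\<lambda>n. nt_comp (Lcat G) (res_mod (Lcat G) (ZG G) n) \<alpha>)"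
  using ZG_resolution lifting_resolution.cochains_postcomp[OF _ assms] by blast

lemma Ecat_arrow:
  assumes "f \<in> Arr (Ecat G)"
  shows "f \<in> Arr (Lcat G)" "Dom (Lcat G) f = Dom (Ecat G) f" "Cod (Lcat G) f = Cod (Ecat G) f"
  using assms Ob_Arr by (auto simp: E.Arr_C L.Arr_C E.Dom_C L.Dom_C E.Cod_C L.Cod_C)

lemma restrict_E_simps [simp]: "obm (restrict_E A) = obm A" "arm (restrict_E A) f = arm A f"
  by (simp_all add: restrict_E_def E_embed_def case_prod_unfold)

lemma restrict_E_module:
  assumes A: "cat_module (Lcat G) A"
  shows "cat_module (Ecat G) (restrict_E A)"
proof (intro cat_module.intro cat_module_axioms.intro E.C_category)
  show "comm_group (obm (restrict_E A) x)" if "x \<in> Ob (Ecat G)" for x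
    using that cat_module_groupD[OF A, of x] by (simp add: E.Ob_C L.Ob_C)
  show "arm (restrict_E A) f \<in> hom (obm (restrict_E A) (Dom (Ecat G) f))
      (obm (restrict_E A) (Cod (Ecat G) f))"
    if "f \<in> Arr (Ecat G)" for f
    using cat_module.arm_hom[OF A Ecat_arrow(1)[OF that]] Ecat_arrow[OF that] by simp
  show "arm (restrict_E A) (Idn (Ecat G) x) a = a"
    if "x \<in> Ob (Ecat G)" "a \<in> carrier (obm (restrict_E A) x)" for x a
    using that cat_module.arm_Idn[OF A, of x a] by (simp add: E.Ob_C L.Ob_C E.Idn_C L.Idn_C)
  fix f g a assume f: "f \<in> Arr (Ecat G)" and g: "g \<in> Arr (Ecat G)"
      and fg: "Cod (Ecat G) f = Dom (Ecat G) g"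
    and a: "a \<in> carrier (obm (restrict_E A) (Dom (Ecat G) f))"
  have "Cmp (Ecat G) f g = Cmp (Lcat G) f g"
    using f g fg Ob_Arr by (auto simp: E.Arr_C E.Dom_C E.Cod_C E.Cmp_C L.Cmp_C)
  then show "arm (restrict_E A) (Cmp (Ecat G) f g) a
      = arm (restrict_E A) g (arm (restrict_E A) f a)"
    using cat_module.arm_Cmp[OF A Ecat_arrow(1)[OF f] Ecat_arrow(1)[OF g], of a] a fg
        Ecat_arrow[OF f] Ecat_arrow[OF g]
    by simp
qed

lemma restrict_E_nat_trans:
  assumes "\<alpha> \<in> nat_trans (Lcat G) A A'"
  shows "\<alpha> \<in> nat_trans (Ecat G) (restrict_E A) (restrict_E A')"
proof (rule nat_transI)
  show "\<alpha> \<in> extensional (Ob (Ecat G))"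
    using assms by (simp add: nat_trans_def E.Ob_C L.Ob_C)
  show "\<alpha> x \<in> extensional (carrier (obm (restrict_E A) x))"
    "\<alpha> x \<in> hom (obm (restrict_E A) x) (obm (restrict_E A') x)" if "x \<in> Ob (Ecat G)" for x
    using assms that by (simp_all add: nat_trans_def E.Ob_C L.Ob_C)
  show "\<alpha> (Cod (Ecat G) f) (arm (restrict_E A) f a) = arm (restrict_E A') f (\<alpha> (Dom (Ecat G) f) a)"
    if "f \<in> Arr (Ecat G)" "a \<in> carrier (obm (restrict_E A) (Dom (Ecat G) f))" for f a
    using nat_trans_natural[OF assms, of f a] that Ecat_arrow[OF that(1)] by simp
qed

lemma cochains_const_Z_postcomp:
  assumes "cat_module (Lcat G) A" "cat_module (Lcat G) A'" "\<alpha> \<in> nat_trans (Lcat G) A A'"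
  shows "cochain_map (cochains (Ecat G) const_Z (restrict_E A)) (coboundary (Ecat G) const_Z)
    (cochains (Ecat G) const_Z (restrict_E A')) (coboundary (Ecat G) const_Z)
    (\<lambda>n. nt_comp (Ecat G) (res_mod (Ecat G) const_Z n) \<alpha>)"
  using const_Z_resolution lifting_resolution.cochains_postcomp[OF _ restrict_E_module[OF assms(1)]
      restrict_E_module[OF assms(2)] restrict_E_nat_trans[OF assms(3)]] by blast

text \<open>The basis of \<open>E.bar\<close> consists of those basis elements of \<open>L.bar\<close> whose arrow is an identity.
  Restriction to it is the adjunction isomorphism between homomorphisms over \<open>Lcat G\<close> and over
  \<open>Ecat G\<close>.\<close>

definition restrict_bar ::
  "nat \<Rightarrow> ('g \<Rightarrow> ('g list \<times> 'g \<Rightarrow>\<^sub>0 int) \<Rightarrow> 'b) \<Rightarrow> 'g \<Rightarrow> ('g list \<times> 'g \<Rightarrow>\<^sub>0 int) \<Rightarrow> 'b" where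
  "restrict_bar n = nt_of (Ecat G) (E.bar (Suc n))"

lemma simplices_mono: "E.simplices n x \<subseteq> L.simplices n x"
  using Ob_Arr by (auto simp: E.simplices_def L.simplices_def L.chains_def)

lemma restrict_bar_apply:
  "x \<in> Ob G \<Longrightarrow> Poly_Mapping.keys c \<subseteq> E.simplices (Suc n) x \<Longrightarrow> restrict_bar n \<phi> x c = \<phi> x c"
  by (simp add: restrict_bar_def E.Ob_C)

lemma restrict_bar_in:
  assumes \<phi>: "\<phi> \<in> nat_trans (Lcat G) (L.bar (Suc n)) A"
  shows "restrict_bar n \<phi> \<in> nat_trans (Ecat G) (E.bar (Suc n)) (restrict_E A)"
  unfolding restrict_bar_def
proof (rule nt_of_in[OF E.bar_module])
  fix x c assume x: "x \<in> Ob (Ecat G)" and c: "c \<in> carrier (obm (E.bar (Suc n)) x)"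
  have x': "x \<in> Ob (Lcat G)" using x by (simp add: E.Ob_C L.Ob_C)
  have c': "c \<in> carrier (obm (L.bar (Suc n)) x)" using c simplices_mono by fastforce
  show "\<phi> x c \<in> carrier (obm (restrict_E A) x)" using nat_trans_closed[OF \<phi> x' c'] by simp
  fix b assume "b \<in> carrier (obm (E.bar (Suc n)) x)"
  then have b': "b \<in> carrier (obm (L.bar (Suc n)) x)" using simplices_mono by fastforce
  show "\<phi> x (c \<otimes>\<^bsub>obm (E.bar (Suc n)) x\<^esub> b) = \<phi> x c \<otimes>\<^bsub>obm (restrict_E A) x\<^esub> \<phi> x b"
    using nat_trans_mult[OF \<phi> x' c' b'] by simp
next
  fix f c assume f: "f \<in> Arr (Ecat G)" and c: "c \<in> carrier (obm (E.bar (Suc n)) (Dom (Ecat G) f))"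
  have "c \<in> carrier (obm (L.bar (Suc n)) (Dom (Lcat G) f))"
    using c simplices_mono Ecat_arrow[OF f] by fastforce
  from nat_trans_natural[OF \<phi> Ecat_arrow(1)[OF f] this]
  show "\<phi> (Cod (Ecat G) f) (arm (E.bar (Suc n)) f c) = arm (restrict_E A) f (\<phi> (Dom (Ecat G) f) c)"
    using Ecat_arrow[OF f] by (simp add: E.arm_bar L.arm_bar)
qed

text \<open>Over either category a homomorphism is determined by its values at the pairs \<open>(\<sigma>, hd \<sigma>)\<close>, which
  are arbitrary, and these pairs belong to both bar modules.\<close>

lemma restrict_bar_bij:
  assumes A: "cat_module (Lcat G) A"
  shows "bij_betw (restrict_bar n) (nat_trans (Lcat G) (L.bar (Suc n)) A)
    (nat_trans (Ecat G) (E.bar (Suc n)) (restrict_E A))"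
proof (rule bij_betwI')
  note A' = restrict_E_module[OF A]
  have at_gen: "restrict_bar n \<phi> (hd \<sigma>) (frag_of (\<sigma>, hd \<sigma>)) = \<phi> (hd \<sigma>) (frag_of (\<sigma>, hd \<sigma>))"
    if "\<sigma> \<in> L.chains (Suc n)" for \<phi> :: "'g \<Rightarrow> ('g list \<times> 'g \<Rightarrow>\<^sub>0 int) \<Rightarrow> 'b" and \<sigma>
    using that E.chain_simplex[of \<sigma> n] by (simp add: restrict_bar_apply)
  fix \<phi> \<psi> assume \<phi>: "\<phi> \<in> nat_trans (Lcat G) (L.bar (Suc n)) A"
      and \<psi>: "\<psi> \<in> nat_trans (Lcat G) (L.bar (Suc n)) A"
  show "restrict_bar n \<phi> = restrict_bar n \<psi> \<longleftrightarrow> \<phi> = \<psi>"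
  proof
    assume eq: "restrict_bar n \<phi> = restrict_bar n \<psi>"
    show "\<phi> = \<psi>"
      by (rule L.bar_nat_trans_eqI[OF A \<phi> \<psi>]) (metis at_gen eq)
  qed simp
next
  show "restrict_bar n \<phi> \<in> nat_trans (Ecat G) (E.bar (Suc n)) (restrict_E A)"
    if "\<phi> \<in> nat_trans (Lcat G) (L.bar (Suc n)) A" for \<phi>
    by (rule restrict_bar_in[OF that])
next
  fix \<psi> assume \<psi>: "\<psi> \<in> nat_trans (Ecat G) (E.bar (Suc n)) (restrict_E A)"
  have "\<psi> (hd \<sigma>) (frag_of (\<sigma>, hd \<sigma>)) \<in> carrier (obm A (hd \<sigma>))" if "\<sigma> \<in> L.chains (Suc n)" for \<sigma>
    using nat_trans_closed[OF \<psi>, of "hd \<sigma>" "frag_of (\<sigma>, hd \<sigma>)"] that E.chain_simplex[of \<sigma> n]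
    by (simp add: E.Ob_C)
  from L.bar_extension[OF A this] obtain \<phi> where \<phi>: "\<phi> \<in> nat_trans (Lcat G) (L.bar (Suc n)) A"
    "\<And>\<sigma>. \<sigma> \<in> L.chains (Suc n) \<Longrightarrow> \<phi> (hd \<sigma>) (frag_of (\<sigma>, hd \<sigma>)) = \<psi> (hd \<sigma>) (frag_of (\<sigma>, hd \<sigma>))"
    by blast
  have "\<psi> = restrict_bar n \<phi>"
  proof (rule E.bar_nat_trans_eqI[OF restrict_E_module[OF A] \<psi> restrict_bar_in[OF \<phi>(1)]])
    fix \<sigma> assume "\<sigma> \<in> L.chains (Suc n)"
    then show "\<psi> (hd \<sigma>) (frag_of (\<sigma>, hd \<sigma>)) = restrict_bar n \<phi> (hd \<sigma>) (frag_of (\<sigma>, hd \<sigma>))"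
      using \<phi>(2)[of \<sigma>] E.chain_simplex[of \<sigma> n] by (simp add: restrict_bar_apply)
  qed
  with \<phi>(1) show "\<exists>\<phi> \<in> nat_trans (Lcat G) (L.bar (Suc n)) A. \<psi> = restrict_bar n \<phi>" by blast
qed

lemma restrict_bar_cochain_map:
  assumes A: "cat_module (Lcat G) A"
  shows "cochain_map
    (\<lambda>n. Hom_group (Lcat G) (L.bar (Suc n)) A)
        (\<lambda>n f. nt_comp (Lcat G) (L.bar (Suc (Suc n))) f (L.bar_diff (Suc n)))
    (\<lambda>n. Hom_group (Ecat G) (E.bar (Suc n)) (restrict_E A))
        (\<lambda>n f. nt_comp (Ecat G) (E.bar (Suc (Suc n))) f (E.bar_diff (Suc n)))
    restrict_bar"
proof (intro cochain_map.intro cochain_map_axioms.intro)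
  note A' = restrict_E_module[OF A]
  show "cochain_complex (\<lambda>n. Hom_group (Lcat G) (L.bar (Suc n)) A)
      (\<lambda>n f. nt_comp (Lcat G) (L.bar (Suc (Suc n))) f (L.bar_diff (Suc n)))"
    using ZG_resolution resolution.Hom_cochain_complex[OF lifting_resolution.axioms(1) A] by blast
  show "cochain_complex (\<lambda>n. Hom_group (Ecat G) (E.bar (Suc n)) (restrict_E A))
      (\<lambda>n f. nt_comp (Ecat G) (E.bar (Suc (Suc n))) f (E.bar_diff (Suc n)))"
    using const_Z_resolution resolution.Hom_cochain_complex[OF lifting_resolution.axioms(1) A']
        by blast
  fix n
  show "restrict_bar n \<in> hom (Hom_group (Lcat G) (L.bar (Suc n)) A)
      (Hom_group (Ecat G) (E.bar (Suc n)) (restrict_E A))"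
  proof (rule homI)
    fix f g assume f: "f \<in> carrier (Hom_group (Lcat G) (L.bar (Suc n)) A)"
        and g: "g \<in> carrier (Hom_group (Lcat G) (L.bar (Suc n)) A)"
    show "restrict_bar n f \<in> carrier (Hom_group (Ecat G) (E.bar (Suc n)) (restrict_E A))"
      using restrict_bar_in f by simp
    from f g have fg: "f \<in> nat_trans (Lcat G) (L.bar (Suc n)) A"
        "g \<in> nat_trans (Lcat G) (L.bar (Suc n)) A" by simp_all
    show "restrict_bar n (f \<otimes>\<^bsub>Hom_group (Lcat G) (L.bar (Suc n)) A\<^esub> g)
        = restrict_bar n f \<otimes>\<^bsub>Hom_group (Ecat G) (E.bar (Suc n)) (restrict_E A)\<^esub> restrict_bar n g"
    proof (rule nat_trans_eqI[OF restrict_bar_in[OF Hom_group_mult_in[OF L.bar_module A fg]]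
          Hom_group_mult_in[OF E.bar_module A' restrict_bar_in[OF fg(1)]
              restrict_bar_in[OF fg(2)]]])
      fix x c assume x: "x \<in> Ob (Ecat G)" and c: "c \<in> carrier (obm (E.bar (Suc n)) x)"
      then have "Poly_Mapping.keys c \<subseteq> L.simplices (Suc n) x" using simplices_mono by fastforce
      then show "restrict_bar n (f \<otimes>\<^bsub>Hom_group (Lcat G) (L.bar (Suc n)) A\<^esub> g) x c
          = (restrict_bar n f \<otimes>\<^bsub>Hom_group (Ecat G) (E.bar (Suc n)) (restrict_E A)\<^esub> restrict_bar n
              g) x c"
        using x c by (simp add: restrict_bar_apply E.Ob_C L.Ob_C)
    qed
  qed
  fix f assume "f \<in> carrier (Hom_group (Lcat G) (L.bar (Suc n)) A)"
  then have f: "f \<in> nat_trans (Lcat G) (L.bar (Suc n)) A" by simp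
  show "restrict_bar (Suc n) (nt_comp (Lcat G) (L.bar (Suc (Suc n))) f (L.bar_diff (Suc n)))
      = nt_comp (Ecat G) (E.bar (Suc (Suc n))) (restrict_bar n f) (E.bar_diff (Suc n))"
  proof (rule nat_trans_eqI[OF restrict_bar_in[OF nt_comp_in[OF L.bar_module L.bar_diff_in f]]
        nt_comp_in[OF E.bar_module E.bar_diff_in restrict_bar_in[OF f]]])
    fix x c assume x: "x \<in> Ob (Ecat G)" and c: "c \<in> carrier (obm (E.bar (Suc (Suc n))) x)"
    then have "Poly_Mapping.keys c \<subseteq> L.simplices (Suc (Suc n)) x" using simplices_mono by fastforce
    then show "restrict_bar (Suc n)
        (nt_comp (Lcat G) (L.bar (Suc (Suc n))) f (L.bar_diff (Suc n))) x c
        = nt_comp (Ecat G) (E.bar (Suc (Suc n))) (restrict_bar n f) (E.bar_diff (Suc n)) x c"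
      using x c E.boundary_closed[of c "Suc n" x]
      by (simp add: restrict_bar_apply E.Ob_C L.Ob_C E.bar_diff_def L.bar_diff_def)
  qed
qed

lemma restrict_bar_natural:
  assumes \<phi>: "\<phi> \<in> nat_trans (Lcat G) (L.bar (Suc n)) A" and \<alpha>: "\<alpha> \<in> nat_trans (Lcat G) A A'"
  shows "restrict_bar n (nt_comp (Lcat G) (L.bar (Suc n)) \<alpha> \<phi>)
      = nt_comp (Ecat G) (E.bar (Suc n)) \<alpha> (restrict_bar n \<phi>)"
proof (rule nat_trans_eqI[OF restrict_bar_in[OF nt_comp_in[OF L.bar_module \<phi> \<alpha>]]
      nt_comp_in[OF E.bar_module restrict_bar_in[OF \<phi>] restrict_E_nat_trans[OF \<alpha>]]])
  fix x c assume x: "x \<in> Ob (Ecat G)" and c: "c \<in> carrier (obm (E.bar (Suc n)) x)"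
  then have "Poly_Mapping.keys c \<subseteq> L.simplices (Suc n) x" using simplices_mono by fastforce
  then show "restrict_bar n (nt_comp (Lcat G) (L.bar (Suc n)) \<alpha> \<phi>) x c
      = nt_comp (Ecat G) (E.bar (Suc n)) \<alpha> (restrict_bar n \<phi>) x c"
    using x c by (simp add: restrict_bar_apply E.Ob_C L.Ob_C)
qed

text \<open>The cochain map \<open>h A\<close> pulls a cochain back to the small bar resolution, extends it to the large
  one, and pulls the result back to the resolution chosen for \<open>ZG G\<close>.\<close>

lemma natural_quasi_isomorphism:
  "\<exists>h. (\<forall>A :: ('g, 'g \<times> 'g, 'a) cmod. cat_module (Lcat G) A \<longrightarrow>
      quasi_isomorphism (cochains (Ecat G) const_Z (restrict_E A)) (coboundary (Ecat G) const_Z)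
        (cochains (Lcat G) (ZG G) A) (coboundary (Lcat G) (ZG G)) (h A)) \<and>
    (\<forall>(A :: ('g, 'g \<times> 'g, 'a) cmod) (A' :: ('g, 'g \<times> 'g, 'a) cmod) \<alpha> n.
      cat_module (Lcat G) A \<longrightarrow> cat_module (Lcat G) A' \<longrightarrow> \<alpha> \<in> nat_trans (Lcat G) A A' \<longrightarrow>
      (\<forall>z \<in> carrier (cochains (Ecat G) const_Z (restrict_E A) n).
        h A' n (nt_comp (Ecat G) (res_mod (Ecat G) const_Z n) \<alpha> z)
          = nt_comp (Lcat G) (res_mod (Lcat G) (ZG G) n) \<alpha> (h A n z)))"
proof -
  let ?RL = "res_mod (Lcat G) (ZG G)" and ?RE = "res_mod (Ecat G) const_Z"
  let ?FL = "\<lambda>n. L.bar (Suc n)" and ?FE = "\<lambda>n. E.bar (Suc n)"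
  let ?KL = "\<lambda>(A :: ('g, 'g \<times> 'g, 'a) cmod) n. Hom_group (Lcat G) (?FL n) A"
    and ?KE = "\<lambda>(A :: ('g, 'g \<times> 'g, 'a) cmod) n. Hom_group (Ecat G) (?FE n) (restrict_E A)"
  let ?dL = "\<lambda>n f. nt_comp (Lcat G) (?FL (Suc n)) f (L.bar_diff (Suc n))"
    and ?dE = "\<lambda>n f. nt_comp (Ecat G) (?FE (Suc n)) f (E.bar_diff (Suc n))"
  let ?CL = "cochains (Lcat G) (ZG G)" and ?\<delta>L = "coboundary (Lcat G) (ZG G)"
  let ?CE = "\<lambda>A :: ('g, 'g \<times> 'g, 'a) cmod. cochains (Ecat G) const_Z (restrict_E A)"
      and ?\<delta>E = "coboundary (Ecat G) const_Z"
  obtain \<epsilon>L jL where "lifting_resolution (Lcat G) (ZG G) ?FL (\<lambda>n. L.bar_diff (Suc n)) \<epsilon>L jL"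
    using ZG_resolution by blast
  then interpret RL: lifting_resolution "Lcat G" "ZG G" ?FL "\<lambda>n. L.bar_diff (Suc n)" \<epsilon>L jL .
  obtain \<epsilon>E jE where "lifting_resolution (Ecat G) const_Z ?FE (\<lambda>n. E.bar_diff (Suc n)) \<epsilon>E jE"
    using const_Z_resolution by blast
  then interpret RE: lifting_resolution "Ecat G" const_Z ?FE "\<lambda>n. E.bar_diff (Suc n)" \<epsilon>E jE .
  obtain q where q: "(\<forall>n. q n \<in> nat_trans (Lcat G) (?RL n) (?FL n)) \<and>
      (\<forall>A :: ('g, 'g \<times> 'g, 'a) cmod. cat_module (Lcat G) A \<longrightarrow>
        quasi_isomorphism (?KL A) ?dL (?CL A) ?\<delta>L (\<lambda>n f. nt_comp (Lcat G) (?RL n) f (q n)))"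
    using RL.resolution_to_cochains by (rule exE)
  obtain p where p: "(\<forall>n. p n \<in> nat_trans (Ecat G) (?FE n) (?RE n)) \<and>
      (\<forall>A :: ('g, 'g \<times> 'g, 'a) cmod. cat_module (Ecat G) A \<longrightarrow>
        quasi_isomorphism (cochains (Ecat G) const_Z A) ?\<delta>E (\<lambda>n. Hom_group (Ecat G) (?FE n) A) ?dE
          (\<lambda>n f. nt_comp (Ecat G) (?FE n) f (p n)))"
    using RE.cochains_to_resolution by (rule exE)
  have p_in: "p n \<in> nat_trans (Ecat G) (?FE n) (?RE n)"
      and q_in: "q n \<in> nat_trans (Lcat G) (?RL n) (?FL n)" for n
    using spec[OF conjunct1[OF p]] spec[OF conjunct1[OF q]] by blast+
  \<comment> \<open>the inverse of restriction: extension of cochains from identities to all arrows\<close>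
  define ext where "ext A n = inv_into (nat_trans (Lcat G) (?FL n) A) (restrict_bar n)"
    for A :: "('g, 'g \<times> 'g, 'a) cmod" and n
  define h where "h A n = (\<lambda>f. nt_comp (Lcat G) (?RL n) f (q n)) \<circ>
      (ext A n \<circ> (\<lambda>f. nt_comp (Ecat G) (?FE n) f (p n)))"
    for A :: "('g, 'g \<times> 'g, 'a) cmod" and n
  have h_qiso: "quasi_isomorphism (?CE A) ?\<delta>E (?CL A) ?\<delta>L (h A)"
    if A: "cat_module (Lcat G) A" for A :: "('g, 'g \<times> 'g, 'a) cmod"
  proof -
    have 1: "quasi_isomorphism (?CE A) ?\<delta>E (?KE A) ?dE (\<lambda>n f. nt_comp (Ecat G) (?FE n) f (p n))"
      using spec[OF conjunct2[OF p], of "restrict_E A"] restrict_E_module[OF A] by (rule mp)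
    have 2: "quasi_isomorphism (?KE A) ?dE (?KL A) ?dL (ext A)"
    proof -
      have "quasi_isomorphism (?KE A) ?dE (?KL A) ?dL
          (\<lambda>n. inv_into (carrier (?KL A n)) (restrict_bar n))"
        by (rule inverse_quasi_isomorphism[OF restrict_bar_cochain_map[OF A]])
            (simp add: restrict_bar_bij[OF A])
      moreover have "ext A = (\<lambda>n. inv_into (carrier (?KL A n)) (restrict_bar n))"
        by (simp add: ext_def fun_eq_iff)
      ultimately show ?thesis by simp
    qed
    have 3: "quasi_isomorphism (?KL A) ?dL (?CL A) ?\<delta>L (\<lambda>n f. nt_comp (Lcat G) (?RL n) f (q n))"
      using spec[OF conjunct2[OF q], of A] A by (rule mp)
    have "h A = (\<lambda>n. (\<lambda>f. nt_comp (Lcat G) (?RL n) f (q n))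
        \<circ> (ext A n \<circ> (\<lambda>f. nt_comp (Ecat G) (?FE n) f (p n))))"
      by (simp add: h_def fun_eq_iff)
    then show ?thesis
      using quasi_isomorphism_comp[OF quasi_isomorphism_comp[OF 1 2] 3] by simp
  qed
  note RL_mod = RL.res_mod_module and RE_mod = RE.res_mod_module
  have h_natural: "h A' n (nt_comp (Ecat G) (?RE n) \<alpha> z) = nt_comp (Lcat G) (?RL n) \<alpha> (h A n z)"
    if A: "cat_module (Lcat G) A" and A': "cat_module (Lcat G) A'"
        and \<alpha>: "\<alpha> \<in> nat_trans (Lcat G) A A'"
      and z: "z \<in> nat_trans (Ecat G) (?RE n) (restrict_E A)" for A A' :: "('g, 'g \<times> 'g, 'a) cmod"
          and n \<alpha> z
  proof -
    note \<alpha>E = restrict_E_nat_trans[OF \<alpha>]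
    define w where "w = nt_comp (Ecat G) (?FE n) z (p n)"
    have w: "w \<in> nat_trans (Ecat G) (?FE n) (restrict_E A)"
      unfolding w_def by (rule nt_comp_in[OF E.bar_module p_in z])
    have w': "nt_comp (Ecat G) (?FE n) (nt_comp (Ecat G) (?RE n) \<alpha> z) (p n)
        = nt_comp (Ecat G) (?FE n) \<alpha> w"
      unfolding w_def by (rule nt_comp_assoc[OF E.bar_module RE_mod p_in z \<alpha>E])
    define \<phi> where "\<phi> = ext A n w"
    have \<phi>: "\<phi> \<in> nat_trans (Lcat G) (?FL n) A" and \<phi>w: "restrict_bar n \<phi> = w"
    proof -
      have "w \<in> restrict_bar n ` nat_trans (Lcat G) (?FL n) A"
        using restrict_bar_bij[OF A, of n] w by (simp add: bij_betw_def)
      then show "\<phi> \<in> nat_trans (Lcat G) (?FL n) A" "restrict_bar n \<phi> = w"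
        unfolding \<phi>_def ext_def by (rule inv_into_into, rule f_inv_into_f)
    qed
    note \<alpha>\<phi> = nt_comp_in[OF L.bar_module \<phi> \<alpha>]
    have "ext A' n (nt_comp (Ecat G) (?FE n) \<alpha> w) = nt_comp (Lcat G) (?FL n) \<alpha> \<phi>"
      unfolding \<phi>w[symmetric] restrict_bar_natural[OF \<phi> \<alpha>, symmetric] ext_def
      by (rule inv_into_f_f[OF bij_betw_imp_inj_on[OF restrict_bar_bij[OF A']] \<alpha>\<phi>])
    then have "h A' n (nt_comp (Ecat G) (?RE n) \<alpha> z)
        = nt_comp (Lcat G) (?RL n) (nt_comp (Lcat G) (?FL n) \<alpha> \<phi>) (q n)"
      by (simp add: h_def w')
    also have "\<dots> = nt_comp (Lcat G) (?RL n) \<alpha> (nt_comp (Lcat G) (?RL n) \<phi> (q n))"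
      by (rule nt_comp_assoc[OF RL_mod L.bar_module q_in \<phi> \<alpha>])
    also have "nt_comp (Lcat G) (?RL n) \<phi> (q n) = h A n z"
      by (simp add: h_def \<phi>_def w_def)
    finally show ?thesis .
  qed
  show ?thesis
  proof (intro exI[of _ h] conjI allI impI ballI)
    show "quasi_isomorphism (?CE A) ?\<delta>E (?CL A) ?\<delta>L (h A)" if "cat_module (Lcat G) A"
      for A :: "('g, 'g \<times> 'g, 'a) cmod" by (rule h_qiso[OF that])
    show "h A' n (nt_comp (Ecat G) (?RE n) \<alpha> z) = nt_comp (Lcat G) (?RL n) \<alpha> (h A n z)"
      if "cat_module (Lcat G) A" "cat_module (Lcat G) A'" "\<alpha> \<in> nat_trans (Lcat G) A A'"
          "z \<in> carrier (?CE A n)"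
      for A A' :: "('g, 'g \<times> 'g, 'a) cmod" and \<alpha> n z
      using that by (intro h_natural) (simp_all add: cochains_eq)
  qed
qed

end

theorem theorem3p2:
  fixes G :: "'g ogpd"
  assumes "ordered_groupoid G"
  shows "\<exists>\<Phi> :: nat \<Rightarrow> ('g, 'g \<times> 'g, 'a) cmod \<Rightarrow>
            ('g \<Rightarrow> ('g \<times> 'g, int) res_carrier \<Rightarrow> 'a) set \<Rightarrow>
            ('g \<Rightarrow> ('g \<times> 'g, 'g \<Rightarrow>\<^sub>0 int) res_carrier \<Rightarrow> 'a) set.
    (\<forall>n A. cat_module (Lcat G) A \<longrightarrow> \<Phi> n A \<in> iso (H_E G n A) (Ext (Lcat G) n (ZG G) A)) \<and>
    (\<forall>n A A' \<alpha>. cat_module (Lcat G) A \<longrightarrow> cat_module (Lcat G) A' \<longrightarrow>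
        \<alpha> \<in> nat_trans (Lcat G) A A' \<longrightarrow>
        (\<forall>X \<in> carrier (H_E G n A).
           \<Phi> n A' (H_E_map G n A' \<alpha> X) = Ext_map (Lcat G) n (ZG G) A' \<alpha> (\<Phi> n A X)))"
proof -
  interpret ordered_groupoid G by fact
  let ?CL = "cochains (Lcat G) (ZG G)" and ?\<delta>L = "coboundary (Lcat G) (ZG G)"
  let ?CE = "\<lambda>A :: ('g, 'g \<times> 'g, 'a) cmod. cochains (Ecat G) const_Z (restrict_E A)"
    and ?\<delta>E = "coboundary (Ecat G) const_Z"
  obtain h where h: "(\<forall>A :: ('g, 'g \<times> 'g, 'a) cmod. cat_module (Lcat G) A \<longrightarrow>
        quasi_isomorphism (?CE A) ?\<delta>E (?CL A) ?\<delta>L (h A)) \<and>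
      (\<forall>(A :: ('g, 'g \<times> 'g, 'a) cmod) (A' :: ('g, 'g \<times> 'g, 'a) cmod) \<alpha> n.
        cat_module (Lcat G) A \<longrightarrow> cat_module (Lcat G) A' \<longrightarrow> \<alpha> \<in> nat_trans (Lcat G) A A' \<longrightarrow>
        (\<forall>z \<in> carrier (?CE A n). h A' n (nt_comp (Ecat G) (res_mod (Ecat G) const_Z n) \<alpha> z)
          = nt_comp (Lcat G) (res_mod (Lcat G) (ZG G) n) \<alpha> (h A n z)))"
    using natural_quasi_isomorphism by (rule exE)
  note h_qiso = conjunct1[OF h, rule_format] and h_natural = conjunct2[OF h, rule_format]
  define \<Phi> where "\<Phi> n A = cohomology_map (?CL A) ?\<delta>L (h A) n" for n A
  show ?thesis
  proof (intro exI[of _ \<Phi>] conjI allI impI ballI)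
    fix n and A :: "('g, 'g \<times> 'g, 'a) cmod"
    assume "cat_module (Lcat G) A"
    from quasi_isomorphism.cohomology_map_iso[OF h_qiso[OF this], of n]
    show "\<Phi> n A \<in> iso (H_E G n A) (Ext (Lcat G) n (ZG G) A)"
      by (simp add: \<Phi>_def H_E_def Ext_eq_cohomology)
  next
    fix n and A A' :: "('g, 'g \<times> 'g, 'a) cmod" and \<alpha> X
    assume A: "cat_module (Lcat G) A" and A': "cat_module (Lcat G) A'"
      and \<alpha>: "\<alpha> \<in> nat_trans (Lcat G) A A'" and X: "X \<in> carrier (H_E G n A)"
    interpret hA: quasi_isomorphism "?CE A" ?\<delta>E "?CL A" ?\<delta>L "h A" by (rule h_qiso[OF A])
    interpret hA': quasi_isomorphism "?CE A'" ?\<delta>E "?CL A'" ?\<delta>L "h A'" by (rule h_qiso[OF A'])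
    interpret \<alpha>E: cochain_map "?CE A" ?\<delta>E "?CE A'" ?\<delta>E
      "\<lambda>n. nt_comp (Ecat G) (res_mod (Ecat G) const_Z n) \<alpha>"
      by (rule cochains_const_Z_postcomp[OF A A' \<alpha>])
    interpret \<alpha>L: cochain_map "?CL A" ?\<delta>L "?CL A'" ?\<delta>L
      "\<lambda>n. nt_comp (Lcat G) (res_mod (Lcat G) (ZG G) n) \<alpha>"
      by (rule cochains_ZG_postcomp[OF A A' \<alpha>])
    obtain z where z: "z \<in> cocycle_set (?CE A) ?\<delta>E n"
      and X_eq: "X = coboundary_set (?CE A) ?\<delta>E n #>\<^bsub>?CE A n\<^esub> z"
      using X unfolding H_E_def Ext_eq_cohomology hA.K.carrier_cohomology by (rule imageE)
    have zc: "z \<in> carrier (?CE A n)" using z hA.K.cocycle_iff by simp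
    show "\<Phi> n A' (H_E_map G n A' \<alpha> X) = Ext_map (Lcat G) n (ZG G) A' \<alpha> (\<Phi> n A X)"
      unfolding \<Phi>_def H_E_map_def Ext_map_eq_cohomology_map X_eq
        \<alpha>E.cohomology_map_coset[OF zc] hA.cohomology_map_coset[OF zc]
        hA'.cohomology_map_coset[OF \<alpha>E.map_closed[OF zc]]
        \<alpha>L.cohomology_map_coset[OF hA.map_closed[OF zc]] h_natural[OF A A' \<alpha> zc] ..
  qed
qed

end
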